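(* Suppose there is a language $L \in \mathrm{coNP}$ such that $L \notin \mathrm{io}\,\mathrm{NP/poly}$. Then every $\mathrm{NP}$-complete language $A$ is complete for $\mathrm{NP}$ via length-increasing $\mathrm{P/poly}$-computable reductions; that is, for every $B\in\mathrm{NP}$ there is a function $f$ computable by a polynomial-size circuit family such that for all $x$, $x\in B\iff f(x)\in A$, and $|f(x)|>|x|$.
   Context: Languages are over $\Sigma=\{0,1\}$; $A_n$ denotes the characteristic sequence of $A$ on strings of length $n$. A language $L$ is in $\mathrm{NP/poly}$ if there is a polynomial-size circuit family $C$ and a polynomial $p$ such that for every $x$, $x\in L$ iff there is $y$ of length $p(|x|)$ with $C(x,y)=1$. For languages $A,B$, write $A =_{\mathrm{io}} B$ if $A_n=B_n$ for infinitely many $n$; for a class $\mathcal{C}$, $A\in\mathrm{io}\,\mathcal{C}$ if there is $B\in\mathcal{C}$ with $A=_{\mathrm{io}}B$. "$\mathrm{NP}$-complete" means complete under polynomial-time many-one reductions. *)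

theory Defs
  imports Main "HOL-Computational_Algebra.Polynomial"
begin

type_synonym lang = "bool list set"

(* Tape symbols: 0 = blank, 1 = bit False, 2 = bit True, 3 = separator.
   States: 0 = start, 1 = halt (accept), 2 = halt (reject). *)

datatype dir = Lft | Rgt | Stay

record tm =
  nstates :: nat
  nsyms   :: nat
  delta   :: "nat \<Rightarrow> nat \<Rightarrow> nat \<times> nat \<times> dir"

definition wf_tm :: "tm \<Rightarrow> bool" where
  "wf_tm M \<longleftrightarrow> nstates M \<ge> 3 \<and> nsyms M \<ge> 4 \<and>
     (\<forall>q < nstates M. \<forall>s < nsyms M.
        fst (delta M q s) < nstates M \<and> fst (snd (delta M q s)) < nsyms M)"

(* configuration: state, reversed left part, head symbol, right part *)
type_synonym config = "nat \<times> nat list \<times> nat \<times> nat list"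

fun move :: "dir \<Rightarrow> nat \<Rightarrow> nat list \<Rightarrow> nat \<Rightarrow> nat list \<Rightarrow> config" where
  "move Stay q ls s rs = (q, ls, s, rs)"
| "move Lft q [] s rs = (q, [], 0, s # rs)"
| "move Lft q (a # ls) s rs = (q, ls, a, s # rs)"
| "move Rgt q ls s [] = (q, s # ls, 0, [])"
| "move Rgt q ls s (a # rs) = (q, s # ls, a, rs)"

definition halting_state :: "nat \<Rightarrow> bool" where
  "halting_state q \<longleftrightarrow> q = 1 \<or> q = 2"

fun step :: "tm \<Rightarrow> config \<Rightarrow> config" where
  "step M (q, ls, h, rs) =
     (if halting_state q then (q, ls, h, rs)
      else (case delta M q h of (q', s', d) \<Rightarrow> move d q' ls s' rs))"

fun init_config :: "nat list \<Rightarrow> config" where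
  "init_config [] = (0, [], 0, [])"
| "init_config (a # w) = (0, [], a, w)"

definition run :: "tm \<Rightarrow> nat \<Rightarrow> nat list \<Rightarrow> config" where
  "run M t w = (step M ^^ t) (init_config w)"

definition enc :: "bool list \<Rightarrow> nat list" where
  "enc x = map (\<lambda>b. if b then 2 else 1) x"

definition halts_within :: "tm \<Rightarrow> nat \<Rightarrow> nat list \<Rightarrow> bool" where
  "halts_within M t w \<longleftrightarrow> halting_state (fst (run M t w))"

definition accepts_within :: "tm \<Rightarrow> nat \<Rightarrow> nat list \<Rightarrow> bool" where
  "accepts_within M t w \<longleftrightarrow> fst (run M t w) = 1"

fun tm_output :: "config \<Rightarrow> bool list" where
  "tm_output (q, ls, h, rs) = map (\<lambda>s. s = 2) (takeWhile (\<lambda>s. s = 1 \<or> s = 2) (h # rs))"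

definition in_NP :: "lang \<Rightarrow> bool" where
  "in_NP L \<longleftrightarrow> (\<exists>M (T :: nat poly) (p :: nat poly). wf_tm M \<and>
     (\<forall>x y. halts_within M (poly T (length (enc x @ 3 # enc y))) (enc x @ 3 # enc y)) \<and>
     (\<forall>x. x \<in> L \<longleftrightarrow> (\<exists>y. length y = poly p (length x) \<and>
            accepts_within M (poly T (length (enc x @ 3 # enc y))) (enc x @ 3 # enc y))))"

definition in_coNP :: "lang \<Rightarrow> bool" where
  "in_coNP L \<longleftrightarrow> in_NP (- L)"

definition FP :: "(bool list \<Rightarrow> bool list) \<Rightarrow> bool" where
  "FP f \<longleftrightarrow> (\<exists>M (T :: nat poly). wf_tm M \<and>
     (\<forall>x. halts_within M (poly T (length x)) (enc x) \<and>
          tm_output (run M (poly T (length x)) (enc x)) = f x))"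

definition NP_complete :: "lang \<Rightarrow> bool" where
  "NP_complete A \<longleftrightarrow> in_NP A \<and>
     (\<forall>B. in_NP B \<longrightarrow> (\<exists>f. FP f \<and> (\<forall>x. x \<in> B \<longleftrightarrow> f x \<in> A)))"

(* gate i may refer to input bits and to wires (values of earlier gates) j < i;
   out-of-range references evaluate to False *)
datatype gate = Inp nat | Cst bool | Neg nat | Conj nat nat | Disj nat nat

record circuit =
  gates :: "gate list"
  outs  :: "nat list"

definition wire :: "bool list \<Rightarrow> nat \<Rightarrow> bool" where
  "wire vs j \<longleftrightarrow> j < length vs \<and> vs ! j"

fun gate_val :: "bool list \<Rightarrow> bool list \<Rightarrow> gate \<Rightarrow> bool" where
  "gate_val x vs (Inp i) = (i < length x \<and> x ! i)"
| "gate_val x vs (Cst b) = b"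
| "gate_val x vs (Neg j) = (\<not> wire vs j)"
| "gate_val x vs (Conj j k) = (wire vs j \<and> wire vs k)"
| "gate_val x vs (Disj j k) = (wire vs j \<or> wire vs k)"

definition eval_gates :: "bool list \<Rightarrow> gate list \<Rightarrow> bool list" where
  "eval_gates x gs = foldl (\<lambda>vs g. vs @ [gate_val x vs g]) [] gs"

definition circ_eval :: "circuit \<Rightarrow> bool list \<Rightarrow> bool list" where
  "circ_eval C x = map (wire (eval_gates x (gates C))) (outs C)"

definition csize :: "circuit \<Rightarrow> nat" where
  "csize C = length (gates C) + length (outs C)"

definition poly_size :: "(nat \<Rightarrow> circuit) \<Rightarrow> bool" where
  "poly_size C \<longleftrightarrow> (\<exists>P :: nat poly. \<forall>n. csize (C n) \<le> poly P n)"

definition circ_accepts :: "circuit \<Rightarrow> bool list \<Rightarrow> bool" where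
  "circ_accepts C x \<longleftrightarrow> circ_eval C x = [True]"

definition in_NPpoly :: "lang \<Rightarrow> bool" where
  "in_NPpoly L \<longleftrightarrow> (\<exists>C (p :: nat poly). poly_size C \<and>
     (\<forall>x. x \<in> L \<longleftrightarrow> (\<exists>y. length y = poly p (length x) \<and> circ_accepts (C (length x)) (x @ y))))"

definition io_eq :: "lang \<Rightarrow> lang \<Rightarrow> bool" where
  "io_eq A B \<longleftrightarrow> infinite {n. \<forall>x. length x = n \<longrightarrow> (x \<in> A \<longleftrightarrow> x \<in> B)}"

definition io_NPpoly :: "lang \<Rightarrow> bool" where
  "io_NPpoly A \<longleftrightarrow> (\<exists>B. in_NPpoly B \<and> io_eq A B)"

(* output decoding for circuits computing functions with variable output length:
   the output bits are read in pairs (v, b); the pair contributes bit b iff v = True *)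
fun decode_pairs :: "bool list \<Rightarrow> bool list" where
  "decode_pairs (v # b # rest) = (if v then b # decode_pairs rest else decode_pairs rest)"
| "decode_pairs _ = []"

definition Ppoly_computable :: "(bool list \<Rightarrow> bool list) \<Rightarrow> bool" where
  "Ppoly_computable f \<longleftrightarrow> (\<exists>C. poly_size C \<and>
     (\<forall>x. decode_pairs (circ_eval (C (length x)) x) = f x))"

end

theory Submission
  imports Defs
begin

text \<open>Let \<open>K\<close> be the complement of \<open>L\<close>, which is in NP, and let \<open>g\<close> reduce satisfiability of
  formulas to \<open>A\<close>. For \<open>x\<close> of length at most \<open>n\<close> and \<open>n + 2\<close> strings \<open>ys\<close> of length \<open>n\<close>, a small
  circuit writes down a formula stating that \<open>x \<in> B\<close> or that some element of \<open>ys\<close> is in \<open>K\<close>; apply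
  \<open>g\<close> to it. If \<open>ys\<close> avoids \<open>K\<close>, the output is in \<open>A\<close> if and only if \<open>x \<in> B\<close>.

  Suppose that a few tuples \<open>ys\<close> over the strings of length \<open>n\<close> in \<open>L\<close> give every \<open>x \<notin> B\<close> an output
  longer than \<open>n\<close>. Then map \<open>x\<close> to its first long output; if there is none, then \<open>x \<in> B\<close>, and any
  fixed long element of \<open>A\<close> will do.

  If no such tuples exist, then greedily, for each set \<open>S\<close> of strings of length \<open>n\<close> in \<open>L\<close> there is
  an \<open>x \<notin> B\<close> for which at least half of all tuples over \<open>S\<close> give an output of length at most \<open>n\<close>. By
  the pigeonhole principle some short \<open>u\<close> is the output for a fraction of \<open>2 ^ -(n + 2)\<close> of the tuples,
  and these tuples involve at least half of \<open>S\<close>. Since \<open>u \<notin> A\<close>, every tuple with output \<open>u\<close> avoids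
  \<open>K\<close>. After \<open>n + 1\<close> rounds this yields advice for recognising \<open>L\<close> at length \<open>n\<close> in NP/poly: guess a
  tuple that contains the input and has one of the recorded outputs. If \<open>A\<close> has no long elements of
  polynomial length, the same argument works with long outputs as one more certificate. By hypothesis
  this happens for finitely many \<open>n\<close> only.\<close>

section \<open>Straight-line programs and circuits\<close>

text \<open>The obstacle is that nothing is known about \<open>g\<close> except that it is a
  reduction: it may shrink formulas and send many of them to one short string. The proof therefore
  profits from both outcomes, long values and collisions.

  The tuple length \<open>n + 2\<close> balances the counting. There are fewer than
  \<open>2 ^ (n + 1)\<close> short values, keeping only the tuples with short value costs another
  factor 2, and a subset with less than half of \<open>S\<close> supports less than a
  \<open>2 ^ -(n + 2)\<close> fraction of the tuples.

  The length \<open>k\<close> of \<open>x\<close> and the length \<open>n\<close> of the strings in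
  \<open>ys\<close> are kept apart, because finitely many \<open>n\<close> remain exceptional while
  inputs of every length must be reduced.

  The same formula is used with \<open>ys\<close> hard-wired (in the reduction) and with
  \<open>x\<close> hard-wired (in the test). Hence it is written by functions that read at most one
  bit each, for which fixing or renaming inputs is free. Its length depends on \<open>n\<close> and
  \<open>k\<close> only, so the machine for \<open>g\<close> is unrolled at a single input length.

  One notion of straight-line program serves twice: it is turned into circuits, and into the
  formulas that circuits write down.\<close>

definition poly_bounded :: "(nat \<Rightarrow> nat) \<Rightarrow> bool" where
  "poly_bounded f \<longleftrightarrow> (\<exists>P :: nat poly. \<forall>n. f n \<le> poly P n)"

lemma poly_nat_mono: "x \<le> y \<Longrightarrow> poly p x \<le> poly p y" for p :: "nat poly"
  by (induction p) (auto intro!: add_mono mult_mono)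

lemma poly_bounded_const: "poly_bounded (\<lambda>_. c)"
  unfolding poly_bounded_def by (rule exI[of _ "[:c:]"]) simp

lemma poly_bounded_id: "poly_bounded (\<lambda>n. n)"
  unfolding poly_bounded_def by (rule exI[of _ "[:0, 1:]"]) simp

lemma poly_bounded_add: "poly_bounded f \<Longrightarrow> poly_bounded g \<Longrightarrow> poly_bounded (\<lambda>n. f n + g n)"
  unfolding poly_bounded_def by (metis add_mono poly_add)

lemma poly_bounded_mult: "poly_bounded f \<Longrightarrow> poly_bounded g \<Longrightarrow> poly_bounded (\<lambda>n. f n * g n)"
  unfolding poly_bounded_def by (metis mult_le_mono poly_mult)

lemma poly_bounded_poly: "poly_bounded f \<Longrightarrow> poly_bounded (\<lambda>n. poly p (f n))"
  unfolding poly_bounded_def by (metis poly_nat_mono poly_pcompose)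

lemma poly_bounded_Suc: "poly_bounded f \<Longrightarrow> poly_bounded (\<lambda>n. Suc (f n))"
  using poly_bounded_add[OF _ poly_bounded_const[of 1]] by simp

lemmas poly_bounded_intros = poly_bounded_const poly_bounded_id poly_bounded_add
  poly_bounded_mult poly_bounded_poly poly_bounded_Suc

text \<open>Straight-line programs, represented by the functions that their wires compute. Functions matter
  only on inputs of length \<open>m\<close>.\<close>

inductive slp :: "nat \<Rightarrow> (bool list \<Rightarrow> bool) list \<Rightarrow> bool" for m where
  Nil: "slp m []"
| Inp: "slp m fs \<Longrightarrow> i < m \<Longrightarrow> (\<And>x. length x = m \<Longrightarrow> h x = x ! i) \<Longrightarrow> slp m (fs @ [h])"
| Cst: "slp m fs \<Longrightarrow> (\<And>x. length x = m \<Longrightarrow> h x = b) \<Longrightarrow> slp m (fs @ [h])"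
| Neg: "slp m fs \<Longrightarrow> f \<in> set fs \<Longrightarrow> (\<And>x. length x = m \<Longrightarrow> h x = (\<not> f x)) \<Longrightarrow> slp m (fs @ [h])"
| Conj: "slp m fs \<Longrightarrow> f \<in> set fs \<Longrightarrow> g \<in> set fs \<Longrightarrow>
    (\<And>x. length x = m \<Longrightarrow> h x = (f x \<and> g x)) \<Longrightarrow> slp m (fs @ [h])"

lemma eval_gates_snoc:
  "eval_gates x (gs @ [g]) = eval_gates x gs @ [gate_val x (eval_gates x gs) g]"
  by (simp add: eval_gates_def)

lemma slp_gates:
  assumes "slp m fs"
  shows "\<exists>gs. length gs = length fs \<and>
           (\<forall>x. length x = m \<longrightarrow> eval_gates x gs = map (\<lambda>f. f x) fs)"
  using assms
proof (induction rule: slp.induct)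
  case Nil
  then show ?case by (simp add: eval_gates_def)
next
  case (Inp fs i h)
  then obtain gs where gs: "length gs = length fs"
    "\<And>x. length x = m \<Longrightarrow> eval_gates x gs = map (\<lambda>f. f x) fs" by blast
  show ?case
    by (rule exI[of _ "gs @ [gate.Inp i]"]) (use gs Inp in \<open>auto simp: eval_gates_snoc\<close>)
next
  case (Cst fs h b)
  then obtain gs where gs: "length gs = length fs"
    "\<And>x. length x = m \<Longrightarrow> eval_gates x gs = map (\<lambda>f. f x) fs" by blast
  show ?case
    by (rule exI[of _ "gs @ [gate.Cst b]"]) (use gs Cst in \<open>auto simp: eval_gates_snoc\<close>)
next
  case (Neg fs f h)
  then obtain gs where gs: "length gs = length fs"
    "\<And>x. length x = m \<Longrightarrow> eval_gates x gs = map (\<lambda>f. f x) fs" by blast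
  from Neg obtain i where "i < length fs" "fs ! i = f" by (auto simp: in_set_conv_nth)
  then show ?case
    by (intro exI[of _ "gs @ [gate.Neg i]"]) (use gs Neg in \<open>auto simp: eval_gates_snoc wire_def\<close>)
next
  case (Conj fs f g h)
  then obtain gs where gs: "length gs = length fs"
    "\<And>x. length x = m \<Longrightarrow> eval_gates x gs = map (\<lambda>f. f x) fs" by blast
  from Conj obtain i j where "i < length fs" "fs ! i = f" "j < length fs" "fs ! j = g"
    by (auto simp: in_set_conv_nth)
  then show ?case
    by (intro exI[of _ "gs @ [gate.Conj i j]"]) (use gs Conj in \<open>auto simp: eval_gates_snoc wire_def\<close>)
qed

text \<open>Once all functions in \<open>F\<close> are available on wires, \<open>c\<close> further gates suffice for those in \<open>G\<close>.\<close>

definition ext :: "nat \<Rightarrow> (bool list \<Rightarrow> bool) set \<Rightarrow> nat \<Rightarrow> (bool list \<Rightarrow> bool) set \<Rightarrow> bool" where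
  "ext m F c G \<longleftrightarrow> (\<forall>fs. slp m fs \<and> F \<subseteq> set fs \<longrightarrow>
     (\<exists>gs. slp m (fs @ gs) \<and> length gs \<le> c \<and> G \<subseteq> set (fs @ gs)))"

lemma extI:
  assumes "\<And>fs. slp m fs \<Longrightarrow> F \<subseteq> set fs \<Longrightarrow>
    \<exists>gs. slp m (fs @ gs) \<and> length gs \<le> c \<and> G \<subseteq> set (fs @ gs)"
  shows "ext m F c G"
  using assms unfolding ext_def by blast

lemma extE:
  assumes "ext m F c G" "slp m fs" "F \<subseteq> set fs"
  obtains gs where "slp m (fs @ gs)" "length gs \<le> c" "G \<subseteq> set (fs @ gs)"
  using assms unfolding ext_def by blast

lemma ext_mono: "ext m F c G \<Longrightarrow> F \<subseteq> F' \<Longrightarrow> c \<le> c' \<Longrightarrow> G' \<subseteq> G \<Longrightarrow> ext m F' c' G'"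
  unfolding ext_def by (meson order_trans)

lemma ext_refl: "G \<subseteq> F \<Longrightarrow> ext m F 0 G"
  by (rule extI) (auto intro: exI[of _ "[]"])

lemma ext_trans:
  assumes "ext m F c G" "ext m (F \<union> G) c' H"
  shows "ext m F (c + c') H"
proof (rule extI)
  fix fs assume fs: "slp m fs" "F \<subseteq> set fs"
  obtain gs where gs: "slp m (fs @ gs)" "length gs \<le> c" "G \<subseteq> set (fs @ gs)"
    using extE[OF assms(1) fs] .
  have "F \<union> G \<subseteq> set (fs @ gs)" using gs fs by auto
  from extE[OF assms(2) gs(1) this] obtain hs where
    "slp m ((fs @ gs) @ hs)" "length hs \<le> c'" "H \<subseteq> set ((fs @ gs) @ hs)" .
  then show "\<exists>gs. slp m (fs @ gs) \<and> length gs \<le> c + c' \<and> H \<subseteq> set (fs @ gs)"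
    using gs by (intro exI[of _ "gs @ hs"]) auto
qed

lemma ext_Un:
  assumes "ext m F c G" "ext m F c' H"
  shows "ext m F (c + c') (G \<union> H)"
proof (rule extI)
  fix fs assume fs: "slp m fs" "F \<subseteq> set fs"
  obtain gs where gs: "slp m (fs @ gs)" "length gs \<le> c" "G \<subseteq> set (fs @ gs)"
    using extE[OF assms(1) fs] .
  have "F \<subseteq> set (fs @ gs)" using fs by auto
  from extE[OF assms(2) gs(1) this] obtain hs where
    "slp m ((fs @ gs) @ hs)" "length hs \<le> c'" "H \<subseteq> set ((fs @ gs) @ hs)" .
  then show "\<exists>gs. slp m (fs @ gs) \<and> length gs \<le> c + c' \<and> G \<union> H \<subseteq> set (fs @ gs)"
    using gs by (intro exI[of _ "gs @ hs"]) auto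
qed

lemma ext_chain:
  assumes "ext m F c G" "ext m (F \<union> G) c' H"
  shows "ext m F (c + c') (G \<union> H)"
proof -
  have "ext m (F \<union> G) (0 + c') (G \<union> H)"
    by (rule ext_Un[OF ext_refl assms(2)]) auto
  then show ?thesis using ext_trans[OF assms(1)] by simp
qed

lemma ext_UN:
  assumes "finite I" "\<And>i. i \<in> I \<Longrightarrow> ext m F c (G i)"
  shows "ext m F (card I * c) (\<Union>i\<in>I. G i)"
  using assms
proof (induction rule: finite_induct)
  case empty
  then show ?case by (simp add: ext_refl)
next
  case (insert i I)
  then have "ext m F (c + card I * c) (G i \<union> (\<Union>i\<in>I. G i))"
    by (intro ext_Un) auto
  with insert show ?case by simp
qed

definition inputs :: "nat \<Rightarrow> (bool list \<Rightarrow> bool) set" where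
  "inputs m = (\<lambda>i x. x ! i) ` {..<m}"

lemma ext_inputs: "ext m {} m (inputs m)"
proof -
  have "ext m {} 1 {\<lambda>x. x ! i}" if "i < m" for i
    by (rule extI) (use that in \<open>auto intro!: exI[of _ "[\<lambda>x. x ! i]"] slp.Inp\<close>)
  then have "ext m {} (card {..<m} * 1) (\<Union>i\<in>{..<m}. {\<lambda>x. x ! i})"
    by (intro ext_UN) auto
  moreover have "(\<Union>i\<in>{..<m}. {\<lambda>x. x ! i}) = inputs m" by (auto simp: inputs_def)
  ultimately show ?thesis by simp
qed

lemma ext_slp:
  assumes "ext m (inputs m) c G"
  obtains fs where "slp m fs" "length fs \<le> m + c" "G \<subseteq> set fs"
proof -
  have "ext m {} (m + c) G" using ext_trans[OF ext_inputs] assms by simp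
  from extE[OF this slp.Nil] show ?thesis using that by auto
qed

lemma ext_circuit:
  assumes "ext m (inputs m) c (set hs)"
  obtains C where "csize C \<le> m + c + length hs"
    "\<And>x. length x = m \<Longrightarrow> circ_eval C x = map (\<lambda>h. h x) hs"
proof -
  obtain fs where fs: "slp m fs" "length fs \<le> m + c" "set hs \<subseteq> set fs"
    using ext_slp[OF assms] .
  obtain gs where gs: "length gs = length fs"
    "\<And>x. length x = m \<Longrightarrow> eval_gates x gs = map (\<lambda>f. f x) fs"
    using slp_gates[OF fs(1)] by blast
  have "\<forall>h\<in>set hs. \<exists>i<length fs. fs ! i = h" using fs(3) by (auto simp: in_set_conv_nth subset_iff)
  then obtain ix where ix: "\<And>h. h \<in> set hs \<Longrightarrow> ix h < length fs \<and> fs ! ix h = h" by metis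
  define C where "C = \<lparr>gates = gs, outs = map ix hs\<rparr>"
  have "csize C \<le> m + c + length hs" using fs gs by (simp add: C_def csize_def)
  moreover have "circ_eval C x = map (\<lambda>h. h x) hs" if "length x = m" for x
    using ix gs(2)[OF that] by (auto simp: circ_eval_def C_def wire_def)
  ultimately show ?thesis using that by blast
qed

text \<open>The value type is arbitrary, so that states and tape symbols can be treated as functions
  of the input before they are turned into Boolean wires.\<close>

definition det :: "nat \<Rightarrow> (bool list \<Rightarrow> bool) set \<Rightarrow> (bool list \<Rightarrow> 'a) \<Rightarrow> bool" where
  "det m D h \<longleftrightarrow> (\<forall>x x'. length x = m \<and> length x' = m \<and> (\<forall>f\<in>D. f x = f x') \<longrightarrow> h x = h x')"

lemma detI:
  assumes "\<And>x x'. length x = m \<Longrightarrow> length x' = m \<Longrightarrow> (\<And>f. f \<in> D \<Longrightarrow> f x = f x') \<Longrightarrow> h x = h x'"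
  shows "det m D h"
  unfolding det_def
proof (intro allI impI)
  fix x x' assume "length x = m \<and> length x' = m \<and> (\<forall>f\<in>D. f x = f x')"
  then show "h x = h x'" by (intro assms) auto
qed

lemma det_comp: "det m D h \<Longrightarrow> det m D (\<lambda>x. P (h x))"
  unfolding det_def
proof (intro allI impI)
  fix x x' assume "\<forall>x x'. length x = m \<and> length x' = m \<and> (\<forall>f\<in>D. f x = f x') \<longrightarrow> h x = h x'"
    "length x = m \<and> length x' = m \<and> (\<forall>f\<in>D. f x = f x')"
  then have "h x = h x'" by blast
  then show "P (h x) = P (h x')" by simp
qed

text \<open>Bounds the number of gates for an arbitrary function of \<open>k\<close> bits.\<close>

definition lcost :: "nat \<Rightarrow> nat" where "lcost k = 8 * 2 ^ k - 7"

lemma lcost_mono: "k \<le> l \<Longrightarrow> lcost k \<le> lcost l"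
  unfolding lcost_def by (intro diff_le_mono mult_le_mono2 power_increasing) auto

lemma lcost_pos: "1 \<le> lcost k"
proof -
  have "(1::nat) \<le> 2 ^ k" by simp
  then show ?thesis unfolding lcost_def by linarith
qed

text \<open>The recurrence behind the closed form: two cofactors, then seven gates that choose
  between them.\<close>

lemma lcost_Suc: "lcost (Suc k) = 2 * lcost k + 7"
proof -
  have "(1::nat) \<le> 2 ^ k" by simp
  then show ?thesis unfolding lcost_def power_Suc by linarith
qed

text \<open>Shannon expansion.\<close>

lemma ext_det_card:
  assumes "finite D" "D \<subseteq> F" "det m D h"
  shows "ext m F (lcost (card D)) {h}"
  using assms
proof (induction D arbitrary: h F rule: finite_induct)
  case empty
  define b where "b = h (replicate m False)"
  have "h x = b" if "length x = m" for x
    using empty(2) that unfolding det_def b_def by (metis empty_iff length_replicate)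
  then have "slp m (fs @ [h])" if "slp m fs" for fs using that by (blast intro: slp.Cst)
  then show ?case using lcost_pos[of 0] by (intro extI exI[of _ "[h]"]) auto
next
  case (insert d D)
  \<comment> \<open>The cofactor of \<open>h\<close> for \<open>d = b\<close>. As \<open>d\<close>
    may depend on \<open>D\<close>, some combinations of values belong to no input; the existential
    makes the cofactor False there, and no input selects it.\<close>
  define hb where "hb b x = (\<exists>x'. length x' = m \<and> d x' = b \<and> (\<forall>g\<in>D. g x' = g x) \<and> h x')" for b x
  have hb_det: "det m D (hb b)" for b
  proof (rule detI)
    fix x x' :: "bool list" assume D: "\<And>f. f \<in> D \<Longrightarrow> f x = f x'"
    have "(\<forall>g\<in>D. g y = g x) \<longleftrightarrow> (\<forall>g\<in>D. g y = g x')" for y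
      by (intro ball_cong refl) (simp add: D)
    then show "hb b x = hb b x'" unfolding hb_def by simp
  qed
  have hb_eq: "h x = hb (d x) x" if "length x = m" for x
  proof
    assume "h x" then show "hb (d x) x" unfolding hb_def using that by blast
  next
    assume "hb (d x) x"
    then obtain x' where "length x' = m" "d x' = d x" "\<forall>g\<in>D. g x' = g x" "h x'"
      unfolding hb_def by blast
    then have "h x' = h x"
      by (intro insert.prems(2)[unfolded det_def, rule_format]) (use that in auto)
    with \<open>h x'\<close> show "h x" by simp
  qed
  have 1: "ext m F (lcost (card D) + lcost (card D)) ({hb True} \<union> {hb False})"
    by (intro ext_Un insert.IH hb_det) (use insert.prems in auto)
  have 2: "ext m (F \<union> ({hb True} \<union> {hb False})) 7 {h}"
  proof (rule extI)
    fix fs assume fs: "slp m fs" "F \<union> ({hb True} \<union> {hb False}) \<subseteq> set fs"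
    \<comment> \<open>A multiplexer from negations and conjunctions only, since \<open>slp\<close>
      has no rule for disjunctions.\<close>
    define a1 where "a1 x = (d x \<and> hb True x)" for x
    define a2 where "a2 x = (\<not> a1 x)" for x
    define a3 where "a3 x = (\<not> d x)" for x
    define a4 where "a4 x = (a3 x \<and> hb False x)" for x
    define a5 where "a5 x = (\<not> a4 x)" for x
    define a6 where "a6 x = (a2 x \<and> a5 x)" for x
    have d: "d \<in> set fs" "hb True \<in> set fs" "hb False \<in> set fs" using insert.prems fs by auto
    have s1: "slp m (fs @ [a1])" by (rule slp.Conj[of _ _ d "hb True"]) (use fs d in \<open>auto simp: a1_def\<close>)
    have s2: "slp m ((fs @ [a1]) @ [a2])" by (rule slp.Neg[OF s1, of a1]) (auto simp: a2_def)
    have s3: "slp m (((fs @ [a1]) @ [a2]) @ [a3])" by (rule slp.Neg[OF s2, of d]) (use d in \<open>auto simp: a3_def\<close>)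
    have s4: "slp m ((((fs @ [a1]) @ [a2]) @ [a3]) @ [a4])"
      by (rule slp.Conj[OF s3, of a3 "hb False"]) (use d in \<open>auto simp: a4_def\<close>)
    have s5: "slp m (((((fs @ [a1]) @ [a2]) @ [a3]) @ [a4]) @ [a5])"
      by (rule slp.Neg[OF s4, of a4]) (auto simp: a5_def)
    have s6: "slp m ((((((fs @ [a1]) @ [a2]) @ [a3]) @ [a4]) @ [a5]) @ [a6])"
      by (rule slp.Conj[OF s5, of a2 a5]) (auto simp: a6_def)
    have "h x = (\<not> a6 x)" if "length x = m" for x
      using hb_eq[OF that] by (cases "d x") (simp_all add: a1_def a2_def a3_def a4_def a5_def a6_def)
    then have s7: "slp m (((((((fs @ [a1]) @ [a2]) @ [a3]) @ [a4]) @ [a5]) @ [a6]) @ [h])"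
      by (intro slp.Neg[OF s6, of a6]) auto
    then show "\<exists>gs. slp m (fs @ gs) \<and> length gs \<le> 7 \<and> {h} \<subseteq> set (fs @ gs)"
      by (intro exI[of _ "[a1, a2, a3, a4, a5, a6, h]"]) auto
  qed
  have "ext m F (lcost (card D) + lcost (card D) + 7) {h}"
    using ext_trans[OF 1 2] .
  then show ?case unfolding card_insert_disjoint[OF insert.hyps] lcost_Suc mult_2 .
qed

text \<open>The \<open>k\<close>-juntas over the wires in \<open>F\<close>. For fixed
  \<open>k\<close> they cost a constant number of gates, so later constructions only have to exhibit
  locality.\<close>

definition loc :: "nat \<Rightarrow> (bool list \<Rightarrow> bool) set \<Rightarrow> nat \<Rightarrow> (bool list \<Rightarrow> 'a) \<Rightarrow> bool" where
  "loc m F k h \<longleftrightarrow> (\<exists>D \<subseteq> F. finite D \<and> card D \<le> k \<and> det m D h)"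

lemma locI: "D \<subseteq> F \<Longrightarrow> finite D \<Longrightarrow> card D \<le> k \<Longrightarrow> det m D h \<Longrightarrow> loc m F k h"
  unfolding loc_def by blast

lemma loc_comp: "loc m F k h \<Longrightarrow> loc m F k (\<lambda>x. P (h x))"
  unfolding loc_def using det_comp by blast

lemma loc_mono: "loc m F k h \<Longrightarrow> F \<subseteq> F' \<Longrightarrow> k \<le> k' \<Longrightarrow> loc m F' k' h"
  unfolding loc_def by (meson order_trans)

lemma loc_const: "loc m F k (\<lambda>_. c)"
  by (rule locI[of "{}"]) (auto simp: det_def)

lemma det_cong: "(\<And>x. length x = m \<Longrightarrow> h x = h' x) \<Longrightarrow> det m D h \<longleftrightarrow> det m D h'"
  unfolding det_def by (intro iff_allI imp_cong refl) simp

lemma loc_cong: "(\<And>x. length x = m \<Longrightarrow> h x = h' x) \<Longrightarrow> loc m F k h \<longleftrightarrow> loc m F k h'"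
  using det_cong[of m h h'] unfolding loc_def by simp

lemma loc_mem: "f \<in> F \<Longrightarrow> loc m F 1 f"
  by (rule locI[of "{f}"]) (auto simp: det_def)

lemma loc_op:
  assumes "loc m F k f" "loc m F l g"
  shows "loc m F (k + l) (\<lambda>x. P (f x) (g x))"
proof -
  obtain D E where "D \<subseteq> F" "finite D" "card D \<le> k" "det m D f"
    "E \<subseteq> F" "finite E" "card E \<le> l" "det m E g"
    using assms unfolding loc_def by blast
  moreover have "card (D \<union> E) \<le> k + l"
    using card_Un_le[of D E] calculation by linarith
  moreover have "det m (D \<union> E) (\<lambda>x. P (f x) (g x))"
  proof (rule detI)
    fix x x' assume "length x = m" "length x' = m" "\<And>h. h \<in> D \<union> E \<Longrightarrow> h x = h x'"
    then have "f x = f x'" "g x = g x'"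
      using calculation(4,8) unfolding det_def by simp_all
    then show "P (f x) (g x) = P (f x') (g x')" by simp
  qed
  ultimately show ?thesis by (intro locI[of "D \<union> E"]) auto
qed

lemma ext_loc: "loc m F k h \<Longrightarrow> ext m F (lcost k) {h}"
proof -
  assume "loc m F k h"
  then obtain D where D: "D \<subseteq> F" "finite D" "card D \<le> k" "det m D h" unfolding loc_def by blast
  show ?thesis
    using ext_det_card[OF D(2,1,4)] by (rule ext_mono) (use lcost_mono[OF D(3)] in auto)
qed

lemma ext_locs:
  assumes "finite G" "card G \<le> c" "\<And>g. g \<in> G \<Longrightarrow> loc m F k g"
  shows "ext m F (c * lcost k) G"
proof -
  have "ext m F (card G * lcost k) (\<Union>g\<in>G. {g})"
    by (intro ext_UN assms(1) ext_loc assms(3))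
  then show ?thesis by (rule ext_mono) (use assms in auto)
qed

text \<open>The conjunction is built as a chain: each round is a junta on \<open>k + 1\<close>
  wires, those of \<open>f i\<close> and the one for the partial conjunction so far.\<close>

lemma ext_ball:
  assumes "finite I" "\<And>i. i \<in> I \<Longrightarrow> loc m F k (f i)"
  shows "ext m F (Suc (card I) * lcost (Suc k)) {\<lambda>x. \<forall>i\<in>I. f i x}"
  using assms
proof (induction rule: finite_induct)
  case empty
  have "ext m F (lcost (Suc k)) {\<lambda>x. True}" by (rule ext_loc[OF loc_const])
  then show ?case by simp
next
  case (insert i I)
  let ?h = "\<lambda>x. \<forall>i\<in>I. f i x"
  have "loc m (F \<union> {?h}) k (f i)"
    by (rule loc_mono[of m F k], rule insert.prems) auto
  moreover have "loc m (F \<union> {?h}) 1 ?h" by (rule loc_mem) auto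
  ultimately have "loc m (F \<union> {?h}) (k + 1) (\<lambda>x. f i x \<and> ?h x)"
    by (rule loc_op[where P = "(\<and>)"])
  then have "ext m (F \<union> {?h}) (lcost (Suc k)) {\<lambda>x. f i x \<and> ?h x}" by (intro ext_loc) simp
  then have "ext m F (Suc (card I) * lcost (Suc k) + lcost (Suc k)) {\<lambda>x. f i x \<and> ?h x}"
    by (rule ext_trans[rotated], intro insert.IH insert.prems insertI2)
  then show ?case using insert.hyps by (simp add: add.commute add.left_commute)
qed

lemma ext_bex:
  assumes "finite I" "\<And>i. i \<in> I \<Longrightarrow> loc m F k (f i)"
  shows "ext m F (Suc (card I) * lcost (Suc k) + lcost 1) {\<lambda>x. \<exists>i\<in>I. f i x}"
proof -
  let ?h = "\<lambda>x. \<forall>i\<in>I. \<not> f i x"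
  have 1: "ext m F (Suc (card I) * lcost (Suc k)) {?h}"
    by (rule ext_ball[OF assms(1)], rule loc_comp[where P = Not], rule assms(2))
  have "loc m (F \<union> {?h}) 1 (\<lambda>x. \<not> ?h x)"
    by (rule loc_comp[where P = Not], rule loc_mem) simp
  then have "ext m (F \<union> {?h}) (lcost 1) {\<lambda>x. \<not> ?h x}" by (rule ext_loc)
  from ext_trans[OF 1 this] show ?thesis by simp
qed

section \<open>Circuits for Turing machines\<close>

definition nth_blank :: "nat list \<Rightarrow> nat \<Rightarrow> nat" where
  "nth_blank xs k = (if k < length xs then xs ! k else 0)"

lemma nth_blank_Nil [simp]: "nth_blank [] k = 0"
  by (simp add: nth_blank_def)

lemma nth_blank_0 [simp]: "nth_blank (a # xs) 0 = a"
  by (simp add: nth_blank_def)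

lemma nth_blank_Cons: "nth_blank (a # xs) (nat i) = (if i \<le> 0 then a else nth_blank xs (nat (i - 1)))"
proof (cases "i \<le> 0")
  case False
  then have "nat i = Suc (nat (i - 1))" by linarith
  with False show ?thesis by (simp add: nth_blank_def)
qed (simp add: nth_blank_def)

text \<open>Head-relative coordinates: cell 0 is under the head, negative cells are to its left.\<close>

definition cell :: "config \<Rightarrow> int \<Rightarrow> nat" where
  "cell c i = (case c of (q, ls, h, rs) \<Rightarrow>
     if i = 0 then h else if i > 0 then nth_blank rs (nat (i - 1)) else nth_blank ls (nat (- i - 1)))"

fun offset :: "dir \<Rightarrow> int" where
  "offset Stay = 0"
| "offset Lft = - 1"
| "offset Rgt = 1"

lemma cell_move:
  "cell (move d q ls s rs) i =
     (if i + offset d = 0 then s else cell (q', ls, h, rs) (i + offset d))"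
proof (cases d)
  case Lft
  then show ?thesis
    by (cases ls) (auto simp: cell_def nth_blank_Cons algebra_simps)
next
  case Rgt
  then show ?thesis
    by (cases rs) (auto simp: cell_def nth_blank_Cons algebra_simps)
next
  case Stay
  then show ?thesis by (simp add: cell_def)
qed

lemma fst_move [simp]: "fst (move d q ls s rs) = q"
  by (cases d; cases ls; cases rs) auto

lemma fst_step:
  "fst (step M c) = (if halting_state (fst c) then fst c else fst (delta M (fst c) (cell c 0)))"
  by (cases c) (auto simp: cell_def split: prod.splits)

lemma cell_step:
  "cell (step M c) i =
     (if halting_state (fst c) then cell c i
      else (case delta M (fst c) (cell c 0) of (q, s, d) \<Rightarrow>
        if i + offset d = 0 then s else cell c (i + offset d)))"
proof (cases c)
  case (fields q ls h rs)
  then show ?thesis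
    by (auto simp: cell_def[of "(q, ls, h, rs)" 0] split: prod.splits
        simp: cell_move[of _ _ ls _ rs _ q h])
qed

lemma offset_cases: "offset d = 0 \<or> offset d = 1 \<or> offset d = - 1"
  by (cases d) auto

lemma cell_init: "cell (init_config w) i = (if 0 \<le> i then nth_blank w (nat i) else 0)"
  by (cases w) (auto simp: cell_def nth_blank_Cons)

lemma fst_init [simp]: "fst (init_config w) = 0"
  by (cases w) auto

lemma run_0 [simp]: "run M 0 w = init_config w"
  by (simp add: run_def)

lemma run_Suc: "run M (Suc t) w = step M (run M t w)"
  by (simp add: run_def)

text \<open>Within these bounds finitely many bits describe the configuration. The window is centred
  at the head, so a mere move may already require one more cell.\<close>

definition tame :: "tm \<Rightarrow> nat \<Rightarrow> config \<Rightarrow> bool" where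
  "tame M N c \<longleftrightarrow> fst c < nstates M \<and> (\<forall>i. cell c i < nsyms M) \<and> (\<forall>i. int N < \<bar>i\<bar> \<longrightarrow> cell c i = 0)"

lemma tame_mono: "tame M N c \<Longrightarrow> N \<le> N' \<Longrightarrow> tame M N' c"
  unfolding tame_def by fastforce

lemma tame_step:
  assumes "wf_tm M" "tame M N c"
  shows "tame M (Suc N) (step M c)"
proof -
  obtain q s d where d: "delta M (fst c) (cell c 0) = (q, s, d)" by (cases "delta M (fst c) (cell c 0)")
  have "q < nstates M" "s < nsyms M"
    using assms d unfolding wf_tm_def tame_def by (metis fst_conv snd_conv)+
  then show ?thesis
    using assms(2) offset_cases[of d] unfolding tame_def fst_step cell_step by (auto simp: d)
qed

lemma tame_run:
  assumes "wf_tm M" "set w \<subseteq> {..<nsyms M}"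
  shows "tame M (length w + t) (run M t w)"
proof (induction t)
  case 0
  have "0 < nstates M" "0 < nsyms M" using assms(1) by (auto simp: wf_tm_def)
  moreover have "w ! k < nsyms M" if "k < length w" for k using nth_mem[OF that] assms(2) by auto
  ultimately show ?case by (auto simp: tame_def cell_init nth_blank_def)
next
  case (Suc t)
  then show ?case using tame_step[OF assms(1)] by (simp add: run_Suc)
qed

section \<open>Configurations as sets of wires\<close>

definition state_bit :: "(bool list \<Rightarrow> config) \<Rightarrow> nat \<Rightarrow> bool list \<Rightarrow> bool" where
  "state_bit cfg q x \<longleftrightarrow> fst (cfg x) = q"

definition cell_bit :: "(bool list \<Rightarrow> config) \<Rightarrow> int \<times> nat \<Rightarrow> bool list \<Rightarrow> bool" where
  "cell_bit cfg p x \<longleftrightarrow> cell (cfg x) (fst p) = snd p"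

text \<open>A one-hot code of state and symbols. Head-relative coordinates spare the head position:
  a move shifts the window by at most one cell, so the next contents of a cell depend on a bounded
  number of bits.\<close>

definition conf_bits :: "tm \<Rightarrow> nat \<Rightarrow> (bool list \<Rightarrow> config) \<Rightarrow> (bool list \<Rightarrow> bool) set" where
  "conf_bits M N cfg = state_bit cfg ` {..<nstates M} \<union>
     cell_bit cfg ` ({- int N..int N} \<times> {..<nsyms M})"

lemma finite_conf_bits: "finite (conf_bits M N cfg)"
  by (simp add: conf_bits_def)

lemma card_conf_bits: "card (conf_bits M N cfg) \<le> nstates M + (2 * N + 1) * nsyms M"
proof -
  have "card (state_bit cfg ` {..<nstates M}) \<le> nstates M"
    using card_image_le[of "{..<nstates M}" "state_bit cfg"] by simp
  moreover have "card (cell_bit cfg ` ({- int N..int N} \<times> {..<nsyms M})) \<le> (2 * N + 1) * nsyms M"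
    using card_image_le[of "{- int N..int N} \<times> {..<nsyms M}" "cell_bit cfg"]
    by (simp add: card_cartesian_product nat_add_distrib nat_mult_distrib)
  ultimately show ?thesis
    unfolding conf_bits_def by (meson add_mono card_Un_le order_trans)
qed

text \<open>The bound counts the state bits and the bits of the cells 0, \<open>i - 1\<close>, \<open>i\<close> and \<open>i + 1\<close>.\<close>

lemma loc_step:
  assumes tame: "\<And>x. length x = m \<Longrightarrow> tame M N (cfg x)"
    and g: "g \<in> conf_bits M N' (\<lambda>x. step M (cfg x))"
  shows "loc m (conf_bits M N cfg) (nstates M + 4 * nsyms M) g"
proof -
  have key: "loc m (conf_bits M N cfg) (nstates M + 4 * nsyms M)
      (\<lambda>x. (fst (step M (cfg x)), cell (step M (cfg x)) i))" for i
  proof -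
    define J where "J = {0, i - 1, i, i + 1} \<inter> {- int N..int N}"
    define D where "D = state_bit cfg ` {..<nstates M} \<union> cell_bit cfg ` (J \<times> {..<nsyms M})"
    have sub: "D \<subseteq> conf_bits M N cfg" unfolding D_def conf_bits_def J_def by blast
    have fin: "finite D" by (simp add: D_def J_def)
    have "card J \<le> card {0, i - 1, i, i + 1}" unfolding J_def by (intro card_mono) auto
    also have "\<dots> \<le> 4" by (simp add: card_insert_if)
    finally have "card J \<le> 4" .
    have "card (cell_bit cfg ` (J \<times> {..<nsyms M})) \<le> card (J \<times> {..<nsyms M})"
      by (rule card_image_le) (simp add: J_def)
    also have "\<dots> \<le> 4 * nsyms M"
      using \<open>card J \<le> 4\<close> by (simp add: card_cartesian_product)
    finally have "card D \<le> nstates M + 4 * nsyms M"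
      unfolding D_def using card_image_le[of "{..<nstates M}" "state_bit cfg"]
      by (intro order_trans[OF card_Un_le] add_mono) auto
    moreover have "det m D (\<lambda>x. (fst (step M (cfg x)), cell (step M (cfg x)) i))"
    proof (rule detI)
      fix x x' assume x: "length x = m" "length x' = m" and eq: "\<And>f. f \<in> D \<Longrightarrow> f x = f x'"
      have "fst (cfg x) < nstates M" using tame[OF x(1)] by (simp add: tame_def)
      then have st: "fst (cfg x') = fst (cfg x)"
        using eq[of "state_bit cfg (fst (cfg x))"] by (auto simp: D_def state_bit_def)
      have ce: "cell (cfg x') j = cell (cfg x) j" if "j \<in> {0, i - 1, i, i + 1}" for j
      proof (cases "j \<in> {- int N..int N}")
        case True
        have "cell (cfg x) j < nsyms M" using tame[OF x(1)] by (simp add: tame_def)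
        with True that have "cell_bit cfg (j, cell (cfg x) j) \<in> D"
          unfolding D_def J_def by blast
        from eq[OF this] show ?thesis by (simp add: cell_bit_def)
      next
        case False
        then have "int N < \<bar>j\<bar>" by auto
        then show ?thesis using tame[OF x(1)] tame[OF x(2)] by (simp add: tame_def)
      qed
      obtain q s d where d: "delta M (fst (cfg x)) (cell (cfg x) 0) = (q, s, d)"
        by (cases "delta M (fst (cfg x)) (cell (cfg x) 0)")
      have "cell (cfg x') (i + offset d) = cell (cfg x) (i + offset d)"
        using offset_cases[of d] by (intro ce) auto
      then show "(fst (step M (cfg x)), cell (step M (cfg x)) i) =
          (fst (step M (cfg x')), cell (step M (cfg x')) i)"
        unfolding fst_step cell_step using st ce[of 0] ce[of i] by (simp add: d)
    qed
    ultimately show ?thesis by (intro locI[OF sub fin])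
  qed
  from g consider q where "g = state_bit (\<lambda>x. step M (cfg x)) q"
    | i s where "g = cell_bit (\<lambda>x. step M (cfg x)) (i, s)"
    unfolding conf_bits_def by blast
  then show ?thesis
  proof cases
    case 1
    have "g = (\<lambda>x. (\<lambda>p. fst p = q) (fst (step M (cfg x)), cell (step M (cfg x)) 0))"
      unfolding 1 state_bit_def by simp
    then show ?thesis using loc_comp[OF key[of 0], where P = "\<lambda>p. fst p = q"] by simp
  next
    case 2
    have "g = (\<lambda>x. (\<lambda>p. snd p = s) (fst (step M (cfg x)), cell (step M (cfg x)) i))"
      unfolding 2 cell_bit_def by simp
    then show ?thesis using loc_comp[OF key[of i], where P = "\<lambda>p. snd p = s"] by simp
  qed
qed

text \<open>One layer for the initial configuration and one per step. The factor
  \<open>lcost (...)\<close> depends on the machine only, which keeps the bound polynomial in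
  \<open>N\<close> and \<open>T\<close>.\<close>

definition run_cost :: "tm \<Rightarrow> nat \<Rightarrow> nat \<Rightarrow> nat" where
  "run_cost M N T = Suc T * ((nstates M + (2 * N + 1) * nsyms M) * lcost (nstates M + 4 * nsyms M))"

lemma poly_bounded_run_cost:
  "poly_bounded N \<Longrightarrow> poly_bounded T \<Longrightarrow> poly_bounded (\<lambda>n. run_cost M (N n) (T n))"
  unfolding run_cost_def by (intro poly_bounded_intros)

lemma loc_init:
  assumes len: "\<And>x. length x = m \<Longrightarrow> length (w x) = l"
    and loc: "\<And>i. i < l \<Longrightarrow> loc m F 1 (\<lambda>x. w x ! i)"
    and g: "g \<in> conf_bits M N (\<lambda>x. init_config (w x))"
  shows "loc m F 1 g"
proof -
  from g consider q where "g = state_bit (\<lambda>x. init_config (w x)) q"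
    | i s where "g = cell_bit (\<lambda>x. init_config (w x)) (i, s)"
    unfolding conf_bits_def by blast
  then show ?thesis
  proof cases
    case 1
    then have "g = (\<lambda>_. 0 = q)" by (simp add: fun_eq_iff state_bit_def)
    then show ?thesis by (simp add: loc_const)
  next
    case 2
    show ?thesis
    proof (cases "0 \<le> i \<and> nat i < l")
      case True
      have "g x \<longleftrightarrow> w x ! nat i = s" if "length x = m" for x
        using True len[OF that] by (simp add: 2 cell_bit_def cell_init nth_blank_def)
      then have "loc m F 1 g \<longleftrightarrow> loc m F 1 (\<lambda>x. w x ! nat i = s)" by (rule loc_cong)
      moreover have "loc m F 1 (\<lambda>x. w x ! nat i = s)"
        by (rule loc_comp[where P = "\<lambda>a. a = s"], rule loc) (use True in simp)
      ultimately show ?thesis by blast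
    next
      case False
      have "g x \<longleftrightarrow> 0 = s" if "length x = m" for x
        using False len[OF that] by (auto simp: 2 cell_bit_def cell_init nth_blank_def)
      then have "loc m F 1 g \<longleftrightarrow> loc m F 1 (\<lambda>_. 0 = s)" by (rule loc_cong)
      then show ?thesis by (simp only: loc_const)
    qed
  qed
qed

text \<open>All layers share the window \<open>N\<close>, which is chosen for the last one; by
  \<open>tame_run\<close> the earlier configurations fit into it as well.\<close>

lemma ext_run:
  assumes wf: "wf_tm M"
    and w: "\<And>x. length x = m \<Longrightarrow> length (w x) = l" "\<And>x. length x = m \<Longrightarrow> set (w x) \<subseteq> {..<nsyms M}"
    and loc: "\<And>i. i < l \<Longrightarrow> loc m F 1 (\<lambda>x. w x ! i)"
    and N: "l + T \<le> N"
  shows "ext m F (run_cost M N T) (conf_bits M N (\<lambda>x. run M T (w x)))"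
  using N
proof (induction T)
  case 0
  have "ext m F ((nstates M + (2 * N + 1) * nsyms M) * lcost 1) (conf_bits M N (\<lambda>x. init_config (w x)))"
    by (intro ext_locs finite_conf_bits card_conf_bits loc_init[OF w(1) loc])
  then show ?case
  proof (rule ext_mono)
    have "1 \<le> nstates M + 4 * nsyms M" using wf by (simp add: wf_tm_def)
    from lcost_mono[OF this] show "(nstates M + (2 * N + 1) * nsyms M) * lcost 1 \<le> run_cost M N 0"
      unfolding run_cost_def by simp
  qed simp_all
next
  case (Suc T)
  let ?c = "\<lambda>x. run M T (w x)"
  have "tame M N (?c x)" if "length x = m" for x
  proof (rule tame_mono)
    show "tame M (length (w x) + T) (?c x)" by (rule tame_run[OF wf w(2)[OF that]])
    show "length (w x) + T \<le> N" using w(1)[OF that] Suc.prems by simp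
  qed
  note tame = this
  have "loc m (conf_bits M N ?c) (nstates M + 4 * nsyms M) g"
    if "g \<in> conf_bits M N (\<lambda>x. step M (?c x))" for g
    by (rule loc_step[OF tame that])
  then have "ext m (conf_bits M N ?c)
      ((nstates M + (2 * N + 1) * nsyms M) * lcost (nstates M + 4 * nsyms M))
      (conf_bits M N (\<lambda>x. step M (?c x)))"
    by (intro ext_locs finite_conf_bits card_conf_bits)
  then have "ext m (F \<union> conf_bits M N ?c)
      ((nstates M + (2 * N + 1) * nsyms M) * lcost (nstates M + 4 * nsyms M))
      (conf_bits M N (\<lambda>x. step M (?c x)))"
    by (rule ext_mono) auto
  note step = this
  have "ext m F (run_cost M N T) (conf_bits M N ?c)" by (rule Suc.IH) (use Suc.prems in simp)
  from ext_trans[OF this step] show ?case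
    by (rule ext_mono) (simp_all only: run_Suc run_cost_def mult_Suc add.commute order_refl)
qed

lemma ext_accepts:
  assumes "wf_tm M"
    and "\<And>x. length x = m \<Longrightarrow> length (w x) = l" "\<And>x. length x = m \<Longrightarrow> set (w x) \<subseteq> {..<nsyms M}"
    and "\<And>i. i < l \<Longrightarrow> loc m F 1 (\<lambda>x. w x ! i)"
  shows "ext m F (run_cost M (l + T) T) {\<lambda>x. accepts_within M T (w x)}"
proof -
  have "(\<lambda>x. accepts_within M T (w x)) = state_bit (\<lambda>x. run M T (w x)) 1"
    by (auto simp: accepts_within_def state_bit_def)
  moreover have "1 < nstates M" using assms(1) by (simp add: wf_tm_def)
  ultimately have sub: "{\<lambda>x. accepts_within M T (w x)} \<subseteq> conf_bits M (l + T) (\<lambda>x. run M T (w x))"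
    unfolding conf_bits_def by simp
  have "ext m F (run_cost M (l + T) T) (conf_bits M (l + T) (\<lambda>x. run M T (w x)))"
    using ext_run[OF assms order_refl] .
  from ext_mono[OF this order_refl order_refl sub] show ?thesis .
qed

section \<open>Reading the output off the cells\<close>

lemma all_le_Suc: "(\<forall>k\<le>Suc j. Q k) \<longleftrightarrow> Q 0 \<and> (\<forall>k\<le>j. Q (Suc k))"
  by (metis Suc_le_mono le0 not0_implies_Suc)

lemma less_length_takeWhile:
  "i < length (takeWhile P xs) \<longleftrightarrow> (\<forall>k\<le>i. k < length xs \<and> P (xs ! k))"
proof (induction xs arbitrary: i)
  case (Cons a xs)
  show ?case
  proof (cases i)
    case (Suc j)
    have "(\<forall>k\<le>Suc j. k < length (a # xs) \<and> P ((a # xs) ! k)) \<longleftrightarrow>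
        P a \<and> (\<forall>k\<le>j. k < length xs \<and> P (xs ! k))"
      using all_le_Suc[of j "\<lambda>k. k < length (a # xs) \<and> P ((a # xs) ! k)"] by simp
    then show ?thesis using Cons.IH[of j] Suc by simp
  qed auto
qed auto

text \<open>Replaces the scan by \<open>takeWhile\<close> with conjunctions of tests on single
  cells, which are available as wires.\<close>

lemma tm_output_cells:
  shows length_tm_output: "i < length (tm_output c) \<longleftrightarrow> (\<forall>k\<le>i. cell c (int k) = 1 \<or> cell c (int k) = 2)"
    and nth_tm_output: "i < length (tm_output c) \<Longrightarrow> tm_output c ! i \<longleftrightarrow> cell c (int i) = 2"
proof -
  obtain q ls h rs where c: "c = (q, ls, h, rs)" by (cases c)
  have cell: "cell c (int k) = nth_blank (h # rs) k" for k
    using nth_blank_Cons[of h rs "int k"] by (auto simp: c cell_def)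
  have tm: "tm_output c = map (\<lambda>s. s = 2) (takeWhile (\<lambda>s. s = 1 \<or> s = 2) (h # rs))"
    by (simp only: c tm_output.simps)
  have blank: "nth_blank (h # rs) k = 1 \<or> nth_blank (h # rs) k = 2 \<longleftrightarrow>
      k < length (h # rs) \<and> ((h # rs) ! k = 1 \<or> (h # rs) ! k = 2)" for k
    by (auto simp: nth_blank_def)
  show *: "i < length (tm_output c) \<longleftrightarrow> (\<forall>k\<le>i. cell c (int k) = 1 \<or> cell c (int k) = 2)"
    unfolding tm length_map less_length_takeWhile cell blank ..
  assume "i < length (tm_output c)"
  then have i: "i < length (takeWhile (\<lambda>s. s = 1 \<or> s = 2) (h # rs))" by (simp only: tm length_map)
  then have "i < length (h # rs)" unfolding less_length_takeWhile by blast
  then show "tm_output c ! i \<longleftrightarrow> cell c (int i) = 2"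
    using i unfolding cell tm by (simp only: nth_map takeWhile_nth nth_blank_def if_True)
qed

definition len_bit :: "(bool list \<Rightarrow> bool list) \<Rightarrow> nat \<Rightarrow> bool list \<Rightarrow> bool" where
  "len_bit u i x \<longleftrightarrow> i < length (u x)"

definition val_bit :: "(bool list \<Rightarrow> bool list) \<Rightarrow> nat \<Rightarrow> bool list \<Rightarrow> bool" where
  "val_bit u i x \<longleftrightarrow> i < length (u x) \<and> u x ! i"

text \<open>A string of unknown length as presence and value bits, the form that
  \<open>decode_pairs\<close> reads. Positions 0 to \<open>N\<close> suffice by
  \<open>length_tm_output_le\<close>.\<close>

definition out_bits :: "nat \<Rightarrow> (bool list \<Rightarrow> bool list) \<Rightarrow> (bool list \<Rightarrow> bool) set" where
  "out_bits N u = len_bit u ` {..N} \<union> val_bit u ` {..N}"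

text \<open>\<open>lcost 3\<close> pays for joining a test on two cell bits to a partial
  conjunction, \<open>lcost 2\<close> for masking a cell bit by the presence bit.\<close>

definition out_cost :: "tm \<Rightarrow> nat \<Rightarrow> nat \<Rightarrow> nat" where
  "out_cost M N T = run_cost M N T + (Suc N * (Suc (Suc N) * lcost 3) + Suc N * lcost 2)"

lemma poly_bounded_out_cost:
  "poly_bounded N \<Longrightarrow> poly_bounded T \<Longrightarrow> poly_bounded (\<lambda>n. out_cost M (N n) (T n))"
  unfolding out_cost_def by (intro poly_bounded_intros poly_bounded_run_cost)

lemma ext_output:
  assumes "wf_tm M"
    and "\<And>x. length x = m \<Longrightarrow> length (w x) = l" "\<And>x. length x = m \<Longrightarrow> set (w x) \<subseteq> {..<nsyms M}"
    and "\<And>i. i < l \<Longrightarrow> loc m F 1 (\<lambda>x. w x ! i)"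
    and "l + T \<le> N"
  shows "ext m F (out_cost M N T) (out_bits N (\<lambda>x. tm_output (run M T (w x))))"
proof -
  let ?c = "\<lambda>x. run M T (w x)"
  let ?u = "\<lambda>x. tm_output (?c x)"
  have syms: "1 < nsyms M" "2 < nsyms M" using assms(1) by (auto simp: wf_tm_def)
  have bit: "loc m (F \<union> conf_bits M N ?c) 1 (\<lambda>x. cell (?c x) (int i) = s)"
    if "i \<le> N" "s < nsyms M" for i s
  proof -
    have "(\<lambda>x. cell (?c x) (int i) = s) = cell_bit ?c (int i, s)" by (auto simp: cell_bit_def)
    moreover have "cell_bit ?c (int i, s) \<in> conf_bits M N ?c" using that by (auto simp: conf_bits_def)
    ultimately show ?thesis by (intro loc_mem) simp
  qed
  have "loc m (F \<union> conf_bits M N ?c) 2 (\<lambda>x. cell (?c x) (int i) = 1 \<or> cell (?c x) (int i) = 2)"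
    if "i \<le> N" for i
    using loc_op[OF bit[OF that syms(1)] bit[OF that syms(2)], where P = "(\<or>)"] by (simp add: numeral_2_eq_2)
  note bit2 = this
  have v1: "ext m (F \<union> conf_bits M N ?c) (Suc (card {..i}) * lcost 3)
      {\<lambda>x. \<forall>k\<in>{..i}. cell (?c x) (int k) = 1 \<or> cell (?c x) (int k) = 2}" if "i \<le> N" for i
    using ext_ball[of "{..i}" m "F \<union> conf_bits M N ?c" 2
        "\<lambda>k x. cell (?c x) (int k) = 1 \<or> cell (?c x) (int k) = 2"] bit2 that
    by simp
  have v2: "(\<lambda>x. \<forall>k\<in>{..i}. cell (?c x) (int k) = 1 \<or> cell (?c x) (int k) = 2) = len_bit ?u i" for i
    by (auto simp: fun_eq_iff len_bit_def length_tm_output)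
  have len: "ext m (F \<union> conf_bits M N ?c) (Suc (Suc N) * lcost 3) {len_bit ?u i}" if i: "i \<le> N" for i
    using v1[OF i] unfolding v2 by (rule ext_mono) (use i in auto)
  have "ext m (F \<union> conf_bits M N ?c) (card {..N} * (Suc (Suc N) * lcost 3)) (\<Union>i\<in>{..N}. {len_bit ?u i})"
    by (intro ext_UN len) auto
  moreover have "(\<Union>i\<in>{..N}. {len_bit ?u i}) = len_bit ?u ` {..N}" by blast
  ultimately have lens: "ext m (F \<union> conf_bits M N ?c) (Suc N * (Suc (Suc N) * lcost 3)) (len_bit ?u ` {..N})"
    by simp
  let ?F = "(F \<union> conf_bits M N ?c) \<union> len_bit ?u ` {..N}"
  have "loc m ?F 2 (val_bit ?u i)" if "i \<le> N" for i
  proof -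
    have "loc m ?F 1 (len_bit ?u i)" using that by (intro loc_mem) auto
    moreover have "loc m ?F 1 (\<lambda>x. cell (?c x) (int i) = 2)"
      by (rule loc_mono[OF bit[OF that syms(2)]]) auto
    ultimately have "loc m ?F (1 + 1) (\<lambda>x. len_bit ?u i x \<and> cell (?c x) (int i) = 2)"
      by (rule loc_op[where P = "(\<and>)"])
    moreover have "(\<lambda>x. len_bit ?u i x \<and> cell (?c x) (int i) = 2) = val_bit ?u i"
      by (auto simp: fun_eq_iff len_bit_def val_bit_def nth_tm_output)
    ultimately show ?thesis by (simp add: numeral_2_eq_2)
  qed
  then have "ext m ?F (Suc N * lcost 2) (val_bit ?u ` {..N})"
    using card_image_le[of "{..N}" "val_bit ?u"] by (intro ext_locs) auto
  from ext_chain[OF lens this]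
  have "ext m (F \<union> conf_bits M N ?c) (Suc N * (Suc (Suc N) * lcost 3) + Suc N * lcost 2) (out_bits N ?u)"
    by (simp add: out_bits_def)
  from ext_trans[OF ext_run[OF assms] this] show ?thesis by (simp add: out_cost_def)
qed

text \<open>Cells beyond \<open>N\<close> are blank, and a blank ends the output.\<close>

lemma length_tm_output_le:
  assumes "wf_tm M" "set w \<subseteq> {..<nsyms M}" "length w + T \<le> N"
  shows "length (tm_output (run M T w)) \<le> Suc N"
proof (rule ccontr)
  assume "\<not> ?thesis"
  then have "Suc N < length (tm_output (run M T w))" by simp
  then have "cell (run M T w) (int (Suc N)) \<noteq> 0" unfolding length_tm_output by fastforce
  moreover have "tame M N (run M T w)" using tame_mono[OF tame_run[OF assms(1,2)] assms(3)] .
  ultimately show False by (simp add: tame_def)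
qed

section \<open>A language of satisfiable formulas\<close>

text \<open>A language of formulas in conjunctive normal form. A formula is read as a sequence of
  two-bit instructions acting on a pointer into the assignment: 01 and 10 say that the current
  variable occurs positively or negatively in the current clause, 00 that it does not occur, and
  all three advance the pointer; 11 ends the clause and resets the pointer. The flag records
  whether the current clause is satisfied already.\<close>

fun cnf_check :: "bool \<Rightarrow> nat \<Rightarrow> bool list \<Rightarrow> bool list \<Rightarrow> bool" where
  "cnf_check fl k (b1 # b2 # X) Y =
     (if b1 \<and> b2 then fl \<and> cnf_check False 0 X Y
      else k < length Y \<and> cnf_check (fl \<or> b1 \<and> \<not> Y ! k \<or> b2 \<and> Y ! k) (Suc k) X Y)"
| "cnf_check fl k [b] Y = False"
| "cnf_check fl k [] Y = True"

text \<open>Making the assignment as long as the formula gives a witness length that is polynomial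
  in the input length, whatever number of variables occurs.\<close>

definition CNF :: lang where
  "CNF = {X. \<exists>Y. length Y = length X \<and> cnf_check False 0 X Y}"

text \<open>The verifier erases the instructions one by one (symbol 4) and marks the assignment bits to
  the left of the pointer (symbols 5 and 6). States 0 and 3 fetch an instruction with the flag
  down or up; 4 to 7 remember its first bit and the flag; 8 to 11 run to the assignment in order
  to skip a variable (flag down, flag up) or to test it (positively, negatively), 12 to 15 look
  for the pointer there; 16 and 17 return with the new flag; 18 and 19 remove all marks.\<close>

definition cnf_delta :: "nat \<Rightarrow> nat \<Rightarrow> nat \<times> nat \<times> dir" where
  "cnf_delta q s =
    (if q = 0 \<or> q = 3 then
       (if s = 1 then (if q = 3 then 5 else 4, 4, Rgt)
        else if s = 2 then (if q = 3 then 7 else 6, 4, Rgt)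
        else if s = 3 then (1, 3, Stay) else (2, 0, Stay))
     else if 4 \<le> q \<and> q \<le> 7 then
       (if s = 1 \<or> s = 2 then
          (if 6 \<le> q \<and> s = 2 then (if q = 7 then (18, 4, Rgt) else (2, 0, Stay))
           else (if q = 5 \<or> q = 7 then 9 else if q = 6 then 11 else if s = 2 then 10 else 8, 4, Rgt))
        else (2, 0, Stay))
     else if 8 \<le> q \<and> q \<le> 11 then
       (if s = 1 \<or> s = 2 then (q, s, Rgt) else if s = 3 then (q + 4, 3, Rgt) else (2, 0, Stay))
     else if 12 \<le> q \<and> q \<le> 15 then
       (if s = 5 \<or> s = 6 then (q, s, Rgt)
        else if s = 1 \<or> s = 2 then
          (if q = 13 \<or> q = 14 \<and> s = 2 \<or> q = 15 \<and> s = 1 then 17 else 16, s + 4, Lft)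
        else (2, 0, Stay))
     else if q = 16 \<or> q = 17 then
       (if s = 4 then (if q = 17 then 3 else 0, 4, Rgt) else (q, s, Lft))
     else if q = 18 then (if s = 0 then (19, 0, Lft) else (18, s, Rgt))
     else if q = 19 then
       (if s = 4 then (0, 4, Rgt)
        else (19, if s = 5 then 1 else if s = 6 then 2 else s, Lft))
     else (2, 0, Stay))"

definition cnf_tm :: tm where
  "cnf_tm = \<lparr>nstates = 20, nsyms = 7, delta = cnf_delta\<rparr>"

lemma delta_cnf_tm [simp]: "delta cnf_tm = cnf_delta"
  by (simp add: cnf_tm_def)

lemma wf_cnf_tm: "wf_tm cnf_tm"
  by (auto simp: wf_tm_def cnf_tm_def cnf_delta_def)

text \<open>\<open>rconf\<close> and \<open>lconf\<close> name the tape ahead in the direction of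
  motion. A sweep then consumes a prefix, and running off the stored tape reads a blank.\<close>

definition rconf :: "nat \<Rightarrow> nat list \<Rightarrow> nat list \<Rightarrow> config" where
  "rconf q ls t = (case t of [] \<Rightarrow> (q, ls, 0, []) | a # rs \<Rightarrow> (q, ls, a, rs))"

definition lconf :: "nat \<Rightarrow> nat list \<Rightarrow> nat list \<Rightarrow> config" where
  "lconf q t rs = (case t of [] \<Rightarrow> (q, [], 0, rs) | a # ls \<Rightarrow> (q, ls, a, rs))"

lemma move_rconf: "move Rgt q ls s rs = rconf q (s # ls) rs"
  by (cases rs) (auto simp: rconf_def)

lemma move_lconf: "move Lft q ls s rs = lconf q ls (s # rs)"
  by (cases ls) (auto simp: lconf_def)

lemma init_rconf: "init_config w = rconf 0 [] w"
  by (cases w) (auto simp: rconf_def)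

lemma rconf_Cons [simp]: "rconf q ls (a # rs) = (q, ls, a, rs)"
  by (simp add: rconf_def)

lemma lconf_Cons [simp]: "lconf q (a # ls) rs = (q, ls, a, rs)"
  by (simp add: lconf_def)

lemma rconf_blanks: "rconf q ls (replicate z 0) = (q, ls, 0, replicate (z - 1) 0)"
  by (cases z) (auto simp: rconf_def)

definition reaches :: "nat \<Rightarrow> config \<Rightarrow> config \<Rightarrow> bool" where
  "reaches n c c' \<longleftrightarrow> (\<exists>k\<le>n. (step cnf_tm ^^ k) c = c')"

lemma reaches_mono: "reaches n c c' \<Longrightarrow> n \<le> n' \<Longrightarrow> reaches n' c c'"
  unfolding reaches_def by (blast intro: order_trans)

lemma reaches_refl: "reaches 0 c c"
  by (simp add: reaches_def)

lemma reaches_trans: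
  assumes "reaches n c c'" "reaches n' c' c''"
  shows "reaches (n + n') c c''"
proof -
  obtain k k' where k: "k \<le> n" "(step cnf_tm ^^ k) c = c'" "k' \<le> n'" "(step cnf_tm ^^ k') c' = c''"
    using assms unfolding reaches_def by blast
  then have "(step cnf_tm ^^ (k' + k)) c = c''" by (simp add: funpow_add)
  moreover have "k' + k \<le> n + n'" using k by simp
  ultimately show ?thesis unfolding reaches_def by blast
qed

lemma reaches_step: "reaches 1 c (step cnf_tm c)"
  unfolding reaches_def by (rule exI[of _ 1]) simp

lemma reaches_Rgt:
  "\<not> halting_state q \<Longrightarrow> cnf_delta q a = (q', s, Rgt) \<Longrightarrow> reaches 1 (q, ls, a, rs) (rconf q' (s # ls) rs)"
  using reaches_step[of "(q, ls, a, rs)"] by (simp add: move_rconf)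

lemma reaches_Lft:
  "\<not> halting_state q \<Longrightarrow> cnf_delta q a = (q', s, Lft) \<Longrightarrow> reaches 1 (q, ls, a, rs) (lconf q' ls (s # rs))"
  using reaches_step[of "(q, ls, a, rs)"] by (simp add: move_lconf)

lemma reaches_Stay:
  "\<not> halting_state q \<Longrightarrow> cnf_delta q a = (q', s, Stay) \<Longrightarrow> reaches 1 (q, ls, a, rs) (q', ls, s, rs)"
  using reaches_step[of "(q, ls, a, rs)"] by simp

lemma sweep_right:
  assumes "\<not> halting_state q" "\<And>a. a \<in> set u \<Longrightarrow> cnf_delta q a = (q, a, Rgt)"
  shows "reaches (length u) (rconf q ls (u @ rs)) (rconf q (rev u @ ls) rs)"
  using assms(2)
proof (induction u arbitrary: ls)
  case (Cons a u)
  have "reaches 1 (rconf q ls ((a # u) @ rs)) (rconf q (a # ls) (u @ rs))"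
    using reaches_Rgt[OF assms(1), of a q a ls "u @ rs"] Cons.prems by simp
  from reaches_trans[OF this Cons.IH] Cons.prems show ?case by simp
qed (simp add: reaches_refl)

text \<open>The rewriting \<open>f\<close> serves the unmarking in state 19; the return in states 16
  and 17 takes the identity.\<close>

lemma sweep_left:
  assumes "\<not> halting_state q" "\<And>a. a \<in> set u \<Longrightarrow> cnf_delta q a = (q, f a, Lft)"
  shows "reaches (length u) (lconf q (u @ ls) rs) (lconf q ls (rev (map f u) @ rs))"
  using assms(2)
proof (induction u arbitrary: rs)
  case (Cons a u)
  have "reaches 1 (lconf q ((a # u) @ ls) rs) (lconf q (u @ ls) (f a # rs))"
    using reaches_Lft[OF assms(1), of a q "f a" "u @ ls" rs] Cons.prems by simp
  from reaches_trans[OF this Cons.IH] Cons.prems show ?case by simp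
qed (simp add: reaches_refl)

definition mark :: "nat \<Rightarrow> bool list \<Rightarrow> nat list" where
  "mark k Y = map (\<lambda>b. if b then 6 else 5) (take k Y) @ enc (drop k Y)"

lemma length_enc [simp]: "length (enc X) = length X"
  by (simp add: enc_def)

lemma set_enc: "set (enc X) \<subseteq> {1, 2}"
  by (auto simp: enc_def)

lemma mark_0 [simp]: "mark 0 Y = enc Y"
  by (simp add: mark_def)

abbreviation erased :: "nat \<Rightarrow> nat list" where
  "erased j \<equiv> replicate j 4"

text \<open>One round trip: across the rest of the formula and the \<open>k\<close> marked bits to
  the pointer, which is marked, and back. \<open>Suc j\<close> guarantees an erased cell, where the
  way back ends.\<close>

lemma reaches_variable:
  assumes g: "g \<in> {8, 9, 10, 11}" and k: "k < length Y"
    and W: "length X + length Y < W"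
  defines "fl \<equiv> g = 9 \<or> g = 10 \<and> Y ! k \<or> g = 11 \<and> \<not> Y ! k"
  shows "reaches (2 * W + 3) (rconf g (erased (Suc j)) (enc X @ 3 # mark k Y @ replicate z 0))
           (rconf (if fl then 3 else 0) (erased (Suc j)) (enc X @ 3 # mark (Suc k) Y @ replicate z 0))"
proof -
  define P where "P = map (\<lambda>b. if b then 6 else 5 :: nat) (take k Y)"
  define y where "y = (if Y ! k then 2 else 1 :: nat)"
  define r where "r = enc (drop (Suc k) Y) @ replicate z 0"
  define q where "q = (if fl then 17 else 16 :: nat)"
  have P: "set P \<subseteq> {5, 6}" "length P = k" using k by (auto simp: P_def)
  have mk: "mark k Y @ replicate z 0 = P @ y # r"
    using k by (simp add: mark_def P_def y_def r_def enc_def flip: Cons_nth_drop_Suc)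
  have mk': "mark (Suc k) Y @ replicate z 0 = P @ (y + 4) # r"
    using k by (simp add: mark_def P_def y_def r_def enc_def take_Suc_conv_app_nth)
  have g': "\<not> halting_state g" "\<not> halting_state (g + 4)" "\<not> halting_state q"
    using g by (auto simp: halting_state_def q_def)
  have 1: "reaches (length (enc X)) (rconf g (erased (Suc j)) (enc X @ 3 # P @ y # r))
      (rconf g (rev (enc X) @ erased (Suc j)) (3 # P @ y # r))"
    by (rule sweep_right[OF g'(1)]) (use set_enc[of X] g in \<open>auto simp: cnf_delta_def\<close>)
  have 2: "reaches 1 (rconf g (rev (enc X) @ erased (Suc j)) (3 # P @ y # r))
      (rconf (g + 4) (3 # rev (enc X) @ erased (Suc j)) (P @ y # r))"
    unfolding rconf_Cons by (rule reaches_Rgt[OF g'(1)]) (use g in \<open>auto simp: cnf_delta_def\<close>)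
  have 3: "reaches (length P) (rconf (g + 4) (3 # rev (enc X) @ erased (Suc j)) (P @ y # r))
      (rconf (g + 4) (rev P @ 3 # rev (enc X) @ erased (Suc j)) (y # r))"
    by (rule sweep_right[OF g'(2)]) (use P g in \<open>auto simp: cnf_delta_def\<close>)
  have "cnf_delta (g + 4) y = (q, y + 4, Lft)"
    using g by (auto simp: cnf_delta_def y_def q_def fl_def)
  then have 4: "reaches 1 (rconf (g + 4) (rev P @ 3 # rev (enc X) @ erased (Suc j)) (y # r))
      (lconf q ((rev P @ 3 # rev (enc X)) @ erased (Suc j)) ((y + 4) # r))"
    using reaches_Lft[OF g'(2)] by simp
  have 5: "reaches (length (rev P @ 3 # rev (enc X)))
      (lconf q ((rev P @ 3 # rev (enc X)) @ erased (Suc j)) ((y + 4) # r))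
      (lconf q (erased (Suc j)) (rev (map (\<lambda>s. s) (rev P @ 3 # rev (enc X))) @ (y + 4) # r))"
    by (rule sweep_left[OF g'(3)]) (use P set_enc[of X] in \<open>auto simp: cnf_delta_def q_def\<close>)
  have 6: "reaches 1 (lconf q (erased (Suc j)) (rev (map (\<lambda>s. s) (rev P @ 3 # rev (enc X))) @ (y + 4) # r))
      (rconf (if fl then 3 else 0) (erased (Suc j)) (enc X @ 3 # P @ (y + 4) # r))"
    using reaches_Rgt[OF g'(3), of 4 "if fl then 3 else 0" 4 "erased j" "enc X @ 3 # P @ (y + 4) # r"]
    by (auto simp: cnf_delta_def q_def)
  note reaches_trans[OF reaches_trans[OF reaches_trans[OF reaches_trans[OF reaches_trans[OF 1 2] 3] 4] 5] 6]
  moreover have "length (enc X) + 1 + length P + 1 + length (rev P @ 3 # rev (enc X)) + 1 \<le> 2 * W + 3"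
    using P(2) k W by simp
  ultimately show ?thesis unfolding mk mk' by (rule reaches_mono)
qed

text \<open>All assignment bits are marked, so the search for the pointer runs onto a blank, where
  the machine rejects.\<close>

lemma reaches_variable_out_of_range:
  assumes g: "g \<in> {8, 9, 10, 11}"
    and W: "length X + length Y < W"
  shows "\<exists>c. reaches (2 * W + 3) (rconf g ls (enc X @ 3 # mark (length Y) Y @ replicate z 0)) c \<and> fst c = 2"
proof -
  define P where "P = map (\<lambda>b. if b then 6 else 5 :: nat) Y"
  have P: "set P \<subseteq> {5, 6}" "length P = length Y" "mark (length Y) Y = P"
    by (auto simp: P_def mark_def enc_def)
  have g': "\<not> halting_state g" "\<not> halting_state (g + 4)"
    using g by (auto simp: halting_state_def)
  have 1: "reaches (length (enc X)) (rconf g ls (enc X @ 3 # P @ replicate z 0))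
      (rconf g (rev (enc X) @ ls) (3 # P @ replicate z 0))"
    by (rule sweep_right[OF g'(1)]) (use set_enc[of X] g in \<open>auto simp: cnf_delta_def\<close>)
  have 2: "reaches 1 (rconf g (rev (enc X) @ ls) (3 # P @ replicate z 0))
      (rconf (g + 4) (3 # rev (enc X) @ ls) (P @ replicate z 0))"
    unfolding rconf_Cons by (rule reaches_Rgt[OF g'(1)]) (use g in \<open>auto simp: cnf_delta_def\<close>)
  have 3: "reaches (length P) (rconf (g + 4) (3 # rev (enc X) @ ls) (P @ replicate z 0))
      (rconf (g + 4) (rev P @ 3 # rev (enc X) @ ls) (replicate z 0))"
    by (rule sweep_right[OF g'(2)]) (use P g in \<open>auto simp: cnf_delta_def\<close>)
  have 4: "reaches 1 (rconf (g + 4) (rev P @ 3 # rev (enc X) @ ls) (replicate z 0))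
      (2, rev P @ 3 # rev (enc X) @ ls, 0, replicate (z - 1) 0)"
    unfolding rconf_blanks by (rule reaches_Stay[OF g'(2)]) (use g in \<open>auto simp: cnf_delta_def\<close>)
  note reaches_trans[OF reaches_trans[OF reaches_trans[OF 1 2] 3] 4]
  moreover have "length (enc X) + 1 + length P + 1 \<le> 2 * W + 3" using P(2) W by simp
  ultimately show ?thesis unfolding P(3) by (meson reaches_mono fst_conv)
qed

text \<open>The right end is recognised by stepping onto a blank, which from then on belongs to the
  stored tape; hence \<open>z\<close> blanks become \<open>Suc (z - 1)\<close>.\<close>

lemma reaches_reset:
  assumes W: "length X + length Y < W"
  shows "reaches (2 * W + 4) (rconf 18 (erased (Suc j)) (enc X @ 3 # mark k Y @ replicate z 0))
           (rconf 0 (erased (Suc j)) (enc X @ 3 # mark 0 Y @ replicate (Suc (z - 1)) 0))"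
proof -
  define v where "v = enc X @ 3 # mark k Y"
  define f where "f s = (if s = 5 then 1 else if s = 6 then 2 else s)" for s :: nat
  have "set (mark k Y) \<subseteq> {1, 2, 5, 6}" by (auto simp: mark_def enc_def)
  then have v: "set v \<subseteq> {1, 2, 3, 5, 6}" "length v = length X + length Y + 1"
    using set_enc[of X] by (auto simp: v_def mark_def)
  have fe: "map f (enc u) = enc u" for u by (simp add: enc_def f_def)
  have "map f (mark k Y) = enc (take k Y) @ enc (drop k Y)"
    by (simp add: mark_def fe) (simp add: enc_def f_def)
  also have "\<dots> = enc Y" by (simp add: enc_def flip: map_append)
  finally have fv: "map f v = enc X @ 3 # enc Y" by (simp add: v_def fe) (simp add: f_def)
  have h: "\<not> halting_state 18" "\<not> halting_state 19" by (auto simp: halting_state_def)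
  have 1: "reaches (length v) (rconf 18 (erased (Suc j)) (v @ replicate z 0))
      (rconf 18 (rev v @ erased (Suc j)) (replicate z 0))"
    by (rule sweep_right[OF h(1)]) (use v(1) in \<open>auto simp: cnf_delta_def\<close>)
  have 2: "reaches 1 (rconf 18 (rev v @ erased (Suc j)) (replicate z 0))
      (lconf 19 (rev v @ erased (Suc j)) (0 # replicate (z - 1) 0))"
    unfolding rconf_blanks by (rule reaches_Lft[OF h(1)]) (simp add: cnf_delta_def)
  have 3: "reaches (length (rev v)) (lconf 19 (rev v @ erased (Suc j)) (0 # replicate (z - 1) 0))
      (lconf 19 (erased (Suc j)) (rev (map f (rev v)) @ 0 # replicate (z - 1) 0))"
    by (rule sweep_left[OF h(2)]) (use v(1) in \<open>auto simp: cnf_delta_def f_def\<close>)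
  have 4: "reaches 1 (lconf 19 (erased (Suc j)) (rev (map f (rev v)) @ 0 # replicate (z - 1) 0))
      (rconf 0 (erased (Suc j)) (enc X @ 3 # mark 0 Y @ replicate (Suc (z - 1)) 0))"
    using reaches_Rgt[OF h(2), of 4 0 4 "erased j" "map f v @ 0 # replicate (z - 1) 0"]
    by (simp add: cnf_delta_def fv rev_map)
  note reaches_trans[OF reaches_trans[OF reaches_trans[OF 1 2] 3] 4]
  moreover have "length v + 1 + length (rev v) + 1 \<le> 2 * W + 4" using v(2) W by simp
  ultimately show ?thesis unfolding v_def append_assoc append_Cons by (rule reaches_mono)
qed

text \<open>Induction along \<open>cnf_check\<close>: the state codes the flag, and the number of
  marks is the pointer. The erased cells and trailing blanks vary between rounds, so
  \<open>j\<close> and \<open>z\<close> are generalised. An instruction takes one excursion across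
  the tape, which the \<open>2 * W + 10\<close> steps per symbol cover.\<close>

lemma cnf_tm_correct:
  assumes "k \<le> length Y" "length X + length Y < W"
  shows "\<exists>c. reaches (Suc (length X) * (2 * W + 10))
           (rconf (if fl then 3 else 0) (erased j) (enc X @ 3 # mark k Y @ replicate z 0)) c \<and>
         fst c = (if cnf_check fl k X Y then 1 else 2)"
  using assms
proof (induction fl k X Y arbitrary: j z rule: cnf_check.induct)
  case (3 fl k Y)
  let ?r = "mark k Y @ replicate z 0"
  have "reaches 1 (rconf (if fl then 3 else 0) (erased j) (3 # ?r)) (1, erased j, 3, ?r)"
    unfolding rconf_Cons by (rule reaches_Stay) (auto simp: halting_state_def cnf_delta_def)
  then have "reaches (2 * W + 10) (rconf (if fl then 3 else 0) (erased j) (3 # ?r)) (1, erased j, 3, ?r)"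
    by (rule reaches_mono) simp
  then show ?case by (intro exI[of _ "(1, erased j, 3, ?r)"]) (simp add: enc_def)
next
  case (2 fl k b Y)
  let ?r = "mark k Y @ replicate z 0"
  let ?q = "if b then (if fl then 7 else 6) else (if fl then 5 else 4)"
  have 1: "reaches 1 (rconf (if fl then 3 else 0) (erased j) (enc [b] @ 3 # ?r)) (rconf ?q (4 # erased j) (3 # ?r))"
    unfolding enc_def list.map append.simps rconf_Cons[of _ _ "if b then 2 else 1"]
    by (rule reaches_Rgt) (auto simp: halting_state_def cnf_delta_def)
  have 2: "reaches 1 (rconf ?q (4 # erased j) (3 # ?r)) (2, 4 # erased j, 0, ?r)"
    unfolding rconf_Cons by (rule reaches_Stay) (auto simp: halting_state_def cnf_delta_def)
  from reaches_trans[OF 1 2] have "reaches (Suc (length [b]) * (2 * W + 10))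
      (rconf (if fl then 3 else 0) (erased j) (enc [b] @ 3 # ?r)) (2, 4 # erased j, 0, ?r)"
    by (rule reaches_mono) simp
  then show ?case by (intro exI[of _ "(2, 4 # erased j, 0, ?r)"]) simp
next
  case (1 fl k b1 b2 X Y)
  let ?r = "enc X @ 3 # mark k Y @ replicate z 0"
  let ?e = "\<lambda>b. if b then 2 else 1 :: nat"
  let ?q = "if b1 then (if fl then 7 else 6) else (if fl then 5 else 4)"
  let ?c0 = "rconf (if fl then 3 else 0) (erased j) (enc (b1 # b2 # X) @ 3 # mark k Y @ replicate z 0)"
  have tape: "enc (b1 # b2 # X) @ 3 # mark k Y @ replicate z 0 = ?e b1 # ?e b2 # ?r" by (simp add: enc_def)
  have s1: "reaches 1 ?c0 (rconf ?q (4 # erased j) (?e b2 # ?r))"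
    unfolding tape rconf_Cons[of _ _ "?e b1"]
    by (rule reaches_Rgt) (auto simp: halting_state_def cnf_delta_def)
  have q: "\<not> halting_state ?q" by (simp add: halting_state_def)
  have W: "length X + length Y < W" using "1.prems" by simp
  show ?case
  proof (cases "b1 \<and> b2")
    case True
    show ?thesis
    proof (cases fl)
      case False
      have "reaches 1 (rconf ?q (4 # erased j) (?e b2 # ?r)) (2, 4 # erased j, 0, ?r)"
        unfolding rconf_Cons[of _ _ "?e b2"]
        by (rule reaches_Stay[OF q]) (use True False in \<open>simp add: cnf_delta_def\<close>)
      from reaches_trans[OF s1 this]
      have "reaches (Suc (length (b1 # b2 # X)) * (2 * W + 10)) ?c0 (2, 4 # erased j, 0, ?r)"
        by (rule reaches_mono) simp
      moreover have "\<not> cnf_check fl k (b1 # b2 # X) Y" using True False by simp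
      ultimately show ?thesis by (intro exI[of _ "(2, 4 # erased j, 0, ?r)"]) simp
    next
      case fl: True
      have s2: "reaches 1 (rconf ?q (4 # erased j) (?e b2 # ?r)) (rconf 18 (erased (Suc (Suc j))) ?r)"
        unfolding rconf_Cons[of _ _ "?e b2"]
        using reaches_Rgt[OF q, of "?e b2" 18 4 "4 # erased j" ?r] True fl by (simp add: cnf_delta_def)
      obtain c where c: "reaches (Suc (length X) * (2 * W + 10))
          (rconf 0 (erased (Suc (Suc j))) (enc X @ 3 # mark 0 Y @ replicate (Suc (z - 1)) 0)) c"
        "fst c = (if cnf_check False 0 X Y then 1 else 2)"
        using "1.IH"(1)[OF True _ W, of "Suc (Suc j)" "Suc (z - 1)"] by auto
      have "reaches (1 + 1 + (2 * W + 4) + Suc (length X) * (2 * W + 10)) ?c0 c"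
        using reaches_trans[OF reaches_trans[OF reaches_trans[OF s1 s2] reaches_reset[OF W]] c(1)] .
      then have "reaches (Suc (length (b1 # b2 # X)) * (2 * W + 10)) ?c0 c"
        by (rule reaches_mono) simp
      moreover have eq: "cnf_check fl k (b1 # b2 # X) Y = cnf_check False 0 X Y" using True fl by simp
      ultimately show ?thesis unfolding eq using c(2) by (intro exI[of _ c] conjI)
    qed
  next
    case False
    define g where "g = (if fl then 9 else if b1 then 11 else if b2 then 10 else 8 :: nat)"
    have g: "g \<in> {8, 9, 10, 11}" by (simp add: g_def)
    have s2: "reaches 1 (rconf ?q (4 # erased j) (?e b2 # ?r)) (rconf g (erased (Suc (Suc j))) ?r)"
      unfolding rconf_Cons[of _ _ "?e b2"]
      using reaches_Rgt[OF q, of "?e b2" g 4 "4 # erased j" ?r] False by (simp add: cnf_delta_def g_def)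
    show ?thesis
    proof (cases "k < length Y")
      case True
      define fl' where "fl' \<longleftrightarrow> fl \<or> b1 \<and> \<not> Y ! k \<or> b2 \<and> Y ! k"
      have flg: "(g = 9 \<or> g = 10 \<and> Y ! k \<or> g = 11 \<and> \<not> Y ! k) = fl'"
        using False by (auto simp: g_def fl'_def)
      have "Suc k \<le> length Y" using True by simp
      from "1.IH"(2)[OF False this W, of "Suc (Suc j)" z] obtain c where
        c: "reaches (Suc (length X) * (2 * W + 10))
          (rconf (if fl' then 3 else 0) (erased (Suc (Suc j))) (enc X @ 3 # mark (Suc k) Y @ replicate z 0)) c"
        "fst c = (if cnf_check fl' (Suc k) X Y then 1 else 2)"
        unfolding fl'_def by blast
      have "reaches (1 + 1 + (2 * W + 3) + Suc (length X) * (2 * W + 10)) ?c0 c"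
        using reaches_trans[OF reaches_trans[OF reaches_trans[OF s1 s2]
            reaches_variable[OF g True W, of "Suc j" z, unfolded flg]] c(1)] .
      then have "reaches (Suc (length (b1 # b2 # X)) * (2 * W + 10)) ?c0 c"
        by (rule reaches_mono) simp
      moreover have eq: "cnf_check fl k (b1 # b2 # X) Y = cnf_check fl' (Suc k) X Y"
        using False True by (auto simp: fl'_def)
      ultimately show ?thesis unfolding eq using c(2) by (intro exI[of _ c] conjI)
    next
      case oor: False
      then have k: "k = length Y" using "1.prems" by simp
      obtain c where c: "reaches (2 * W + 3) (rconf g (erased (Suc (Suc j))) ?r) c" "fst c = 2"
        using reaches_variable_out_of_range[OF g W] unfolding k by blast
      from reaches_trans[OF reaches_trans[OF s1 s2] c(1)]
      have "reaches (Suc (length (b1 # b2 # X)) * (2 * W + 10)) ?c0 c"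
        by (rule reaches_mono) simp
      moreover have eq: "cnf_check fl k (b1 # b2 # X) Y = False" using False oor by auto
      ultimately show ?thesis unfolding eq using c(2) by (intro exI[of _ c] conjI) simp_all
    qed
  qed
qed

lemma step_halted: "halting_state (fst c) \<Longrightarrow> (step M ^^ n) c = c"
proof (induction n)
  case (Suc n)
  then show ?case by (cases c) simp
qed simp

theorem CNF_in_NP: "in_NP CNF"
proof -
  \<comment> \<open>This is \<open>(W + 1) * (2 * W + 10)\<close> expanded, where \<open>W\<close>
    is the length of formula, separator and assignment together.\<close>
  define T where "T = ([:10, 12, 2:] :: nat poly)"
  define p where "p = ([:0, 1:] :: nat poly)"
  have fin: "fst (run cnf_tm (poly T (length (enc X @ 3 # enc Y))) (enc X @ 3 # enc Y)) =
      (if cnf_check False 0 X Y then 1 else 2)" for X Y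
  proof -
    define W where "W = length (enc X @ 3 # enc Y)"
    have W: "length X + length Y < W" by (simp add: W_def)
    obtain c where c: "reaches (Suc (length X) * (2 * W + 10)) (rconf 0 [] (enc X @ 3 # enc Y)) c"
      "fst c = (if cnf_check False 0 X Y then 1 else 2)"
      using cnf_tm_correct[OF le0 W, of False 0 0] by auto
    obtain k where k: "k \<le> Suc (length X) * (2 * W + 10)" "run cnf_tm k (enc X @ 3 # enc Y) = c"
      using c(1) unfolding reaches_def run_def init_rconf by blast
    have "Suc (length X) * (2 * W + 10) \<le> (W + 1) * (2 * W + 10)"
      using W by (intro mult_le_mono1) simp
    also have "\<dots> = poly T W" by (simp add: T_def algebra_simps)
    finally obtain d where d: "poly T W = d + k" using k(1) by (metis le_trans le_iff_add add.commute)
    have "run cnf_tm (poly T W) (enc X @ 3 # enc Y) = (step cnf_tm ^^ d) c"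
      using k(2) by (simp add: run_def d funpow_add)
    also have "\<dots> = c" by (rule step_halted) (use c(2) in \<open>simp add: halting_state_def\<close>)
    finally show ?thesis using c(2) by (simp add: W_def)
  qed
  have "halts_within cnf_tm (poly T (length (enc X @ 3 # enc Y))) (enc X @ 3 # enc Y)" for X Y
    unfolding halts_within_def fin by (simp add: halting_state_def)
  moreover have "X \<in> CNF \<longleftrightarrow> (\<exists>Y. length Y = poly p (length X) \<and>
      accepts_within cnf_tm (poly T (length (enc X @ 3 # enc Y))) (enc X @ 3 # enc Y))" for X
    unfolding accepts_within_def fin by (auto simp: CNF_def p_def)
  ultimately show ?thesis unfolding in_NP_def using wf_cnf_tm by blast
qed

section \<open>Clauses, their encoding, and formulas from straight-line programs\<close>

type_synonym clause = "nat set \<times> nat set"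

fun csat :: "clause \<Rightarrow> bool list \<Rightarrow> bool" where
  "csat (P, N) Y \<longleftrightarrow> (\<exists>v\<in>P. Y ! v) \<or> (\<exists>v\<in>N. \<not> Y ! v)"

text \<open>A variable with both signs would be encoded as 11, which ends the clause; hence the
  disjointness.\<close>

fun clause_wf :: "nat \<Rightarrow> clause \<Rightarrow> bool" where
  "clause_wf n (P, N) \<longleftrightarrow> P \<inter> N = {} \<and> P \<union> N \<subseteq> {..<n}"

fun entries :: "nat \<Rightarrow> nat \<Rightarrow> clause \<Rightarrow> bool list" where
  "entries k n (P, N) = concat (map (\<lambda>v. [v \<in> N, v \<in> P]) [k..<n])"

text \<open>Every clause spends two bits on each of the \<open>n\<close> variables, occurring or
  not. So the length and layout of a formula depend only on the numbers of clauses and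
  variables.\<close>

definition row :: "nat \<Rightarrow> clause \<Rightarrow> bool list" where
  "row n c = entries 0 n c @ [True, True]"

lemma clause_wf_mono: "clause_wf n c \<Longrightarrow> n \<le> n' \<Longrightarrow> clause_wf n' c"
  by (cases c) fastforce

lemma csat_cong:
  assumes "clause_wf n c" "\<And>v. v < n \<Longrightarrow> Y ! v = Y' ! v"
  shows "csat c Y \<longleftrightarrow> csat c Y'"
proof (cases c)
  case (Pair P N)
  then have "\<And>v. v \<in> P \<Longrightarrow> Y ! v = Y' ! v" "\<And>v. v \<in> N \<Longrightarrow> Y ! v = Y' ! v"
    using assms by auto
  then show ?thesis by (simp add: Pair)
qed

lemma cnf_check_entries:
  assumes "P \<inter> N = {}" "n \<le> length Y" "k \<le> n"
  shows "cnf_check fl k (entries k n (P, N) @ True # True # Z) Y \<longleftrightarrow>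
    (fl \<or> (\<exists>v\<in>{k..<n}. v \<in> P \<and> Y ! v \<or> v \<in> N \<and> \<not> Y ! v)) \<and> cnf_check False 0 Z Y"
  using assms(3)
proof (induction "n - k" arbitrary: k fl)
  case 0
  then show ?case by simp
next
  case (Suc d)
  then have k: "k < n" "d = n - Suc k" "Suc k \<le> n" by auto
  have e: "entries k n (P, N) = (k \<in> N) # (k \<in> P) # entries (Suc k) n (P, N)"
    using k(1) by (simp add: upt_conv_Cons)
  have "\<not> (k \<in> N \<and> k \<in> P)" using assms(1) by blast
  then have "cnf_check fl k (entries k n (P, N) @ True # True # Z) Y \<longleftrightarrow>
      cnf_check (fl \<or> k \<in> N \<and> \<not> Y ! k \<or> k \<in> P \<and> Y ! k) (Suc k)
        (entries (Suc k) n (P, N) @ True # True # Z) Y"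
    unfolding e append_Cons cnf_check.simps(1) using k(1) assms(2) by auto
  also have "\<dots> \<longleftrightarrow> ((fl \<or> k \<in> N \<and> \<not> Y ! k \<or> k \<in> P \<and> Y ! k) \<or>
      (\<exists>v\<in>{Suc k..<n}. v \<in> P \<and> Y ! v \<or> v \<in> N \<and> \<not> Y ! v)) \<and> cnf_check False 0 Z Y"
    by (rule Suc.hyps(1)[OF k(2,3)])
  also have "\<dots> \<longleftrightarrow> (fl \<or> (\<exists>v\<in>insert k {Suc k..<n}. v \<in> P \<and> Y ! v \<or> v \<in> N \<and> \<not> Y ! v)) \<and> cnf_check False 0 Z Y"
    by blast
  also have "insert k {Suc k..<n} = {k..<n}" using k(1) by auto
  finally show ?case .
qed

lemma cnf_check_rows:
  assumes "\<And>c. c \<in> set cs \<Longrightarrow> clause_wf n c" "n \<le> length Y"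
  shows "cnf_check False 0 (concat (map (row n) cs)) Y \<longleftrightarrow> (\<forall>c\<in>set cs. csat c Y)"
  using assms(1)
proof (induction cs)
  case (Cons c cs)
  obtain P N where c: "c = (P, N)" by (cases c)
  have wf: "P \<inter> N = {}" "P \<union> N \<subseteq> {..<n}" using Cons.prems[of c] by (auto simp: c)
  have "(\<exists>v\<in>{0..<n}. v \<in> P \<and> Y ! v \<or> v \<in> N \<and> \<not> Y ! v) \<longleftrightarrow> csat c Y"
    unfolding c csat.simps using wf(2) by (meson UnCI atLeastLessThan_iff le0 lessThan_iff subset_iff)
  moreover have "concat (map (row n) (c # cs)) = entries 0 n (P, N) @ True # True # concat (map (row n) cs)"
    by (simp add: row_def c del: entries.simps)
  ultimately show ?case
    using cnf_check_entries[OF wf(1) assms(2) le0, of False "concat (map (row n) cs)"] Cons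
    by (simp del: entries.simps)
qed simp

lemma length_entries: "length (entries k n c) = 2 * (n - k)"
  by (cases c) (simp add: length_concat comp_def sum_list_triv)

lemma length_row: "length (row n c) = 2 * n + 2"
  by (simp add: row_def length_entries)

lemma length_rows: "length (concat (map (row n) cs)) = length cs * (2 * n + 2)"
  by (induction cs) (simp_all add: length_row)

text \<open>Truncating and padding convert between assignments as long as the formula and
  assignments of \<open>n\<close> variables. A nonempty clause list makes the formula at least
  \<open>n\<close> bits long.\<close>

lemma CNF_rows:
  assumes wf: "\<And>c. c \<in> set cs \<Longrightarrow> clause_wf n c" and "cs \<noteq> []"
  shows "concat (map (row n) cs) \<in> CNF \<longleftrightarrow> (\<exists>Y. length Y = n \<and> (\<forall>c\<in>set cs. csat c Y))"
proof -
  let ?X = "concat (map (row n) cs)"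
  have n: "n \<le> length ?X" using assms(2) unfolding length_rows by (cases cs) auto
  show ?thesis
  proof
    assume "?X \<in> CNF"
    then obtain Y where Y: "length Y = length ?X" "cnf_check False 0 ?X Y" unfolding CNF_def by blast
    then have "csat c (take n Y)" if "c \<in> set cs" for c
      using cnf_check_rows[OF wf, of cs Y] n csat_cong[OF wf[OF that], of Y "take n Y"] that by simp
    then show "\<exists>Y. length Y = n \<and> (\<forall>c\<in>set cs. csat c Y)"
      using Y(1) n by (intro exI[of _ "take n Y"]) simp
  next
    assume "\<exists>Y. length Y = n \<and> (\<forall>c\<in>set cs. csat c Y)"
    then obtain Y where Y: "length Y = n" "\<And>c. c \<in> set cs \<Longrightarrow> csat c Y" by blast
    define Y' where "Y' = Y @ replicate (length ?X - n) False"
    have len: "length Y' = length ?X" using Y(1) n by (simp add: Y'_def)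
    have "csat c Y'" if "c \<in> set cs" for c
      using csat_cong[OF wf[OF that], of Y Y'] Y(1) Y(2)[OF that] by (simp add: Y'_def nth_append)
    then have "cnf_check False 0 ?X Y'" using cnf_check_rows[OF wf, of cs Y'] n len by simp
    then show "?X \<in> CNF" using len unfolding CNF_def by blast
  qed
qed

text \<open>Tseitin's transformation: the variables are the inputs followed by the wires.\<close>

lemma tseitin:
  assumes "slp m fs"
  shows "\<exists>cs. length cs \<le> 3 * length fs \<and> (\<forall>c\<in>set cs. clause_wf (m + length fs) c) \<and>
    (\<forall>Y. m + length fs \<le> length Y \<longrightarrow>
      ((\<forall>c\<in>set cs. csat c Y) \<longleftrightarrow> (\<forall>j<length fs. Y ! (m + j) = (fs ! j) (take m Y))))"
  using assms
proof (induction rule: slp.induct)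
  case Nil
  then show ?case by simp
next
  case (Inp fs i h)
  then obtain cs where cs: "length cs \<le> 3 * length fs" "\<And>c. c \<in> set cs \<Longrightarrow> clause_wf (m + length fs) c"
    "\<And>Y. m + length fs \<le> length Y \<Longrightarrow>
      (\<forall>c\<in>set cs. csat c Y) \<longleftrightarrow> (\<forall>j<length fs. Y ! (m + j) = (fs ! j) (take m Y))" by blast
  let ?v = "m + length fs"
  let ?cs = "cs @ [({i}, {?v}), ({?v}, {i})]"
  have "h (take m Y) = Y ! i" if "m \<le> length Y" for Y
    using Inp.hyps(3)[of "take m Y"] Inp.hyps(2) that by simp
  then have "(\<forall>c\<in>set ?cs. csat c Y) \<longleftrightarrow> (\<forall>j<length (fs @ [h]). Y ! (m + j) = ((fs @ [h]) ! j) (take m Y))"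
    if "m + length (fs @ [h]) \<le> length Y" for Y
    using cs(3)[of Y] that by (auto simp: nth_append less_Suc_eq)
  moreover have "clause_wf (m + length (fs @ [h])) c" if "c \<in> set ?cs" for c
    using that clause_wf_mono[OF cs(2), of c "Suc ?v"] Inp.hyps(2) by auto
  ultimately show ?case using cs(1) by (intro exI[of _ ?cs]) simp
next
  case (Cst fs h b)
  then obtain cs where cs: "length cs \<le> 3 * length fs" "\<And>c. c \<in> set cs \<Longrightarrow> clause_wf (m + length fs) c"
    "\<And>Y. m + length fs \<le> length Y \<Longrightarrow>
      (\<forall>c\<in>set cs. csat c Y) \<longleftrightarrow> (\<forall>j<length fs. Y ! (m + j) = (fs ! j) (take m Y))" by blast
  let ?v = "m + length fs"
  let ?cs = "cs @ [if b then ({?v}, {}) else ({}, {?v})]"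
  have "h (take m Y) = b" if "m \<le> length Y" for Y
    using Cst.hyps(2)[of "take m Y"] that by simp
  then have "(\<forall>c\<in>set ?cs. csat c Y) \<longleftrightarrow> (\<forall>j<length (fs @ [h]). Y ! (m + j) = ((fs @ [h]) ! j) (take m Y))"
    if "m + length (fs @ [h]) \<le> length Y" for Y
    using cs(3)[of Y] that by (auto simp: nth_append less_Suc_eq)
  moreover have "clause_wf (m + length (fs @ [h])) c" if "c \<in> set ?cs" for c
    using that clause_wf_mono[OF cs(2), of c "Suc ?v"] by auto
  ultimately show ?case using cs(1) by (intro exI[of _ ?cs]) simp
next
  case (Neg fs f h)
  then obtain cs where cs: "length cs \<le> 3 * length fs" "\<And>c. c \<in> set cs \<Longrightarrow> clause_wf (m + length fs) c"
    "\<And>Y. m + length fs \<le> length Y \<Longrightarrow>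
      (\<forall>c\<in>set cs. csat c Y) \<longleftrightarrow> (\<forall>j<length fs. Y ! (m + j) = (fs ! j) (take m Y))" by blast
  obtain i where i: "i < length fs" "fs ! i = f" using Neg.hyps(2) by (auto simp: in_set_conv_nth)
  let ?v = "m + length fs"
  let ?cs = "cs @ [({m + i, ?v}, {}), ({}, {m + i, ?v})]"
  have "h (take m Y) = (\<not> (fs ! i) (take m Y))" if "m \<le> length Y" for Y
    using Neg.hyps(3)[of "take m Y"] that i by simp
  then have "(\<forall>c\<in>set ?cs. csat c Y) \<longleftrightarrow> (\<forall>j<length (fs @ [h]). Y ! (m + j) = ((fs @ [h]) ! j) (take m Y))"
    if "m + length (fs @ [h]) \<le> length Y" for Y
    using cs(3)[of Y] that i(1) by (auto simp: nth_append less_Suc_eq)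
  moreover have "clause_wf (m + length (fs @ [h])) c" if "c \<in> set ?cs" for c
    using that clause_wf_mono[OF cs(2), of c "Suc ?v"] i(1) by auto
  ultimately show ?case using cs(1) by (intro exI[of _ ?cs]) simp
next
  case (Conj fs f g h)
  then obtain cs where cs: "length cs \<le> 3 * length fs" "\<And>c. c \<in> set cs \<Longrightarrow> clause_wf (m + length fs) c"
    "\<And>Y. m + length fs \<le> length Y \<Longrightarrow>
      (\<forall>c\<in>set cs. csat c Y) \<longleftrightarrow> (\<forall>j<length fs. Y ! (m + j) = (fs ! j) (take m Y))" by blast
  obtain i where i: "i < length fs" "fs ! i = f" using Conj.hyps(2) by (auto simp: in_set_conv_nth)
  obtain k where k: "k < length fs" "fs ! k = g" using Conj.hyps(3) by (auto simp: in_set_conv_nth)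
  let ?v = "m + length fs"
  let ?cs = "cs @ [({m + i}, {?v}), ({m + k}, {?v}), ({?v}, {m + i, m + k})]"
  have "h (take m Y) = ((fs ! i) (take m Y) \<and> (fs ! k) (take m Y))" if "m \<le> length Y" for Y
    using Conj.hyps(4)[of "take m Y"] that i k by simp
  then have "(\<forall>c\<in>set ?cs. csat c Y) \<longleftrightarrow> (\<forall>j<length (fs @ [h]). Y ! (m + j) = ((fs @ [h]) ! j) (take m Y))"
    if "m + length (fs @ [h]) \<le> length Y" for Y
    using cs(3)[of Y] that i(1) k(1) by (auto simp: nth_append less_Suc_eq)
  moreover have "clause_wf (m + length (fs @ [h])) c" if "c \<in> set ?cs" for c
    using that clause_wf_mono[OF cs(2), of c "Suc ?v"] i(1) k(1) by auto
  ultimately show ?case using cs(1) by (intro exI[of _ ?cs]) simp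
qed

text \<open>The \<open>a\<close> known inputs enter through unit clauses, while the other
  \<open>b\<close> inputs are left to the assignment. Only unit clauses depend on \<open>z\<close>,
  and each of their bits on at most one bit of \<open>z\<close>, so writing the formula takes hardly
  any circuitry.\<close>

lemma slp_CNF_instance:
  assumes "slp (a + b) fs" "f \<in> set fs"
  obtains hs where
    "length hs \<le> (a + 3 * length fs + 1) * (2 * (a + b + length fs) + 2)"
    "\<And>h. h \<in> set hs \<Longrightarrow> loc a (inputs a) 1 h"
    "\<And>z. length z = a \<Longrightarrow> map (\<lambda>h. h z) hs \<in> CNF \<longleftrightarrow> (\<exists>w. length w = b \<and> f (z @ w))"
proof -
  define n where "n = a + b + length fs"
  obtain cs where cs: "length cs \<le> 3 * length fs" "\<And>c. c \<in> set cs \<Longrightarrow> clause_wf n c"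
    "\<And>Y. n \<le> length Y \<Longrightarrow>
      (\<forall>c\<in>set cs. csat c Y) \<longleftrightarrow> (\<forall>j<length fs. Y ! (a + b + j) = (fs ! j) (take (a + b) Y))"
    using tseitin[OF assms(1)] unfolding n_def by blast
  obtain j0 where j0: "j0 < length fs" "fs ! j0 = f" using assms(2) by (auto simp: in_set_conv_nth)
  define unit where "unit z i = (if z ! i then ({i}, {}) else ({}, {i}) :: clause)" for z i
  define cl where "cl z = map (unit z) [0..<a] @ cs @ [({a + b + j0}, {})]" for z
  \<comment> \<open>The row of the unit clause for variable \<open>i\<close>, as functions of
    \<open>z\<close>: all entries except the one at \<open>i\<close> are 00, and that one is
    \<open>z ! i\<close> negated and plain.\<close>
  define uhs where "uhs i = concat (map (\<lambda>v. [\<lambda>z. v = i \<and> \<not> z ! i, \<lambda>z. v = i \<and> z ! i]) [0..<n]) @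
      [\<lambda>z. True, \<lambda>z. True]" for i :: nat
  define hs where "hs = concat (map uhs [0..<a]) @
    map (\<lambda>b z. b) (concat (map (row n) (cs @ [({a + b + j0}, {})])))"
  have uhs: "map (\<lambda>h. h z) (uhs i) = row n (unit z i)" for z i
    unfolding uhs_def row_def unit_def
    by (auto simp: map_concat comp_def intro!: arg_cong[of _ _ concat])
  have hs: "map (\<lambda>h. h z) hs = concat (map (row n) (cl z))" for z
    unfolding hs_def cl_def by (simp add: map_concat comp_def uhs)
  \<comment> \<open>The length is the same for all \<open>z\<close>, so it is read off at an
    arbitrary one.\<close>
  have "length hs = length (cl (replicate a False)) * (2 * n + 2)"
    using arg_cong[OF hs[of "replicate a False"], of length] unfolding length_rows by simp
  also have "\<dots> \<le> (a + 3 * length fs + 1) * (2 * (a + b + length fs) + 2)"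
    unfolding n_def[symmetric] by (intro mult_le_mono1) (use cs(1) in \<open>simp add: cl_def\<close>)
  finally have 1: "length hs \<le> (a + 3 * length fs + 1) * (2 * (a + b + length fs) + 2)" .
  have "loc a (inputs a) 1 h" if h: "h \<in> set hs" for h
  proof -
    consider c where "h = (\<lambda>z. c)" | i v where "i < a" "h = (\<lambda>z. v = i \<and> \<not> z ! i)"
      | i v where "i < a" "h = (\<lambda>z. v = i \<and> z ! i)"
      using h unfolding hs_def uhs_def by (auto split: if_splits)
    then show ?thesis
    proof cases
      case 1
      show ?thesis unfolding 1 by (rule loc_const)
    next
      case 2
      have "loc a (inputs a) 1 (\<lambda>z. z ! i)" by (rule loc_mem) (use 2 in \<open>simp add: inputs_def\<close>)
      then show ?thesis unfolding 2 by (rule loc_comp)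
    next
      case 3
      have "loc a (inputs a) 1 (\<lambda>z. z ! i)" by (rule loc_mem) (use 3 in \<open>simp add: inputs_def\<close>)
      then show ?thesis unfolding 3 by (rule loc_comp)
    qed
  qed
  moreover have "map (\<lambda>h. h z) hs \<in> CNF \<longleftrightarrow> (\<exists>w. length w = b \<and> f (z @ w))" if z: "length z = a" for z
  proof -
    have wf: "clause_wf n c" if "c \<in> set (cl z)" for c
      using that cs(2)[of c] j0(1) by (auto simp: cl_def unit_def n_def)
    have "cl z \<noteq> []" by (simp add: cl_def)
    from CNF_rows[OF wf this]
    have "map (\<lambda>h. h z) hs \<in> CNF \<longleftrightarrow> (\<exists>Y. length Y = n \<and> (\<forall>c\<in>set (cl z). csat c Y))"
      unfolding hs .
    also have "\<dots> \<longleftrightarrow> (\<exists>w. length w = b \<and> f (z @ w))"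
    proof
      assume "\<exists>Y. length Y = n \<and> (\<forall>c\<in>set (cl z). csat c Y)"
      then obtain Y where Y: "length Y = n" "\<And>c. c \<in> set (cl z) \<Longrightarrow> csat c Y" by blast
      have "Y ! i = z ! i" if "i < a" for i
      proof -
        have "unit z i \<in> set (cl z)" using that by (simp add: cl_def)
        from Y(2)[OF this] show ?thesis by (simp add: unit_def split: if_splits)
      qed
      then have "take a Y = z" using z Y(1) by (intro nth_equalityI) (auto simp: n_def)
      then have "take (a + b) Y = z @ take b (drop a Y)" by (simp add: take_add)
      moreover have "\<forall>c\<in>set cs. csat c Y" using Y(2) by (simp add: cl_def)
      then have "Y ! (a + b + j0) = f (take (a + b) Y)" using cs(3)[of Y] Y(1) j0 by simp
      moreover have "Y ! (a + b + j0)" using Y(2)[of "({a + b + j0}, {})"] by (simp add: cl_def)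
      ultimately show "\<exists>w. length w = b \<and> f (z @ w)"
        using Y(1) by (intro exI[of _ "take b (drop a Y)"]) (simp add: n_def)
    next
      assume "\<exists>w. length w = b \<and> f (z @ w)"
      then obtain w where w: "length w = b" "f (z @ w)" by blast
      define Y where "Y = z @ w @ map (\<lambda>f. f (z @ w)) fs"
      have len: "length Y = n" using z w by (simp add: Y_def n_def)
      have take: "take (a + b) Y = z @ w" using z w by (simp add: Y_def)
      have val: "Y ! (a + b + j) = (fs ! j) (z @ w)" if "j < length fs" for j
        using that z w(1) by (simp add: Y_def nth_append)
      have "\<forall>c\<in>set cs. csat c Y" using cs(3)[of Y] len take val by simp
      moreover have "csat (unit z i) Y" if "i < a" for i
        using that z by (simp add: unit_def Y_def nth_append)
      moreover have "csat ({a + b + j0}, {}) Y" using val[OF j0(1)] j0(2) w(2) by simp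
      ultimately have "\<forall>c\<in>set (cl z). csat c Y" unfolding cl_def by auto
      then show "\<exists>Y. length Y = n \<and> (\<forall>c\<in>set (cl z). csat c Y)" using len by blast
    qed
    finally show ?thesis .
  qed
  ultimately show ?thesis using that 1 by blast
qed

section \<open>Formulas for a disjunction of NP statements\<close>

definition sub :: "'a list \<Rightarrow> nat \<Rightarrow> nat \<Rightarrow> 'a list" where
  "sub u p l = take l (drop p u)"

lemma length_sub: "p + l \<le> length u \<Longrightarrow> length (sub u p l) = l"
  by (simp add: sub_def)

lemma nth_sub: "p + l \<le> length u \<Longrightarrow> i < l \<Longrightarrow> sub u p l ! i = u ! (p + i)"
  by (simp add: sub_def)

lemma sub_append: "p = length u \<Longrightarrow> l = length v \<Longrightarrow> sub (u @ v @ w) p l = v"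
  by (simp add: sub_def)

lemma sub_append_right: "length u \<le> p \<Longrightarrow> sub (u @ v) p l = sub v (p - length u) l"
  by (simp add: sub_def)

lemma length_concat_uniform: "(\<And>y. y \<in> set ys \<Longrightarrow> length y = n) \<Longrightarrow> length (concat ys) = length ys * n"
  by (induction ys) simp_all

lemma sub_concat:
  assumes "\<And>y. y \<in> set ys \<Longrightarrow> length y = n" "i < length ys" "p = length u + i * n"
  shows "sub (u @ concat ys @ v) p n = ys ! i"
proof -
  have ys: "ys = take i ys @ ys ! i # drop (Suc i) ys" using assms(2) by (rule id_take_nth_drop)
  have "length (concat (take i ys)) = length (take i ys) * n"
    by (rule length_concat_uniform) (rule assms(1), erule in_set_takeD)
  then have len: "length (concat (take i ys)) = i * n" using assms(2) by simp
  have "concat ys = concat (take i ys) @ ys ! i @ concat (drop (Suc i) ys)"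
    using arg_cong[OF ys, of concat] by (simp only: concat_append concat.simps)
  then have eq: "u @ concat ys @ v = (u @ concat (take i ys)) @ ys ! i @ (concat (drop (Suc i) ys) @ v)"
    by (simp only: append_assoc)
  show ?thesis unfolding eq
  proof (rule sub_append)
    show "p = length (u @ concat (take i ys))" by (simp only: length_append len assms(3))
    show "n = length (ys ! i)" by (rule assms(1)[OF nth_mem[OF assms(2)], symmetric])
  qed
qed

lemma loc_input: "i < m \<Longrightarrow> loc m (inputs m) 1 (\<lambda>u. u ! i)"
  by (rule loc_mem) (simp add: inputs_def)

lemma loc_sub:
  assumes "p + l \<le> m" "i < l"
  shows "loc m (inputs m) 1 (\<lambda>u. sub u p l ! i)"
proof -
  have "loc m (inputs m) 1 (\<lambda>u. sub u p l ! i) = loc m (inputs m) 1 (\<lambda>u. u ! (p + i))"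
    by (rule loc_cong) (simp add: nth_sub assms)
  then show ?thesis using loc_input[of "p + i" m] assms by simp
qed

lemma enc_nth: "i < length x \<Longrightarrow> enc x ! i = (if x ! i then 2 else 1)"
  by (simp add: enc_def)

text \<open>Both parts are cut out of one common input, because many verifications run side by side
  in a single program.\<close>

lemma ext_verifier:
  assumes M: "wf_tm M" and l: "p + l \<le> m" "p' + l' \<le> m"
  shows "ext m (inputs m) (run_cost M (l + 1 + l' + T) T)
    {\<lambda>u. accepts_within M T (enc (sub u p l) @ 3 # enc (sub u p' l'))}"
proof (rule ext_accepts[OF M])
  fix u :: "bool list" assume u: "length u = m"
  then show "length (enc (sub u p l) @ 3 # enc (sub u p' l')) = l + 1 + l'"
    using l by (simp add: length_sub)
  show "set (enc (sub u p l) @ 3 # enc (sub u p' l')) \<subseteq> {..<nsyms M}"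
    using M set_enc[of "sub u p l"] set_enc[of "sub u p' l'"] by (auto simp: wf_tm_def)
next
  fix i assume i: "i < l + 1 + l'"
  let ?w = "\<lambda>u. (enc (sub u p l) @ 3 # enc (sub u p' l')) ! i"
  consider "i < l" | "i = l" | "l < i" by linarith
  then show "loc m (inputs m) 1 ?w"
  proof cases
    case 1
    have "loc m (inputs m) 1 ?w = loc m (inputs m) 1 (\<lambda>u. if sub u p l ! i then 2 else 1 :: nat)"
      by (rule loc_cong) (use 1 l(1) in \<open>simp add: nth_append length_sub enc_nth\<close>)
    moreover have "loc m (inputs m) 1 (\<lambda>u. if sub u p l ! i then 2 else 1 :: nat)"
      by (rule loc_comp[where P = "\<lambda>b. if b then 2 else 1 :: nat"], rule loc_sub[OF l(1) 1])
    ultimately show ?thesis by blast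
  next
    case 2
    have "loc m (inputs m) 1 ?w = loc m (inputs m) 1 (\<lambda>u. 3 :: nat)"
      by (rule loc_cong) (use 2 l(1) in \<open>simp add: nth_append length_sub\<close>)
    then show ?thesis by (simp only: loc_const)
  next
    case 3
    define j where "j = i - Suc l"
    have j: "i = Suc l + j" "j < l'" using 3 i by (simp_all add: j_def)
    have "loc m (inputs m) 1 ?w = loc m (inputs m) 1 (\<lambda>u. if sub u p' l' ! j then 2 else 1 :: nat)"
      by (rule loc_cong) (use j l in \<open>simp add: nth_append length_sub enc_nth\<close>)
    moreover have "loc m (inputs m) 1 (\<lambda>u. if sub u p' l' ! j then 2 else 1 :: nat)"
      by (rule loc_comp[where P = "\<lambda>b. if b then 2 else 1 :: nat"], rule loc_sub[OF l(2) j(2)])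
    ultimately show ?thesis by blast
  qed
qed

lemma run_cost_mono: "N \<le> N' \<Longrightarrow> T \<le> T' \<Longrightarrow> run_cost M N T \<le> run_cost M N' T'"
  unfolding run_cost_def by (intro mult_le_mono add_mono) auto

text \<open>The bit \<open>e\<close> switches \<open>x\<close> off. This is needed when \<open>A\<close> has no long elements: then we want an
  instance that depends on \<open>ys\<close> only.\<close>

definition or_instance :: "lang \<Rightarrow> lang \<Rightarrow> nat \<Rightarrow> nat \<Rightarrow> (bool list \<Rightarrow> bool) list \<Rightarrow> bool" where
  "or_instance B K n k hs \<longleftrightarrow>
     (\<forall>h\<in>set hs. loc (1 + k + (n + 2) * n) (inputs (1 + k + (n + 2) * n)) 1 h) \<and>
     (\<forall>e x ys. length x = k \<longrightarrow> length ys = n + 2 \<longrightarrow> (\<forall>y\<in>set ys. length y = n) \<longrightarrow>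
        (map (\<lambda>h. h (e # x @ concat ys)) hs \<in> CNF \<longleftrightarrow> e \<and> x \<in> B \<or> (\<exists>y\<in>set ys. y \<in> K)))"

text \<open>The switch, \<open>x\<close> and \<open>ys\<close> are the known bits of the program;
  behind them lie the slots for a certificate of \<open>x\<close> and for one of each of the
  \<open>n + 2\<close> strings. The bound \<open>I\<close> is taken at \<open>k = n\<close> and
  serves all smaller \<open>k\<close> by monotonicity.\<close>

lemma or_instances:
  assumes "in_NP B" "in_NP K"
  obtains I where "poly_bounded I"
    "\<And>n k. k \<le> n \<Longrightarrow> \<exists>hs. or_instance B K n k hs \<and> length hs \<le> I n"
proof -
  obtain M1 and T1 p1 :: "nat poly" where M1: "wf_tm M1"
    "\<And>x. x \<in> B \<longleftrightarrow> (\<exists>y. length y = poly p1 (length x) \<and>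
        accepts_within M1 (poly T1 (length (enc x @ 3 # enc y))) (enc x @ 3 # enc y))"
    using assms(1) unfolding in_NP_def by blast
  obtain M2 and T2 p2 :: "nat poly" where M2: "wf_tm M2"
    "\<And>x. x \<in> K \<longleftrightarrow> (\<exists>y. length y = poly p2 (length x) \<and>
        accepts_within M2 (poly T2 (length (enc x @ 3 # enc y))) (enc x @ 3 # enc y))"
    using assms(2) unfolding in_NP_def by blast
  define t1 where "t1 k = poly T1 (k + 1 + poly p1 k)" for k
  define t2 where "t2 k = poly T2 (k + 1 + poly p2 k)" for k
  define c1 where "c1 k = run_cost M1 (k + 1 + poly p1 k + t1 k) (t1 k)" for k
  define c2 where "c2 k = run_cost M2 (k + 1 + poly p2 k + t2 k) (t2 k)" for k
  define a where "a n k = 1 + k + (n + 2) * n" for n k :: nat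
  define b where "b n k = poly p1 k + (n + 2) * poly p2 n" for n k
  define c where "c n k = c1 k + ((n + 2) * c2 n + (Suc (n + 2) * lcost 2 + lcost 1 + lcost 3))" for n k
  define s where "s n k = a n k + b n k + c n k" for n k
  define I where "I n = (a n n + 3 * s n n + 1) * (2 * (a n n + b n n + s n n) + 2)" for n
  have I: "poly_bounded I"
    unfolding I_def s_def a_def b_def c_def c1_def c2_def t1_def t2_def
    by (intro poly_bounded_intros poly_bounded_run_cost)
  have "\<exists>hs. or_instance B K n k hs \<and> length hs \<le> I n" if kn: "k \<le> n" for n k
  proof -
    let ?m = "a n k + b n k"
    define A where "A u = accepts_within M1 (t1 k) (enc (sub u 1 k) @ 3 # enc (sub u (a n k) (poly p1 k)))" for u
    define D where "D i u = accepts_within M2 (t2 n) (enc (sub u (1 + k + i * n) n) @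
        3 # enc (sub u (a n k + poly p1 k + i * poly p2 n) (poly p2 n)))" for i u
    define E where "E u = (\<exists>i\<in>{..<n + 2}. D i u)" for u
    define f where "f u = (u ! 0 \<and> A u \<or> E u)" for u
    have A: "ext ?m (inputs ?m) (c1 k) {A}"
      unfolding A_def c1_def by (rule ext_verifier[OF M1(1)]) (auto simp: a_def b_def)
    have off: "i * l + l \<le> (n + 2) * l" if "i < n + 2" for i l
      using mult_le_mono1[of "Suc i" "n + 2" l] that by simp
    have D: "ext ?m (inputs ?m) (c2 n) {D i}" if i: "i < n + 2" for i
      unfolding D_def c2_def
      by (rule ext_verifier[OF M2(1)]) (use off[OF i, of n] off[OF i, of "poly p2 n"] in \<open>auto simp: a_def b_def\<close>)
    have "ext ?m (inputs ?m) (card {..<n + 2} * c2 n) (\<Union>i\<in>{..<n + 2}. {D i})"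
      by (rule ext_UN) (use D in auto)
    moreover have "(\<Union>i\<in>{..<n + 2}. {D i}) = D ` {..<n + 2}" by blast
    ultimately have Ds: "ext ?m (inputs ?m) ((n + 2) * c2 n) (D ` {..<n + 2})" by simp
    have "ext ?m (inputs ?m \<union> D ` {..<n + 2}) (Suc (card {..<n + 2}) * lcost (Suc 1) + lcost 1)
        {\<lambda>x. \<exists>i\<in>{..<n + 2}. D i x}"
      by (rule ext_bex, simp, rule loc_mem, blast)
    then have "ext ?m (inputs ?m \<union> D ` {..<n + 2}) (Suc (n + 2) * lcost 2 + lcost 1) {\<lambda>x. \<exists>i\<in>{..<n + 2}. D i x}"
      unfolding card_lessThan one_add_one[symmetric] Suc_eq_plus1 .
    moreover have "(\<lambda>x. \<exists>i\<in>{..<n + 2}. D i x) = E" by (simp add: E_def fun_eq_iff)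
    ultimately have "ext ?m (inputs ?m \<union> D ` {..<n + 2}) (Suc (n + 2) * lcost 2 + lcost 1) {E}" by simp
    from ext_trans[OF Ds this]
    have E: "ext ?m (inputs ?m) ((n + 2) * c2 n + (Suc (n + 2) * lcost 2 + lcost 1)) {E}" .
    let ?F = "inputs ?m \<union> ({A} \<union> {E})"
    have "loc ?m ?F 1 (\<lambda>u. u ! 0)" by (rule loc_mem) (simp add: inputs_def a_def)
    moreover have "loc ?m ?F 1 A" by (rule loc_mem) simp
    ultimately have "loc ?m ?F (1 + 1) (\<lambda>u. u ! 0 \<and> A u)" by (rule loc_op[where P = "(\<and>)"])
    moreover have "loc ?m ?F 1 E" by (rule loc_mem) simp
    ultimately have "loc ?m ?F (1 + 1 + 1) (\<lambda>u. u ! 0 \<and> A u \<or> E u)" by (rule loc_op[where P = "(\<or>)"])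
    moreover have "(\<lambda>u. u ! 0 \<and> A u \<or> E u) = f" by (simp add: f_def fun_eq_iff)
    ultimately have "ext ?m ?F (lcost 3) {f}" using ext_loc[of ?m ?F 3 f] by (simp add: numeral_3_eq_3)
    from ext_trans[OF ext_Un[OF A E] this]
    have "ext ?m (inputs ?m) (c n k) {f}" by (rule ext_mono) (simp_all add: c_def)
    then obtain fs where fs: "slp ?m fs" "length fs \<le> ?m + c n k" "{f} \<subseteq> set fs"
      by (rule ext_slp)
    from fs(3) have "f \<in> set fs" by simp
    then obtain hs where hs:
      "length hs \<le> (a n k + 3 * length fs + 1) * (2 * (a n k + b n k + length fs) + 2)"
      "\<And>h. h \<in> set hs \<Longrightarrow> loc (a n k) (inputs (a n k)) 1 h"
      "\<And>z. length z = a n k \<Longrightarrow> map (\<lambda>h. h z) hs \<in> CNF \<longleftrightarrow> (\<exists>w. length w = b n k \<and> f (z @ w))"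
      by (rule slp_CNF_instance[OF fs(1)]) blast
    have mono: "a n k \<le> a n n" "b n k \<le> b n n" "s n k \<le> s n n"
    proof -
      have "poly p1 k \<le> poly p1 n" using kn by (rule poly_nat_mono)
      moreover have "t1 k \<le> t1 n" unfolding t1_def
        by (rule poly_nat_mono) (use kn calculation in simp)
      ultimately have "c1 k \<le> c1 n" unfolding c1_def using kn by (intro run_cost_mono) simp_all
      then show "a n k \<le> a n n" "b n k \<le> b n n" "s n k \<le> s n n"
        using kn \<open>poly p1 k \<le> poly p1 n\<close> by (simp_all add: a_def b_def s_def c_def)
    qed
    have "length fs \<le> s n n" using fs(2) mono(3) by (simp add: s_def)
    then have "length hs \<le> I n"
      unfolding I_def using mono(1,2) by (intro order_trans[OF hs(1)] mult_le_mono) simp_all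
    moreover have "or_instance B K n k hs"
      unfolding or_instance_def
    proof (intro conjI ballI allI impI)
      fix h assume "h \<in> set hs"
      then show "loc (1 + k + (n + 2) * n) (inputs (1 + k + (n + 2) * n)) 1 h"
        using hs(2) by (simp add: a_def)
    next
      fix e :: bool and x :: "bool list" and ys :: "bool list list"
      assume x: "length x = k" and ys: "length ys = n + 2" "\<forall>y\<in>set ys. length y = n"
      let ?z = "e # x @ concat ys"
      have "length (concat ys) = (n + 2) * n" using length_concat_uniform[of ys n] ys by simp
      then have z: "length ?z = a n k" using x by (simp add: a_def)
      have yi: "sub (?z @ w) (1 + k + i * n) n = ys ! i" if "i < n + 2" for i w
        using sub_concat[of ys n i "1 + k + i * n" "e # x" w] that ys x by simp
      have xs: "sub (?z @ w) 1 k = x" for w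
        using sub_append[of 1 "[e]" k x "concat ys @ w"] x by simp
      have ws: "sub (?z @ w) (a n k + p) l = sub w p l" for w p l
        using sub_append_right[of ?z "a n k + p" w l] z by simp
      \<comment> \<open>A certificate is placed into its slot and all other slots are filled with
        False, since one true disjunct is enough.\<close>
      have wit: "\<exists>w. length w = b n k \<and> sub w p l = v" if "length v = l" "p + l \<le> b n k" for p l and v :: "bool list"
        by (rule exI[of _ "replicate p False @ v @ replicate (b n k - (p + l)) False"])
          (use that sub_append[of p "replicate p False" l v] in simp)
      have Aw: "A (?z @ w) = accepts_within M1 (poly T1 (length (enc x @ 3 # enc v))) (enc x @ 3 # enc v)"
        if "v = sub w 0 (poly p1 k)" "length w = b n k" for v w
      proof -
        have "length v = poly p1 k" using that by (simp add: length_sub b_def)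
        then show ?thesis using ws[of w 0 "poly p1 k"] that(1) x by (simp add: A_def xs[simplified] t1_def)
      qed
      have Dw: "D i (?z @ w) = accepts_within M2 (poly T2 (length (enc (ys ! i) @ 3 # enc v))) (enc (ys ! i) @ 3 # enc v)"
        if v: "v = sub w (poly p1 k + i * poly p2 n) (poly p2 n)" "length w = b n k" and i: "i < n + 2" for v w i
      proof -
        have "length v = poly p2 n" using v off[OF i, of "poly p2 n"] by (simp add: length_sub b_def)
        moreover have "length (ys ! i) = n" using ys i by simp
        ultimately show ?thesis
          using ws[of w "poly p1 k + i * poly p2 n" "poly p2 n"] v(1) yi[OF i, of w]
          by (simp add: D_def t2_def add.assoc)
      qed
      have "map (\<lambda>h. h ?z) hs \<in> CNF \<longleftrightarrow> (\<exists>w. length w = b n k \<and> f (?z @ w))"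
        by (rule hs(3)[OF z])
      also have "\<dots> \<longleftrightarrow> e \<and> x \<in> B \<or> (\<exists>y\<in>set ys. y \<in> K)"
      proof
        assume "\<exists>w. length w = b n k \<and> f (?z @ w)"
        then obtain w where w: "length w = b n k" "f (?z @ w)" by blast
        show "e \<and> x \<in> B \<or> (\<exists>y\<in>set ys. y \<in> K)"
        proof (cases "e \<and> A (?z @ w)")
          case True
          have "length (sub w 0 (poly p1 k)) = poly p1 (length x)"
            using w(1) x by (simp add: length_sub b_def)
          then have "x \<in> B" using M1(2)[of x] Aw[OF refl w(1)] True by blast
          then show ?thesis using True by blast
        next
          case False
          then obtain i where i: "i < n + 2" "D i (?z @ w)" using w(2) by (auto simp: f_def E_def)
          have "length (sub w (poly p1 k + i * poly p2 n) (poly p2 n)) = poly p2 (length (ys ! i))"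
            using w(1) ys i(1) off[OF i(1), of "poly p2 n"] by (simp add: length_sub b_def)
          then have "ys ! i \<in> K" using M2(2)[of "ys ! i"] Dw[OF refl w(1) i(1)] i(2) by blast
          then show ?thesis using i(1) ys(1) nth_mem by metis
        qed
      next
        assume "e \<and> x \<in> B \<or> (\<exists>y\<in>set ys. y \<in> K)"
        then consider "e" "x \<in> B" | i where "i < n + 2" "ys ! i \<in> K"
          using ys(1) by (metis in_set_conv_nth)
        then show "\<exists>w. length w = b n k \<and> f (?z @ w)"
        proof cases
          case 1
          then obtain v where v: "length v = poly p1 k"
            "accepts_within M1 (poly T1 (length (enc x @ 3 # enc v))) (enc x @ 3 # enc v)"
            using M1(2)[of x] x by blast
          obtain w where w: "length w = b n k" "sub w 0 (poly p1 k) = v"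
            using wit[of v "poly p1 k" 0] v(1) by (auto simp: b_def)
          have "A (?z @ w)" using Aw[OF w(2)[symmetric] w(1)] v(2) by blast
          then have "f (?z @ w)" using 1(1) by (simp add: f_def)
          then show ?thesis using w(1) by blast
        next
          case 2
          have "length (ys ! i) = n" using ys 2(1) by simp
          then obtain v where v: "length v = poly p2 n"
            "accepts_within M2 (poly T2 (length (enc (ys ! i) @ 3 # enc v))) (enc (ys ! i) @ 3 # enc v)"
            using M2(2)[of "ys ! i"] 2(2) by auto
          obtain w where w: "length w = b n k" "sub w (poly p1 k + i * poly p2 n) (poly p2 n) = v"
            using wit[of v "poly p2 n" "poly p1 k + i * poly p2 n"] v(1) off[OF 2(1), of "poly p2 n"]
            by (auto simp: b_def)
          have "D i (?z @ w)" using Dw[OF w(2)[symmetric] w(1) 2(1)] v(2) by blast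
          then have "f (?z @ w)" using 2(1) unfolding f_def E_def by blast
          then show ?thesis using w(1) by blast
        qed
      qed
      finally show "map (\<lambda>h. h ?z) hs \<in> CNF \<longleftrightarrow> e \<and> x \<in> B \<or> (\<exists>y\<in>set ys. y \<in> K)" .
    qed
    ultimately show ?thesis by blast
  qed
  with I show ?thesis by (rule that)
qed

text \<open>Reading at most one bit survives the substitution of functions that read at most one
  bit. So the formula can be fed with any mixture of constants and wires.\<close>

lemma loc_subst:
  assumes "loc a (inputs a) 1 h"
    and "\<And>x. length x = m \<Longrightarrow> length (e x) = a" "\<And>i. i < a \<Longrightarrow> loc m F 1 (\<lambda>x. e x ! i)"
  shows "loc m F 1 (\<lambda>x. h (e x))"
proof -
  obtain D where D: "D \<subseteq> inputs a" "finite D" "card D \<le> 1" "det a D h"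
    using assms(1) unfolding loc_def by blast
  show ?thesis
  proof (cases "D = {}")
    case True
    then have "det m {} (\<lambda>x. h (e x))"
      using D(4) assms(2) by (simp add: det_def)
    then show ?thesis by (intro locI[of "{}"]) simp_all
  next
    case False
    then have "card D = 1" using D(2,3) by (simp add: card_gt_0_iff le_antisym Suc_leI)
    then obtain d where "D = {d}" by (auto simp: card_1_singleton_iff)
    then obtain i where i: "i < a" "D = {\<lambda>z. z ! i}" using D(1) by (auto simp: inputs_def)
    obtain D' where D': "D' \<subseteq> F" "finite D'" "card D' \<le> 1" "det m D' (\<lambda>x. e x ! i)"
      using assms(3)[OF i(1)] unfolding loc_def by blast
    have "det m D' (\<lambda>x. h (e x))"
    proof (rule detI)
      fix x x' assume x: "length x = m" "length x' = m" and eq: "\<And>f. f \<in> D' \<Longrightarrow> f x = f x'"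
      then have "e x ! i = e x' ! i" using D'(4) unfolding det_def by blast
      then show "h (e x) = h (e x')" using D(4) assms(2) x unfolding det_def i(2) by simp
    qed
    then show ?thesis by (rule locI[OF D'(1-3)])
  qed
qed

text \<open>The number of bits in \<open>hs\<close> is fixed and with it the running time, so the
  machine can be unrolled although the bits themselves vary with the input.\<close>

lemma ext_FP_output:
  assumes M: "wf_tm M" "\<And>y. tm_output (run M (poly T (length y)) (enc y)) = g y"
    and hs: "\<And>h. h \<in> set hs \<Longrightarrow> loc m F 1 h"
    and N: "length hs + poly T (length hs) \<le> N"
  shows "ext m F (out_cost M N (poly T (length hs))) (out_bits N (\<lambda>x. g (map (\<lambda>h. h x) hs)))"
    and "length (g (map (\<lambda>h. h x) hs)) \<le> Suc N"
proof -
  have syms: "set (enc y) \<subseteq> {..<nsyms M}" for y using set_enc[of y] M(1) by (auto simp: wf_tm_def)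
  have g: "tm_output (run M (poly T (length hs)) (enc (map (\<lambda>h. h x) hs))) = g (map (\<lambda>h. h x) hs)" for x
    using M(2)[of "map (\<lambda>h. h x) hs"] by simp
  have "loc m F 1 (\<lambda>x. enc (map (\<lambda>h. h x) hs) ! i)" if "i < length hs" for i
  proof -
    have "(\<lambda>x. enc (map (\<lambda>h. h x) hs) ! i) = (\<lambda>x. if (hs ! i) x then 2 else 1)"
      using that by (simp add: enc_nth)
    moreover have "loc m F 1 (\<lambda>x. if (hs ! i) x then 2 else 1 :: nat)"
      by (rule loc_comp[where P = "\<lambda>b. if b then 2 else 1 :: nat"], rule hs) (use that in simp)
    ultimately show ?thesis by simp
  qed
  from ext_output[OF M(1) _ syms this N]
  show "ext m F (out_cost M N (poly T (length hs))) (out_bits N (\<lambda>x. g (map (\<lambda>h. h x) hs)))"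
    unfolding g by simp
  show "length (g (map (\<lambda>h. h x) hs)) \<le> Suc N"
    using length_tm_output_le[OF M(1) syms, of "map (\<lambda>h. h x) hs" "poly T (length hs)" N] N unfolding g by simp
qed

section \<open>Covering arguments\<close>

text \<open>Each choice at least halves what is still uncovered. The hypothesis speaks of all
  nonempty subsets because it is applied to leftovers that cannot be predicted.\<close>

lemma halving_cover:
  assumes "finite S0" "card S0 < 2 ^ j"
    and "\<And>S. S \<subseteq> S0 \<Longrightarrow> S \<noteq> {} \<Longrightarrow> \<exists>c\<in>T. card S \<le> 2 * card {y \<in> S. cov c y}"
  shows "\<exists>cs. length cs \<le> j \<and> set cs \<subseteq> T \<and> (\<forall>y\<in>S0. \<exists>c\<in>set cs. cov c y)"
  using assms
proof (induction j arbitrary: S0)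
  case 0
  then have "S0 = {}" by simp
  then show ?case by (intro exI[of _ "[]"]) simp
next
  case (Suc j)
  show ?case
  proof (cases "S0 = {}")
    case True
    then show ?thesis by (intro exI[of _ "[]"]) simp
  next
    case False
    then obtain c where c: "c \<in> T" "card S0 \<le> 2 * card {y \<in> S0. cov c y}"
      using Suc.prems(3)[of S0] by blast
    define S1 where "S1 = {y \<in> S0. \<not> cov c y}"
    have "card S0 = card {y \<in> S0. cov c y} + card S1"
      unfolding S1_def using Suc.prems(1)
      by (subst card_Un_disjoint[symmetric]) (auto intro: arg_cong[of _ _ card])
    then have "2 * card S1 \<le> card S0" using c(2) by linarith
    then have "card S1 < 2 ^ j" using Suc.prems(2) by simp
    have S1: "S1 \<subseteq> S0" by (auto simp: S1_def)
    have "\<exists>c\<in>T. card S \<le> 2 * card {y \<in> S. cov c y}" if "S \<subseteq> S1" "S \<noteq> {}" for S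
      by (rule Suc.prems(3)[OF subset_trans[OF that(1) S1] that(2)])
    from Suc.IH[OF finite_subset[OF S1 Suc.prems(1)] \<open>card S1 < 2 ^ j\<close> this]
    obtain cs where cs: "length cs \<le> j" "set cs \<subseteq> T" "\<forall>y\<in>S1. \<exists>c\<in>set cs. cov c y"
      by blast
    show ?thesis
    proof (intro exI[of _ "c # cs"] conjI ballI)
      fix y assume "y \<in> S0"
      then show "\<exists>d\<in>set (c # cs). cov d y"
        using cs(3) by (cases "cov c y") (simp_all add: S1_def)
    qed (use cs(1,2) c(1) in simp_all)
  qed
qed

section \<open>Counting tuples and short strings\<close>

definition tuples :: "nat \<Rightarrow> 'a set \<Rightarrow> 'a list set" where
  "tuples t S = {ys. set ys \<subseteq> S \<and> length ys = t}"

lemma finite_tuples: "finite S \<Longrightarrow> finite (tuples t S)"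
  unfolding tuples_def by (rule finite_lists_length_eq)

lemma card_tuples: "finite S \<Longrightarrow> card (tuples t S) = card S ^ t"
  unfolding tuples_def by (rule card_lists_length_eq)

lemma tuples_mono: "S \<subseteq> S' \<Longrightarrow> tuples t S \<subseteq> tuples t S'"
  by (auto simp: tuples_def)

text \<open>The tuples with \<open>P\<close> are tuples over the elements that they mention. Were
  these less than half of \<open>S\<close>, such tuples would be less than a \<open>2 ^ -t\<close>
  fraction of all.\<close>

lemma dense_tuples:
  assumes "finite S" "0 < t" "card (tuples t S) \<le> 2 ^ t * card {ys \<in> tuples t S. P ys}"
  shows "card S \<le> 2 * card {y \<in> S. \<exists>ys\<in>tuples t S. y \<in> set ys \<and> P ys}"
proof (rule ccontr)
  let ?S = "{y \<in> S. \<exists>ys\<in>tuples t S. y \<in> set ys \<and> P ys}"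
  assume "\<not> ?thesis"
  then have lt: "2 * card ?S < card S" by simp
  have "{ys \<in> tuples t S. P ys} \<subseteq> tuples t ?S" by (auto simp: tuples_def)
  moreover have "finite (tuples t ?S)" by (rule finite_tuples) (simp add: assms(1))
  ultimately have "card {ys \<in> tuples t S. P ys} \<le> card (tuples t ?S)" by (intro card_mono)
  also have "\<dots> = card ?S ^ t" by (rule card_tuples) (simp add: assms(1))
  finally have "card S ^ t \<le> 2 ^ t * card ?S ^ t"
    using assms(3) unfolding card_tuples[OF assms(1)] by (meson mult_le_mono2 order_trans)
  also have "\<dots> = (2 * card ?S) ^ t" by (simp add: power_mult_distrib)
  also have "\<dots> < card S ^ t" using lt assms(2) by (intro power_strict_mono) auto
  finally show False by simp
qed

lemma popular_value:
  assumes "finite Q" "finite V" "V \<noteq> {}" "\<And>q. q \<in> Q \<Longrightarrow> f q \<in> V"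
  shows "\<exists>v\<in>V. card Q \<le> card V * card {q \<in> Q. f q = v}"
proof (rule ccontr)
  assume "\<not> ?thesis"
  then have "(\<Sum>v\<in>V. card V * card {q \<in> Q. f q = v}) < (\<Sum>v\<in>V. card Q)"
    by (intro sum_strict_mono assms(2,3)) (simp add: not_le)
  then have "card V * (\<Sum>v\<in>V. card {q \<in> Q. f q = v}) < card V * card Q"
    by (simp add: sum_distrib_left)
  then have "(\<Sum>v\<in>V. card {q \<in> Q. f q = v}) < card Q" by simp
  moreover have "card Q \<le> card (\<Union>v\<in>V. {q \<in> Q. f q = v})"
    using assms(1,2,4) by (intro card_mono) auto
  moreover have "\<dots> \<le> (\<Sum>v\<in>V. card {q \<in> Q. f q = v})" by (rule card_UN_le[OF assms(2)])
  ultimately show False by simp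
qed

definition short :: "nat \<Rightarrow> bool list set" where
  "short n = {u. length u \<le> n}"

text \<open>The count is one below a power of two, which leaves room for the extra value
  \<open>None\<close> within \<open>2 ^ Suc n\<close>.\<close>

lemma card_short: "finite (short n) \<and> Suc (card (short n)) = 2 ^ Suc n"
proof (induction n)
  case 0
  have "short 0 = {[]}" by (auto simp: short_def)
  then show ?case by simp
next
  case (Suc n)
  let ?E = "{u :: bool list. set u \<subseteq> UNIV \<and> length u = Suc n}"
  have E: "finite ?E" "card ?E = 2 ^ Suc n"
    using finite_lists_length_eq[of "UNIV :: bool set" "Suc n"]
      card_lists_length_eq[of "UNIV :: bool set" "Suc n"] by simp_all
  have "short (Suc n) = short n \<union> ?E" "short n \<inter> ?E = {}" by (auto simp: short_def)
  then show ?case using Suc E by (simp add: card_Un_disjoint)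
qed

text \<open>Identifying all long outputs leaves at most \<open>2 ^ Suc n\<close> values, so
  pigeonholing also works when most outputs are long. \<open>None\<close> can certify a tuple if no
  long output lies in \<open>A\<close>.\<close>

definition trunc :: "nat \<Rightarrow> bool list \<Rightarrow> bool list option" where
  "trunc n u = (if length u \<le> n then Some u else None)"

lemma popular_trunc:
  assumes "finite S"
  shows "\<exists>v\<in>insert None (Some ` short n).
    card S \<le> 2 * card {y \<in> S. \<exists>ys\<in>tuples (n + 2) S. y \<in> set ys \<and> trunc n (G ys) = v}"
proof -
  let ?V = "insert None (Some ` short n)"
  have V: "finite ?V" "card ?V \<le> 2 ^ Suc n"
    using card_short[of n] card_image[of Some "short n"] by (auto simp: card_insert_if)
  have "\<exists>v\<in>?V. card (tuples (n + 2) S) \<le> card ?V * card {ys \<in> tuples (n + 2) S. trunc n (G ys) = v}"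
    by (rule popular_value[OF finite_tuples[OF assms] V(1)]) (simp_all add: trunc_def short_def)
  then obtain v where v: "v \<in> ?V"
    "card (tuples (n + 2) S) \<le> card ?V * card {ys \<in> tuples (n + 2) S. trunc n (G ys) = v}"
    by (rule bexE)
  have "card ?V \<le> 2 ^ (n + 2)" using V(2) by simp
  note order_trans[OF v(2) mult_le_mono1[OF this]]
  from dense_tuples[OF assms _ this] show ?thesis by (intro bexI[OF _ v(1)]) simp
qed

text \<open>The source of the tuple length: a factor 2 for discarding long outputs and
  \<open>2 ^ Suc n\<close> for fixing the short one make \<open>2 ^ (n + 2)\<close>, the ratio that
  \<open>dense_tuples\<close> accepts.\<close>

lemma popular_short:
  assumes "finite S" "card (tuples (n + 2) S) \<le> 2 * card {ys \<in> tuples (n + 2) S. length (G ys) \<le> n}"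
  shows "\<exists>v\<in>short n. card S \<le> 2 * card {y \<in> S. \<exists>ys\<in>tuples (n + 2) S. y \<in> set ys \<and> G ys = v}"
proof -
  let ?Q = "{ys \<in> tuples (n + 2) S. length (G ys) \<le> n}"
  have Q: "finite ?Q" using finite_tuples[OF assms(1)] by simp
  have "[] \<in> short n" by (simp add: short_def)
  then have "short n \<noteq> {}" by (metis empty_iff)
  then have "\<exists>v\<in>short n. card ?Q \<le> card (short n) * card {ys \<in> ?Q. G ys = v}"
    by (intro popular_value Q card_short[THEN conjunct1]) (simp_all add: short_def)
  then obtain v where v: "v \<in> short n" "card ?Q \<le> card (short n) * card {ys \<in> ?Q. G ys = v}"
    by (rule bexE)
  have eq: "{ys \<in> ?Q. G ys = v} = {ys \<in> tuples (n + 2) S. G ys = v}"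
    using v(1) by (auto simp: short_def)
  have "card (short n) \<le> 2 ^ Suc n" using card_short[of n] by linarith
  note order_trans[OF v(2)[unfolded eq] mult_le_mono1[OF this]]
  then have "card (tuples (n + 2) S) \<le> 2 ^ (n + 2) * card {ys \<in> tuples (n + 2) S. G ys = v}"
    using assms(2) by simp
  from dense_tuples[OF assms(1) _ this] show ?thesis by (intro bexI[OF _ v(1)]) simp
qed

text \<open>Double counting of the pairs in \<open>R\<close>: if every row is at least half full, so
  is some column.\<close>

lemma exists_good_column:
  assumes "finite Q" "Q \<noteq> {}" "finite X"
    and "\<And>x. x \<in> X \<Longrightarrow> card Q \<le> 2 * card {q \<in> Q. R x q}"
  shows "\<exists>q\<in>Q. card X \<le> 2 * card {x \<in> X. R x q}"
proof (rule ccontr)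
  assume "\<not> ?thesis"
  then have "(\<Sum>q\<in>Q. 2 * card {x \<in> X. R x q}) < (\<Sum>q\<in>Q. card X)"
    by (intro sum_strict_mono assms(1,2)) (simp add: not_le)
  moreover have "(\<Sum>q\<in>Q. 2 * card {x \<in> X. R x q}) = (\<Sum>x\<in>X. 2 * card {q \<in> Q. R x q})"
  proof -
    have "card {x \<in> X. R x q} = (\<Sum>x\<in>X. if R x q then 1 else 0)" for q
      using assms(3) by (simp add: sum.If_cases Int_def)
    moreover have "card {q \<in> Q. R x q} = (\<Sum>q\<in>Q. if R x q then 1 else 0)" for x
      using assms(1) by (simp add: sum.If_cases Int_def)
    ultimately show ?thesis
      unfolding sum_distrib_left[symmetric] by (simp only: sum.swap[of _ X Q])
  qed
  moreover have "(\<Sum>x\<in>X. card Q) \<le> (\<Sum>x\<in>X. 2 * card {q \<in> Q. R x q})"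
    by (intro sum_mono assms(4))
  ultimately show False by (simp add: mult.commute)
qed

text \<open>If every nonempty \<open>S\<close> has an \<open>x\<close> with short outputs on at
  least half of its tuples, halving over \<open>S0\<close> gives the cover. A set \<open>S\<close>
  without such an \<open>x\<close> is useful itself: every \<open>x\<close> has long outputs on more
  than half of its tuples, so averaging finds a tuple that suits half of any given subset of
  \<open>X0\<close>, and halving runs over \<open>X0\<close> instead.\<close>

lemma long_or_covered:
  fixes G :: "'x \<Rightarrow> bool list list \<Rightarrow> bool list"
  assumes "finite S0" "card S0 < 2 ^ Suc n" "finite X0" "card X0 < 2 ^ Suc n"
  obtains
    (long) Ys where "length Ys \<le> Suc n" "set Ys \<subseteq> tuples (n + 2) S0"
      "\<And>x. x \<in> X0 \<Longrightarrow> \<exists>ys\<in>set Ys. n < length (G x ys)"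
  | (covered) cs where "length cs \<le> Suc n" "set cs \<subseteq> X0 \<times> short n"
      "\<And>y. y \<in> S0 \<Longrightarrow> \<exists>(x, u)\<in>set cs. \<exists>ys\<in>tuples (n + 2) S0. y \<in> set ys \<and> G x ys = u"
proof (cases "\<forall>S\<subseteq>S0. S \<noteq> {} \<longrightarrow>
    (\<exists>x\<in>X0. card (tuples (n + 2) S) \<le> 2 * card {ys \<in> tuples (n + 2) S. length (G x ys) \<le> n})")
  case True
  let ?cov = "\<lambda>(x, u) y. \<exists>ys\<in>tuples (n + 2) S0. y \<in> set ys \<and> G x ys = u"
  have "\<exists>c\<in>X0 \<times> short n. card S \<le> 2 * card {y \<in> S. ?cov c y}" if S: "S \<subseteq> S0" "S \<noteq> {}" for S
  proof -
    have fin: "finite S" using S(1) assms(1) by (rule finite_subset)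
    obtain x where x: "x \<in> X0"
      "card (tuples (n + 2) S) \<le> 2 * card {ys \<in> tuples (n + 2) S. length (G x ys) \<le> n}"
      using True S by blast
    obtain u where u: "u \<in> short n"
      "card S \<le> 2 * card {y \<in> S. \<exists>ys\<in>tuples (n + 2) S. y \<in> set ys \<and> G x ys = u}"
      using popular_short[OF fin x(2)] by blast
    have "card {y \<in> S. \<exists>ys\<in>tuples (n + 2) S. y \<in> set ys \<and> G x ys = u} \<le> card {y \<in> S. ?cov (x, u) y}"
      using fin tuples_mono[OF S(1), of "n + 2"] by (intro card_mono) auto
    then have "card S \<le> 2 * card {y \<in> S. ?cov (x, u) y}" using u(2) by linarith
    then show ?thesis using x(1) u(1) by (intro bexI[of _ "(x, u)"]) simp_all
  qed
  from halving_cover[OF assms(1,2) this] obtain cs where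
    "length cs \<le> Suc n" "set cs \<subseteq> X0 \<times> short n" "\<forall>y\<in>S0. \<exists>c\<in>set cs. ?cov c y" by blast
  note cs = this
  show ?thesis
  proof (rule covered[OF cs(1,2)])
    fix y assume "y \<in> S0"
    with cs(3) obtain x u where "(x, u) \<in> set cs" "?cov (x, u) y" by fast
    then show "\<exists>(x, u)\<in>set cs. \<exists>ys\<in>tuples (n + 2) S0. y \<in> set ys \<and> G x ys = u"
      by (intro bexI[of _ "(x, u)"]) simp_all
  qed
next
  case False
  then obtain S where S: "S \<subseteq> S0" "S \<noteq> {}"
    "\<And>x. x \<in> X0 \<Longrightarrow> 2 * card {ys \<in> tuples (n + 2) S. length (G x ys) \<le> n} < card (tuples (n + 2) S)"
    by (auto simp: not_le)
  let ?Q = "tuples (n + 2) S"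
  have fin: "finite ?Q" by (rule finite_tuples[OF finite_subset[OF S(1) assms(1)]])
  obtain y where "y \<in> S" using S(2) by blast
  \<comment> \<open>Tuples may repeat entries, so a single element of \<open>S\<close> is enough to
    build one.\<close>
  then have "replicate (n + 2) y \<in> ?Q" by (simp add: tuples_def set_replicate_conv_if)
  then have ne: "?Q \<noteq> {}" by blast
  have half: "card ?Q \<le> 2 * card {ys \<in> ?Q. n < length (G x ys)}" if "x \<in> X0" for x
  proof -
    have "card ?Q = card {ys \<in> ?Q. length (G x ys) \<le> n} + card {ys \<in> ?Q. n < length (G x ys)}"
      using fin by (subst card_Un_disjoint[symmetric]) (auto intro: arg_cong[of _ _ card])
    then show ?thesis using S(3)[OF that] by linarith
  qed
  have "\<exists>ys\<in>?Q. card X \<le> 2 * card {x \<in> X. n < length (G x ys)}" if X: "X \<subseteq> X0" for X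
    by (rule exists_good_column[OF fin ne finite_subset[OF X assms(3)]]) (use half X in blast)
  from halving_cover[OF assms(3,4), of ?Q "\<lambda>ys x. n < length (G x ys)", OF this] obtain Ys where
    "length Ys \<le> Suc n" "set Ys \<subseteq> ?Q" "\<forall>x\<in>X0. \<exists>ys\<in>set Ys. n < length (G x ys)" by blast
  note Ys = this
  show ?thesis
  proof (rule long[OF Ys(1)])
    show "set Ys \<subseteq> tuples (n + 2) S0" using Ys(2) tuples_mono[OF S(1)] by (rule subset_trans)
    show "\<exists>ys\<in>set Ys. n < length (G x ys)" if "x \<in> X0" for x using Ys(3) that by blast
  qed
qed

lemma concat_sub:
  assumes "length w = t * n"
  shows "concat (map (\<lambda>i. sub w (i * n) n) [0..<t]) = w"
proof -
  have "concat (map (\<lambda>i. sub w (i * n) n) [0..<s]) = take (s * n) w" for s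
  proof (induction s)
    case (Suc s)
    have "take (Suc s * n) w = take (s * n) w @ take n (drop (s * n) w)"
      using take_add[of "s * n" n w] by (simp add: add.commute)
    with Suc show ?case by (simp add: sub_def)
  qed simp
  then show ?thesis using assms by simp
qed

lemma decode_pairs_blocks:
  "decode_pairs (concat (map (\<lambda>i. [v i, b i]) is) @ zs) = map b (filter v is) @ decode_pairs zs"
  by (induction "is") simp_all

section \<open>Length-increasing reductions or nondeterministic tests\<close>

lemma map_filter_nth:
  assumes "length w \<le> m"
  shows "map (\<lambda>i. i < length w \<and> w ! i) (filter (\<lambda>i. i < length w) [0..<m]) = w"
proof -
  have "[0..<m] = [0..<length w] @ [length w..<m]"
    using upt_add_eq_append[of 0 "length w" "m - length w"] assms by simp
  then have "filter (\<lambda>i. i < length w) [0..<m] = [0..<length w]" by simp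
  then show ?thesis by (auto intro: nth_equalityI)
qed

text \<open>Masking the presence bits alone silences a block, so choosing among strings of different
  lengths leaves the value bits untouched. The fallback \<open>w\<close> is switched by
  \<open>e\<close> in the same way.\<close>

lemma decode_pairs_selected:
  assumes "\<And>j. j \<in> set js \<Longrightarrow> length (u j) \<le> m"
  shows "decode_pairs (concat (map (\<lambda>j. concat (map (\<lambda>i. [s j \<and> i < length (u j), i < length (u j) \<and> u j ! i]) [0..<m])) js)
      @ concat (map (\<lambda>b. [e, b]) w)) =
    concat (map (\<lambda>j. if s j then u j else []) js) @ (if e then w else [])"
  using assms
proof (induction js)
  case Nil
  show ?case using decode_pairs_blocks[of "\<lambda>_. e" "\<lambda>b. b" w "[]"] by simp
next
  case (Cons j js)
  have "map (\<lambda>i. i < length (u j) \<and> u j ! i) (filter (\<lambda>i. s j \<and> i < length (u j)) [0..<m]) =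
      (if s j then u j else [])"
    using map_filter_nth[of "u j" m] Cons.prems[of j] by simp
  then show ?case
    using Cons.IH[OF Cons.prems] by (simp add: decode_pairs_blocks)
qed

lemma concat_single:
  "j0 < r \<Longrightarrow> concat (map (\<lambda>j. if j = j0 then v else []) [0..<r]) = v"
proof (induction r)
  case (Suc r)
  have "concat (map (\<lambda>j. if j = j0 then v else []) [0..<r]) = []" if "r \<le> j0" using that by simp
  with Suc show ?case by (cases "j0 = r") auto
qed simp

lemma card_fixed_length: "card {y :: bool list. length y = n \<and> P y} \<le> 2 ^ n"
proof -
  have "card {y :: bool list. length y = n \<and> P y} \<le> card {y :: bool list. set y \<subseteq> UNIV \<and> length y = n}"
    by (intro card_mono finite_lists_length_eq) auto
  then show ?thesis using card_lists_length_eq[of "UNIV :: bool set" n] by simp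
qed

lemma finite_fixed_length: "finite {y :: bool list. length y = n \<and> P y}"
  by (rule finite_subset[OF _ finite_lists_length_eq[of "UNIV :: bool set" n]]) auto

text \<open>Recognising \<open>v\<close> takes only the positions up to \<open>length v\<close>:
  presence and value before it, absence at it. The repeated condition \<open>i < length u\<close> is
  the shape of \<open>val_bit\<close>.\<close>

lemma trunc_Some_iff:
  assumes "length v \<le> n"
  shows "trunc n u = Some v \<longleftrightarrow>
    (\<forall>i\<in>{..length v}. if i = length v then \<not> i < length u else i < length u \<and> (i < length u \<and> u ! i) = v ! i)"
    (is "?l \<longleftrightarrow> ?r")
proof
  assume ?l
  then have "u = v" by (simp add: trunc_def split: if_splits)
  then show ?r by auto
next
  assume r: ?r
  from bspec[OF r, of "length v"] have "length u \<le> length v" by simp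
  moreover have "length v \<le> length u"
  proof (rule ccontr)
    assume "\<not> ?thesis"
    then have "length u \<in> {..length v}" "length u \<noteq> length v" by auto
    with bspec[OF r, of "length u"] show False by simp
  qed
  ultimately have len: "length u = length v" by simp
  have "u ! i = v ! i" if "i < length v" for i using bspec[OF r, of i] that len by simp
  then have "u = v" using len by (intro nth_equalityI) auto
  then show ?l using assms by (simp add: trunc_def)
qed

text \<open>One pair of lengths with its formula \<open>hs\<close> and the machine for
  \<open>g\<close>. \<open>N\<close> bounds the tape window; \<open>n \<le> N\<close> puts position
  \<open>n\<close>, whose presence means a long output, among the wires.\<close>

locale or_reduction =
  fixes A B K :: lang and n k N :: nat and hs :: "(bool list \<Rightarrow> bool) list"
    and g :: "bool list \<Rightarrow> bool list" and M :: tm and T :: "nat poly"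
  assumes inst: "or_instance B K n k hs" and wf: "wf_tm M"
    and out: "\<And>y. tm_output (run M (poly T (length y)) (enc y)) = g y"
    and red: "\<And>X. X \<in> CNF \<longleftrightarrow> g X \<in> A"
    and N: "length hs + poly T (length hs) \<le> N" "n \<le> N" and kn: "k \<le> n"
begin

abbreviation len where "len \<equiv> 1 + k + (n + 2) * n"

definition G where "G z = g (map (\<lambda>h. h z) hs)"

definition gcost where "gcost = out_cost M N (poly T (length hs))"

lemma loc_hs: "h \<in> set hs \<Longrightarrow> loc len (inputs len) 1 h"
  using inst unfolding or_instance_def by blast

lemma G_in_A:
  assumes "length x = k" "length ys = n + 2" "\<forall>y\<in>set ys. length y = n"
  shows "G (e # x @ concat ys) \<in> A \<longleftrightarrow> e \<and> x \<in> B \<or> (\<exists>y\<in>set ys. y \<in> K)"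
  unfolding G_def red[symmetric] using inst assms unfolding or_instance_def by blast

lemma length_G: "length (G z) \<le> Suc N"
  unfolding G_def by (rule ext_FP_output(2)[OF wf out loc_hs N(1)])

lemma ext_G:
  assumes "\<And>x. length x = m \<Longrightarrow> length (e x) = len" "\<And>i. i < len \<Longrightarrow> loc m F 1 (\<lambda>x. e x ! i)"
  shows "ext m F gcost (out_bits N (\<lambda>x. G (e x)))"
proof -
  let ?hs = "map (\<lambda>h x. h (e x)) hs"
  have l: "loc m F 1 h" if "h \<in> set ?hs" for h
  proof -
    have "h \<in> (\<lambda>h x. h (e x)) ` set hs" using that by simp
    then obtain h' where h': "h = (\<lambda>x. h' (e x))" "h' \<in> set hs" by (rule imageE)
    show ?thesis unfolding h'(1) by (rule loc_subst[OF loc_hs[OF h'(2)] assms])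
  qed
  have "length ?hs + poly T (length ?hs) \<le> N" using N(1) by simp
  from ext_FP_output(1)[OF wf out l this] show ?thesis
    by (simp add: gcost_def G_def comp_def)
qed

text \<open>After the \<open>k\<close> inputs, in order of construction: the simulations of
  \<open>g\<close>, the selectors, the fallback flag, the masked presence bits and the two
  constants; then the output list.\<close>

definition red_cost where
  "red_cost = k + (Suc n * gcost + (Suc n * (Suc (Suc n) * lcost 2) + (Suc (Suc n) * lcost 2 +
     (Suc n * Suc N * lcost 2 + 2 * lcost 1)))) + (Suc n * (2 * Suc N) + 2 * Suc N)"

lemma reduction_circuit:
  assumes Ys: "length Ys \<le> Suc n" "\<And>ys. ys \<in> set Ys \<Longrightarrow> length ys = n + 2"
      "\<And>ys y. ys \<in> set Ys \<Longrightarrow> y \<in> set ys \<Longrightarrow> length y = n \<and> y \<notin> K"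
    and long: "\<And>x. length x = k \<Longrightarrow> x \<notin> B \<Longrightarrow> \<exists>ys\<in>set Ys. n < length (G (True # x @ concat ys))"
    and w: "w \<in> A" "n < length w" "length w \<le> Suc N"
  shows "\<exists>C. csize C \<le> red_cost \<and> (\<forall>x. length x = k \<longrightarrow>
    n < length (decode_pairs (circ_eval C x)) \<and> (decode_pairs (circ_eval C x) \<in> A \<longleftrightarrow> x \<in> B))"
proof -
  define r where "r = length Ys"
  define u where "u j x = G (True # x @ concat (Ys ! j))" for j x
  define Bits where "Bits = (\<Union>j\<in>{..<r}. out_bits N (u j))"
  \<comment> \<open>Selects the least index whose output is long.\<close>
  define s where "s j x \<longleftrightarrow> (\<forall>i\<in>{..j}. if i = j then len_bit (u i) n x else \<not> len_bit (u i) n x)" for j x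
  define e where "e x \<longleftrightarrow> (\<forall>i\<in>{..<r}. \<not> len_bit (u i) n x)" for x
  define v where "v p x \<longleftrightarrow> s (fst p) x \<and> len_bit (u (fst p)) (snd p) x" for p x
  define c where "c b x \<longleftrightarrow> b" for b :: bool and x :: "bool list"
  have r: "r \<le> Suc n" using Ys(1) by (simp add: r_def)
  have "ext k (inputs k) gcost (out_bits N (u j))" if j: "j < r" for j
    unfolding u_def
  proof (rule ext_G)
    have Yj: "Ys ! j \<in> set Ys" using j by (simp add: r_def)
    have cl: "length (concat (Ys ! j)) = (n + 2) * n"
      using length_concat_uniform[of "Ys ! j" n] Ys(2,3)[OF Yj] by simp
    fix x :: "bool list"
    show "length x = k \<Longrightarrow> length (True # x @ concat (Ys ! j)) = len" using cl by simp
  next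
    fix i assume "i < len"
    let ?e = "\<lambda>x. (True # x @ concat (Ys ! j)) ! i"
    consider "i = 0" | "0 < i" "i < Suc k" | "Suc k \<le> i" by linarith
    then show "loc k (inputs k) 1 ?e"
    proof cases
      case 1
      show ?thesis unfolding 1 nth_Cons_0 by (rule loc_const)
    next
      case 2
      have "loc k (inputs k) 1 ?e = loc k (inputs k) 1 (\<lambda>x. x ! (i - 1))"
        by (rule loc_cong, cases i) (use 2 in \<open>simp_all add: nth_append\<close>)
      then show ?thesis using loc_input[of "i - 1" k] 2 by simp
    next
      case 3
      have "loc k (inputs k) 1 ?e = loc k (inputs k) 1 (\<lambda>x. concat (Ys ! j) ! (i - Suc k))"
        by (rule loc_cong, cases i) (use 3 in \<open>simp_all add: nth_append\<close>)
      then show ?thesis by (simp only: loc_const)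
    qed
  qed
  then have "ext k (inputs k) (card {..<r} * gcost) Bits"
    unfolding Bits_def by (intro ext_UN) simp_all
  then have 1: "ext k (inputs k) (Suc n * gcost) Bits"
    by (rule ext_mono) (use r in \<open>simp_all add: mult_le_mono1 del: mult_Suc\<close>)
  have len_Bits: "len_bit (u j) i \<in> Bits" "val_bit (u j) i \<in> Bits" if "j < r" "i \<le> N" for i j
    using that unfolding Bits_def out_bits_def by blast+
  let ?F = "inputs k \<union> Bits"
  have nlen: "loc k ?F 1 (\<lambda>x. \<not> len_bit (u i) n x)" if "i < r" for i
    by (rule loc_comp[where P = Not], rule loc_mem) (use len_Bits(1)[OF that N(2)] in simp)
  have "ext k ?F (Suc (Suc n) * lcost 2) {s j}" if j: "j < r" for j
  proof -
    have "loc k ?F 1 (\<lambda>x. if i = j then len_bit (u i) n x else \<not> len_bit (u i) n x)" if "i \<in> {..j}" for i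
    proof (cases "i = j")
      case True
      have "loc k ?F 1 (len_bit (u i) n)"
        by (rule loc_mem) (use len_Bits(1)[OF j N(2)] True in simp)
      then show ?thesis using True by simp
    next
      case False
      then show ?thesis using nlen[of i] that j by simp
    qed
    from ext_ball[OF finite_atMost this]
    have "ext k ?F (Suc (card {..j}) * lcost (Suc 1)) {s j}" by (simp only: s_def[abs_def])
    then show ?thesis
      by (rule ext_mono) (use j r in \<open>simp_all add: numeral_2_eq_2 mult_le_mono1 del: mult_Suc\<close>)
  qed
  then have "ext k ?F (card {..<r} * (Suc (Suc n) * lcost 2)) (\<Union>j\<in>{..<r}. {s j})"
    by (intro ext_UN) simp_all
  then have 2: "ext k ?F (Suc n * (Suc (Suc n) * lcost 2)) (s ` {..<r})"
    by (rule ext_mono) (use r in \<open>auto simp: mult_le_mono1 simp del: mult_Suc\<close>)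
  have "ext k ?F (Suc (card {..<r}) * lcost (Suc 1)) {e}"
    unfolding e_def[abs_def] by (rule ext_ball) (use nlen in simp_all)
  then have "ext k ?F (Suc (Suc n) * lcost 2) {e}"
    by (rule ext_mono) (use r in \<open>simp_all add: numeral_2_eq_2 mult_le_mono1 del: mult_Suc\<close>)
  then have 3: "ext k (?F \<union> s ` {..<r}) (Suc (Suc n) * lcost 2) {e}"
    by (rule ext_mono) simp_all
  let ?F' = "?F \<union> s ` {..<r} \<union> {e}"
  have "loc k ?F' 2 (v p)" if p: "p \<in> {..<r} \<times> {..N}" for p
  proof -
    have "loc k ?F' 1 (s (fst p))" by (rule loc_mem) (use p in auto)
    moreover have "loc k ?F' 1 (len_bit (u (fst p)) (snd p))"
      by (rule loc_mem) (use p len_Bits(1)[of "fst p" "snd p"] in auto)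
    ultimately have "loc k ?F' (1 + 1) (\<lambda>x. s (fst p) x \<and> len_bit (u (fst p)) (snd p) x)"
      by (rule loc_op[where P = "(\<and>)"])
    then show ?thesis by (simp add: v_def[abs_def] numeral_2_eq_2)
  qed
  then have v: "ext k ?F' (Suc n * Suc N * lcost 2) (v ` ({..<r} \<times> {..N}))"
  proof (intro ext_locs)
    have "card (v ` ({..<r} \<times> {..N})) \<le> card ({..<r} \<times> {..N})" by (rule card_image_le) simp
    also have "\<dots> \<le> Suc n * Suc N" using mult_le_mono1[OF r, of "Suc N"] by (simp only: card_cartesian_product card_lessThan card_atMost)
    finally show "card (v ` ({..<r} \<times> {..N})) \<le> Suc n * Suc N" .
  qed auto
  have c: "ext k ?F' (2 * lcost 1) (range c)"
  proof (rule ext_locs)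
    show "card (range c) \<le> 2" using card_image_le[of "UNIV :: bool set" c] by simp
    show "loc k ?F' 1 f" if f: "f \<in> range c" for f
    proof -
      from f obtain b where "f = c b" by (rule rangeE)
      then have "f = (\<lambda>_. b)" by (simp add: c_def fun_eq_iff)
      then show ?thesis by (simp only: loc_const)
    qed
  qed simp
  define hs' where "hs' = concat (map (\<lambda>j. concat (map (\<lambda>i. [v (j, i), val_bit (u j) i]) [0..<Suc N])) [0..<r]) @
      concat (map (\<lambda>b. [e, c b]) w)"
  let ?c = "Suc n * gcost + (Suc n * (Suc (Suc n) * lcost 2) + (Suc (Suc n) * lcost 2 +
     (Suc n * Suc N * lcost 2 + 2 * lcost 1)))"
  \<comment> \<open>\<open>ext_chain\<close> keeps the wires of earlier layers, since the output
    list also reads the value bits of the first one.\<close>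
  have chain: "ext k (inputs k) ?c (Bits \<union> (s ` {..<r} \<union> ({e} \<union> (v ` ({..<r} \<times> {..N}) \<union> range c))))"
    by (rule ext_chain[OF 1 ext_chain[OF 2 ext_chain[OF 3 ext_Un[OF v c]]]])
  have sub: "set hs' \<subseteq> Bits \<union> (s ` {..<r} \<union> ({e} \<union> (v ` ({..<r} \<times> {..N}) \<union> range c)))"
  proof
    fix f assume "f \<in> set hs'"
    then consider j i where "j < r" "i \<le> N" "f = v (j, i)" | j i where "j < r" "i \<le> N" "f = val_bit (u j) i"
      | "f = e" | b where "f = c b"
      unfolding hs'_def by (auto simp: less_Suc_eq_le simp del: upt_Suc split: if_splits)
    then show "f \<in> Bits \<union> (s ` {..<r} \<union> ({e} \<union> (v ` ({..<r} \<times> {..N}) \<union> range c)))"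
    proof cases
      case 1
      then have "f \<in> v ` ({..<r} \<times> {..N})" by blast
      then show ?thesis by blast
    next
      case 2
      then show ?thesis using len_Bits(2) by blast
    qed blast+
  qed
  from ext_mono[OF chain order_refl order_refl sub] obtain C where C: "csize C \<le> k + ?c + length hs'"
    "\<And>x. length x = k \<Longrightarrow> circ_eval C x = map (\<lambda>h. h x) hs'" by (rule ext_circuit) blast
  have "length hs' = r * (2 * Suc N) + 2 * length w"
    unfolding hs'_def by (simp add: length_concat comp_def sum_list_triv del: upt_Suc)
  also have "\<dots> \<le> Suc n * (2 * Suc N) + 2 * Suc N"
    by (rule add_mono[OF mult_le_mono1[OF r] mult_le_mono2[OF w(3)]])
  finally have "csize C \<le> red_cost"
    unfolding red_cost_def by (rule order_trans[OF C(1) add_left_mono])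
  moreover have "n < length (decode_pairs (circ_eval C x)) \<and> (decode_pairs (circ_eval C x) \<in> A \<longleftrightarrow> x \<in> B)"
    if x: "length x = k" for x
  proof -
    have ev: "map (\<lambda>h. h x) hs' = concat (map (\<lambda>j. concat (map (\<lambda>i. [s j x \<and> i < length (u j x),
          i < length (u j x) \<and> u j x ! i]) [0..<Suc N])) [0..<r]) @ concat (map (\<lambda>b. [e x, b]) w)"
      unfolding hs'_def by (simp add: map_concat comp_def v_def len_bit_def val_bit_def c_def del: upt_Suc)
    have dec: "decode_pairs (circ_eval C x) =
        concat (map (\<lambda>j. if s j x then u j x else []) [0..<r]) @ (if e x then w else [])"
      unfolding C(2)[OF x] ev by (rule decode_pairs_selected) (simp add: u_def length_G)
    show ?thesis
    proof (cases "e x")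
      case True
      have "\<not> s j x" if "j < r" for j
        using True that unfolding e_def s_def by auto
      then have "decode_pairs (circ_eval C x) = w" unfolding dec using True by simp
      moreover have "x \<in> B"
      proof (rule ccontr)
        assume "x \<notin> B"
        then obtain ys where "ys \<in> set Ys" "n < length (G (True # x @ concat ys))" using long x by blast
        then obtain j where "j < r" "n < length (u j x)" by (auto simp: in_set_conv_nth r_def u_def)
        then show False using True unfolding e_def len_bit_def by blast
      qed
      ultimately show ?thesis using w by simp
    next
      case False
      then have "\<exists>j. j < r \<and> n < length (u j x)" by (auto simp: e_def len_bit_def)
      define j0 where "j0 = (LEAST j. j < r \<and> n < length (u j x))"
      have j0: "j0 < r" "n < length (u j0 x)"
        using LeastI_ex[OF \<open>\<exists>j. j < r \<and> n < length (u j x)\<close>] unfolding j0_def by blast+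
      have min: "\<not> n < length (u i x)" if "i < j0" for i
        using not_less_Least[OF that[unfolded j0_def]] that j0(1) by simp
      have "s j x \<longleftrightarrow> j = j0" if "j < r" for j
      proof
        assume sj: "s j x"
        have "j0 \<le> j"
        proof (rule ccontr)
          assume "\<not> ?thesis"
          then have "\<not> len_bit (u j) n x" using min by (simp add: len_bit_def)
          moreover have "len_bit (u j) n x" using bspec[OF sj[unfolded s_def], of j] by simp
          ultimately show False by blast
        qed
        moreover have "\<not> j0 < j"
        proof
          assume "j0 < j"
          then have "\<not> len_bit (u j0) n x" using bspec[OF sj[unfolded s_def], of j0] by simp
          then show False using j0(2) by (simp add: len_bit_def)
        qed
        ultimately show "j = j0" by linarith
      next
        assume "j = j0"
        then show "s j x" unfolding s_def using j0(2) min by (auto simp: len_bit_def)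
      qed
      then have "concat (map (\<lambda>j. if s j x then u j x else []) [0..<r]) =
          concat (map (\<lambda>j. if j = j0 then u j0 x else []) [0..<r])"
        by (intro arg_cong[of _ _ concat] map_cong) auto
      then have "decode_pairs (circ_eval C x) = u j0 x"
        unfolding dec using False concat_single[OF j0(1)] by simp
      moreover have "Ys ! j0 \<in> set Ys" using j0(1) by (simp add: r_def)
      then have "u j0 x \<in> A \<longleftrightarrow> x \<in> B"
        unfolding u_def using G_in_A[OF x Ys(2), of "Ys ! j0" True] Ys(3)[of "Ys ! j0"] by blast
      ultimately show ?thesis using j0(2) by simp
    qed
  qed
  ultimately show ?thesis by blast
qed

definition test_cost where
  "test_cost = (n + (n + 2) * n) + ((n + 2) * (Suc n * lcost 3) + (Suc (n + 2) * lcost 2 + lcost 1) +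
     (Suc n * (gcost + (n + 3) * lcost 3) + (Suc (Suc n) * lcost 2 + lcost 1)) + lcost 2) + 1"

text \<open>The witness is the tuple itself. The circuit looks for the input among its blocks and
  compares the value of \<open>G\<close> with the recorded ones; a recorded pair vouches for the
  whole tuple.\<close>

lemma test_circuit:
  assumes cs: "length cs \<le> Suc n"
      "\<And>X v. (X, v) \<in> set cs \<Longrightarrow> length X = Suc k \<and> v \<in> insert None (Some ` short n)"
    and sound: "\<And>X v ys y. (X, v) \<in> set cs \<Longrightarrow> length ys = n + 2 \<Longrightarrow> \<forall>y\<in>set ys. length y = n \<Longrightarrow>
      trunc n (G (X @ concat ys)) = v \<Longrightarrow> y \<in> set ys \<Longrightarrow> y \<notin> K"
    and complete: "\<And>y. length y = n \<Longrightarrow> y \<notin> K \<Longrightarrow> \<exists>(X, v)\<in>set cs. \<exists>ys. length ys = n + 2 \<and>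
      (\<forall>y\<in>set ys. length y = n) \<and> y \<in> set ys \<and> trunc n (G (X @ concat ys)) = v"
  shows "\<exists>C. csize C \<le> test_cost \<and> (\<forall>y. length y = n \<longrightarrow>
    (y \<notin> K \<longleftrightarrow> (\<exists>w. length w = (n + 2) * n \<and> circ_accepts C (y @ w))))"
proof -
  let ?l = "(n + 2) * n"
  let ?m = "n + ?l"
  define eq where "eq i u \<longleftrightarrow> (\<forall>j\<in>{..<n}. u ! j = u ! (n + (i * n + j)))" for i and u :: "bool list"
  define mem where "mem u \<longleftrightarrow> (\<exists>i\<in>{..<n + 2}. eq i u)" for u
  define tst where "tst c u \<longleftrightarrow> trunc n (G (fst c @ sub u n ?l)) = snd c" for c u
  define hit where "hit u \<longleftrightarrow> (\<exists>c\<in>set cs. tst c u)" for u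
  define acc where "acc u \<longleftrightarrow> mem u \<and> hit u" for u
  have off: "i * n + n \<le> ?l" if "i < n + 2" for i
    using mult_le_mono1[of "Suc i" "n + 2" n] that by simp
  have "ext ?m (inputs ?m) (Suc n * lcost 3) {eq i}" if i: "i < n + 2" for i
  proof -
    have "loc ?m (inputs ?m) (1 + 1) (\<lambda>u. u ! j = u ! (n + (i * n + j)))" if "j \<in> {..<n}" for j
      by (rule loc_op[where P = "(=)"]; rule loc_input) (use that off[OF i] in simp_all)
    from ext_ball[OF finite_lessThan this]
    have "ext ?m (inputs ?m) (Suc (card {..<n}) * lcost (Suc (1 + 1))) {eq i}" by (simp only: eq_def[abs_def])
    then show ?thesis by (simp add: numeral_3_eq_3)
  qed
  then have "ext ?m (inputs ?m) (card {..<n + 2} * (Suc n * lcost 3)) (\<Union>i\<in>{..<n + 2}. {eq i})"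
    by (intro ext_UN) simp_all
  then have eqs: "ext ?m (inputs ?m) ((n + 2) * (Suc n * lcost 3)) (eq ` {..<n + 2})"
    by (rule ext_mono) auto
  have "ext ?m (inputs ?m \<union> eq ` {..<n + 2}) (Suc (card {..<n + 2}) * lcost (Suc 1) + lcost 1) {mem}"
    unfolding mem_def[abs_def] by (rule ext_bex, simp, rule loc_mem, blast)
  then have "ext ?m (inputs ?m \<union> eq ` {..<n + 2}) (Suc (n + 2) * lcost 2 + lcost 1) {mem}"
    unfolding card_lessThan one_add_one[symmetric] Suc_eq_plus1 .
  from ext_trans[OF eqs this]
  have mem: "ext ?m (inputs ?m) ((n + 2) * (Suc n * lcost 3) + (Suc (n + 2) * lcost 2 + lcost 1)) {mem}" .
  have tst: "ext ?m (inputs ?m) (gcost + (n + 3) * lcost 3) {tst c}" if c: "c \<in> set cs" for c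
  proof -
    obtain X v where Xv: "c = (X, v)" by (cases c)
    have X: "length X = Suc k" and v: "v \<in> insert None (Some ` short n)" using cs(2)[of X v] c Xv by auto
    let ?G = "\<lambda>u. G (X @ sub u n ?l)"
    have bits: "ext ?m (inputs ?m) gcost (out_bits N ?G)"
    proof (rule ext_G)
      fix u :: "bool list" assume "length u = ?m"
      then show "length (X @ sub u n ?l) = len" using X by (simp add: length_sub)
    next
      fix i assume i: "i < len"
      show "loc ?m (inputs ?m) 1 (\<lambda>u. (X @ sub u n ?l) ! i)"
      proof (cases "i < Suc k")
        case True
        then have "(\<lambda>u. (X @ sub u n ?l) ! i) = (\<lambda>u. X ! i)" using X by (simp add: nth_append)
        then show ?thesis by (simp only: loc_const)
      next
        case False
        then have "(\<lambda>u. (X @ sub u n ?l) ! i) = (\<lambda>u. sub u n ?l ! (i - Suc k))"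
          using X by (simp add: nth_append)
        moreover have "loc ?m (inputs ?m) 1 (\<lambda>u. sub u n ?l ! (i - Suc k))"
          by (rule loc_sub) (use i False in simp_all)
        ultimately show ?thesis by simp
      qed
    qed
    let ?F = "inputs ?m \<union> out_bits N ?G"
    have lb: "loc ?m ?F 1 (len_bit ?G i)" "loc ?m ?F 1 (val_bit ?G i)" if "i \<le> n" for i
      by (rule loc_mem, use that N(2) in \<open>simp add: out_bits_def\<close>)+
    show ?thesis
    proof (cases v)
      case None
      have "tst c = (\<lambda>u. len_bit ?G n u)"
        by (auto simp: fun_eq_iff tst_def Xv None trunc_def len_bit_def)
      then have "ext ?m ?F (lcost 1) {tst c}" using ext_loc[OF lb(1)[OF order_refl]] by simp
      from ext_trans[OF bits this] show ?thesis
      proof (rule ext_mono)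
        have "lcost 1 \<le> lcost 3" by (rule lcost_mono) simp
        also have "lcost 3 \<le> (n + 3) * lcost 3" by simp
        finally show "gcost + lcost 1 \<le> gcost + (n + 3) * lcost 3" by simp
      qed simp_all
    next
      case (Some w)
      then have w: "length w \<le> n" using v by (auto simp: short_def)
      let ?f = "\<lambda>i u. if i = length w then \<not> len_bit ?G i u else len_bit ?G i u \<and> val_bit ?G i u = w ! i"
      have "loc ?m ?F 2 (?f i)" if "i \<in> {..length w}" for i
      proof (cases "i = length w")
        case True
        have "loc ?m ?F 1 (\<lambda>u. \<not> len_bit ?G i u)"
          by (rule loc_comp[where P = Not], rule lb(1)) (use True w in simp)
        then have "loc ?m ?F 2 (\<lambda>u. \<not> len_bit ?G i u)" by (rule loc_mono) simp_all
        then show ?thesis using True by simp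
      next
        case False
        have "loc ?m ?F (1 + 1) (\<lambda>u. len_bit ?G i u \<and> val_bit ?G i u = w ! i)"
          by (rule loc_op[where P = "\<lambda>p q. p \<and> q = w ! i"]; rule lb) (use that w in simp_all)
        then show ?thesis using False by (simp add: numeral_2_eq_2)
      qed
      from ext_ball[OF finite_atMost this]
      have "ext ?m ?F (Suc (card {..length w}) * lcost (Suc 2)) {\<lambda>u. \<forall>i\<in>{..length w}. ?f i u}" .
      moreover have "(\<lambda>u. \<forall>i\<in>{..length w}. ?f i u) = tst c"
        unfolding fun_eq_iff tst_def Xv Some fst_conv snd_conv trunc_Some_iff[OF w] len_bit_def val_bit_def by simp
      ultimately have "ext ?m ?F (Suc (card {..length w}) * lcost (Suc 2)) {tst c}" by (simp only:)
      then have "ext ?m ?F ((n + 3) * lcost 3) {tst c}"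
        by (rule ext_mono) (use w in \<open>simp_all add: mult_le_mono1 numeral_3_eq_3 numeral_2_eq_2 del: mult_Suc\<close>)
      from ext_trans[OF bits this] show ?thesis .
    qed
  qed
  have card: "card (set cs) \<le> Suc n" using card_length[of cs] cs(1) by linarith
  have "ext ?m (inputs ?m) (card (set cs) * (gcost + (n + 3) * lcost 3)) (\<Union>c\<in>set cs. {tst c})"
    by (intro ext_UN tst) simp_all
  then have tsts: "ext ?m (inputs ?m) (Suc n * (gcost + (n + 3) * lcost 3)) (tst ` set cs)"
    by (rule ext_mono) (use mult_le_mono1[OF card] in \<open>auto simp del: mult_Suc\<close>)
  have "ext ?m (inputs ?m \<union> tst ` set cs) (Suc (card (set cs)) * lcost (Suc 1) + lcost 1) {hit}"
    unfolding hit_def[abs_def] by (rule ext_bex, simp, rule loc_mem, blast)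
  then have "ext ?m (inputs ?m \<union> tst ` set cs) (Suc (Suc n) * lcost 2 + lcost 1) {hit}"
    by (rule ext_mono) (use card in \<open>simp_all add: numeral_2_eq_2 mult_le_mono1 del: mult_Suc\<close>)
  from ext_trans[OF tsts this]
  have hit: "ext ?m (inputs ?m) (Suc n * (gcost + (n + 3) * lcost 3) + (Suc (Suc n) * lcost 2 + lcost 1)) {hit}" .
  let ?F = "inputs ?m \<union> ({mem} \<union> {hit})"
  have "loc ?m ?F (1 + 1) (\<lambda>u. mem u \<and> hit u)"
    by (rule loc_op[where P = "(\<and>)"]; rule loc_mem) simp_all
  then have "ext ?m ?F (lcost (1 + 1)) {\<lambda>u. mem u \<and> hit u}" by (rule ext_loc)
  then have "ext ?m ?F (lcost 2) (set [acc])" by (simp add: acc_def[abs_def] numeral_2_eq_2)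
  from ext_circuit[OF ext_trans[OF ext_Un[OF mem hit] this]]
  obtain C where C: "csize C \<le> test_cost" "\<And>u. length u = ?m \<Longrightarrow> circ_eval C u = [acc u]"
    unfolding test_cost_def by auto
  have "y \<notin> K \<longleftrightarrow> (\<exists>w. length w = ?l \<and> circ_accepts C (y @ w))" if y: "length y = n" for y
  proof
    assume "y \<notin> K"
    then obtain X v ys where ys: "(X, v) \<in> set cs" "length ys = n + 2" "\<forall>y\<in>set ys. length y = n"
      "y \<in> set ys" "trunc n (G (X @ concat ys)) = v" using complete[OF y] by blast
    have cl: "length (concat ys) = ?l" using length_concat_uniform[of ys n] ys(2,3) by simp
    obtain i where i: "i < n + 2" "ys ! i = y" using ys(2,4) by (metis in_set_conv_nth)
    have "sub (concat ys) (i * n) n = y"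
      using sub_concat[of ys n i "i * n" "[]" "[]"] ys(2,3) i by simp
    then have "concat ys ! (i * n + j) = y ! j" if "j < n" for j
      using nth_sub[of "i * n" n "concat ys" j] off[OF i(1)] that cl by simp
    then have "eq i (y @ concat ys)" using y by (simp add: eq_def nth_append)
    then have "mem (y @ concat ys)" using i(1) unfolding mem_def by blast
    moreover have "sub (y @ concat ys) n ?l = concat ys" using y cl by (simp add: sub_def)
    then have "tst (X, v) (y @ concat ys)" using ys(5) by (simp add: tst_def)
    then have "hit (y @ concat ys)" using ys(1) unfolding hit_def by blast
    ultimately have "acc (y @ concat ys)" by (simp add: acc_def)
    then have "circ_accepts C (y @ concat ys)" using C(2)[of "y @ concat ys"] y cl by (simp add: circ_accepts_def)
    then show "\<exists>w. length w = ?l \<and> circ_accepts C (y @ w)" using cl by blast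
  next
    assume "\<exists>w. length w = ?l \<and> circ_accepts C (y @ w)"
    then obtain w where w: "length w = ?l" "circ_accepts C (y @ w)" by blast
    then have "acc (y @ w)" using C(2)[of "y @ w"] y by (simp add: circ_accepts_def)
    then obtain i c where i: "i < n + 2" "eq i (y @ w)" and c: "c \<in> set cs" "tst c (y @ w)"
      unfolding acc_def mem_def hit_def by blast
    obtain X v where Xv: "c = (X, v)" by (cases c)
    define ys where "ys = map (\<lambda>i. sub w (i * n) n) [0..<n + 2]"
    have cw: "concat ys = w" unfolding ys_def by (rule concat_sub[OF w(1)])
    have ys: "length ys = n + 2" "\<forall>y\<in>set ys. length y = n"
      using off w(1) by (auto simp: ys_def length_sub simp del: upt_Suc)
    have "sub (y @ w) n ?l = w" using y w(1) by (simp add: sub_def)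
    then have "trunc n (G (X @ concat ys)) = v" using c(2) by (simp add: tst_def Xv cw)
    moreover have "ys ! i = y"
    proof (rule nth_equalityI)
      show len: "length (ys ! i) = length y" using ys i(1) y by simp
      fix j assume "j < length (ys ! i)"
      then have j: "j < n" using len y by simp
      have "ys ! i = sub w (i * n) n" using i(1) by (simp add: ys_def del: upt_Suc)
      then have "ys ! i ! j = w ! (i * n + j)" using nth_sub[of "i * n" n w j] off[OF i(1)] w(1) j by simp
      also have "\<dots> = y ! j" using i(2) j y unfolding eq_def by (simp add: nth_append)
      finally show "ys ! i ! j = y ! j" .
    qed
    then have "y \<in> set ys" using i(1) ys(1) by (metis nth_mem)
    ultimately show "y \<notin> K" using sound[of X v ys y] c(1) Xv ys by blast
  qed
  with C(1) show ?thesis by blast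
qed

text \<open>A pair attained by some tuple that avoids \<open>K\<close> vouches for all its tuples: a
  short value lies outside \<open>A\<close> because one of its tuples avoids \<open>K\<close>, and
  long values lie outside \<open>A\<close> by \<open>none\<close>.\<close>

lemma test_from_cover:
  assumes cs: "length cs \<le> Suc n"
      "\<And>X v. (X, v) \<in> set cs \<Longrightarrow> \<exists>e x. X = e # x \<and> length x = k \<and> \<not> (e \<and> x \<in> B)"
      "\<And>X v. (X, v) \<in> set cs \<Longrightarrow> v \<in> insert None (Some ` short n)"
    and none: "\<And>X w. (X, None) \<in> set cs \<Longrightarrow> w \<in> A \<Longrightarrow> n < length w \<Longrightarrow> length w \<le> Suc N \<Longrightarrow> False"
    and cover: "\<And>y. length y = n \<Longrightarrow> y \<notin> K \<Longrightarrow> \<exists>(X, v)\<in>set cs. \<exists>ys\<in>tuples (n + 2) {y. length y = n \<and> y \<notin> K}.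
      y \<in> set ys \<and> trunc n (G (X @ concat ys)) = v"
  shows "\<exists>C. csize C \<le> test_cost \<and> (\<forall>y. length y = n \<longrightarrow>
    (y \<notin> K \<longleftrightarrow> (\<exists>w. length w = (n + 2) * n \<and> circ_accepts C (y @ w))))"
proof -
  define sound where "sound X v \<longleftrightarrow> (\<forall>ys. length ys = n + 2 \<longrightarrow> (\<forall>y\<in>set ys. length y = n) \<longrightarrow>
      trunc n (G (X @ concat ys)) = v \<longrightarrow> (\<forall>y\<in>set ys. y \<notin> K))" for X v
  have sound: "sound X v"
    if Xv: "(X, v) \<in> set cs" and ys0: "ys0 \<in> tuples (n + 2) {y. length y = n \<and> y \<notin> K}"
      and v: "trunc n (G (X @ concat ys0)) = v" for X v ys0
    unfolding sound_def
  proof (intro allI impI)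
    fix ys assume ys: "length ys = n + 2" "\<forall>y\<in>set ys. length y = n" "trunc n (G (X @ concat ys)) = v"
    obtain e x where x: "X = e # x" "length x = k" "\<not> (e \<and> x \<in> B)" using cs(2)[OF Xv] by blast
    have iff: "G (X @ concat zs) \<in> A \<longleftrightarrow> (\<exists>y\<in>set zs. y \<in> K)"
      if "length zs = n + 2" "\<forall>y\<in>set zs. length y = n" for zs
      using G_in_A[OF x(2) that, of e] x(3) unfolding x(1) append_Cons by simp
    have "length ys0 = n + 2" "\<forall>y\<in>set ys0. length y = n" "\<forall>y\<in>set ys0. y \<notin> K"
      using ys0 by (auto simp: tuples_def)
    then have ys0': "G (X @ concat ys0) \<notin> A" using iff by simp
    have "G (X @ concat ys) \<notin> A"
    proof (cases v)
      case None
      then have "n < length (G (X @ concat ys))" using ys(3) by (simp add: trunc_def split: if_splits)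
      then show ?thesis using none[OF Xv[unfolded None]] length_G by blast
    next
      case (Some u)
      then have "G (X @ concat ys) = u" "G (X @ concat ys0) = u"
        using ys(3) v by (simp_all add: trunc_def split: if_splits)
      then show ?thesis using ys0' by simp
    qed
    then show "\<forall>y\<in>set ys. y \<notin> K" using iff[OF ys(1,2)] by blast
  qed
  \<comment> \<open>A pair that no tuple avoiding \<open>K\<close> attains may be unsound, so it is
    dropped. No string loses its cover, because covering pairs are attained.\<close>
  define cs' where "cs' = filter (\<lambda>(X, v). sound X v) cs"
  show ?thesis
  proof (rule test_circuit)
    show "length cs' \<le> Suc n" using cs(1) by (simp add: cs'_def le_trans[OF length_filter_le])
    show "length X = Suc k \<and> v \<in> insert None (Some ` short n)" if "(X, v) \<in> set cs'" for X v
    proof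
      have Xv: "(X, v) \<in> set cs" using that by (simp add: cs'_def)
      show "length X = Suc k" using cs(2)[OF Xv] by auto
      show "v \<in> insert None (Some ` short n)" by (rule cs(3)[OF Xv])
    qed
  next
    fix X v ys y
    assume "(X, v) \<in> set cs'" "length ys = n + 2" "\<forall>y\<in>set ys. length y = n"
      "trunc n (G (X @ concat ys)) = v" "y \<in> set ys"
    moreover from this(1) have "sound X v" by (simp add: cs'_def)
    ultimately show "y \<notin> K" unfolding sound_def by blast
  next
    fix y assume "length y = n" "y \<notin> K"
    then obtain X v ys where ys: "(X, v) \<in> set cs" "ys \<in> tuples (n + 2) {y. length y = n \<and> y \<notin> K}"
      "y \<in> set ys" "trunc n (G (X @ concat ys)) = v" using cover by blast
    have "(X, v) \<in> set cs'" using sound[OF ys(1,2,4)] ys(1) by (simp add: cs'_def)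
    moreover have "length ys = n + 2" "\<forall>y\<in>set ys. length y = n" using ys(2) by (auto simp: tuples_def)
    ultimately show "\<exists>(X, v)\<in>set cs'. \<exists>ys. length ys = n + 2 \<and> (\<forall>y\<in>set ys. length y = n) \<and>
        y \<in> set ys \<and> trunc n (G (X @ concat ys)) = v" using ys(3,4) by blast
  qed
qed

lemma reduction_or_test:
  "(\<exists>C. csize C \<le> red_cost \<and> (\<forall>x. length x = k \<longrightarrow>
      n < length (decode_pairs (circ_eval C x)) \<and> (decode_pairs (circ_eval C x) \<in> A \<longleftrightarrow> x \<in> B))) \<or>
   (\<exists>C. csize C \<le> test_cost \<and> (\<forall>y. length y = n \<longrightarrow>
      (y \<notin> K \<longleftrightarrow> (\<exists>w. length w = (n + 2) * n \<and> circ_accepts C (y @ w)))))"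
proof -
  define S0 where "S0 = {y. length y = n \<and> y \<notin> K}"
  have "card S0 \<le> 2 ^ n" unfolding S0_def by (rule card_fixed_length)
  also have "(2::nat) ^ n < 2 ^ Suc n" by simp
  finally have S0: "finite S0" "card S0 < 2 ^ Suc n" unfolding S0_def by (simp_all add: finite_fixed_length)
  \<comment> \<open>The fallback is hard-wired, so its length must be bounded. \<open>Suc N\<close>
    also bounds the outputs by \<open>length_G\<close>; hence in the second case no long output lies
    in \<open>A\<close>.\<close>
  show ?thesis
  proof (cases "\<exists>w\<in>A. n < length w \<and> length w \<le> Suc N")
    case True
    then obtain w where w: "w \<in> A" "n < length w" "length w \<le> Suc N" by blast
    define X0 where "X0 = (\<lambda>x. True # x) ` {x. length x = k \<and> x \<notin> B}"
    have X0: "finite X0" unfolding X0_def by (rule finite_imageI[OF finite_fixed_length])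
    have "card X0 \<le> card {x. length x = k \<and> x \<notin> B}"
      unfolding X0_def by (rule card_image_le[OF finite_fixed_length])
    also have "\<dots> \<le> 2 ^ k" by (rule card_fixed_length)
    also have "(2::nat) ^ k \<le> 2 ^ n" using kn by (intro power_increasing) simp_all
    also have "(2::nat) ^ n < 2 ^ Suc n" by simp
    finally have cX0: "card X0 < 2 ^ Suc n" .
    show ?thesis
    proof (rule long_or_covered[OF S0 X0 cX0, where G = "\<lambda>X ys. G (X @ concat ys)"])
      fix Ys assume Ys: "length Ys \<le> Suc n" "set Ys \<subseteq> tuples (n + 2) S0"
        and long: "\<And>X. X \<in> X0 \<Longrightarrow> \<exists>ys\<in>set Ys. n < length (G (X @ concat ys))"
      show ?thesis
      proof (rule disjI1, rule reduction_circuit[OF Ys(1) _ _ _ w])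
        show "length ys = n + 2" if "ys \<in> set Ys" for ys
          using subsetD[OF Ys(2) that] by (simp add: tuples_def)
        show "length y = n \<and> y \<notin> K" if "ys \<in> set Ys" "y \<in> set ys" for ys y
          using subsetD[OF Ys(2) that(1)] that(2) by (auto simp: tuples_def S0_def)
        show "\<exists>ys\<in>set Ys. n < length (G (True # x @ concat ys))" if "length x = k" "x \<notin> B" for x
          using long[of "True # x"] that by (simp add: X0_def)
      qed
    next
      fix cs assume cs: "length cs \<le> Suc n" "set cs \<subseteq> X0 \<times> short n"
        and cover: "\<And>y. y \<in> S0 \<Longrightarrow> \<exists>(X, u)\<in>set cs. \<exists>ys\<in>tuples (n + 2) S0. y \<in> set ys \<and> G (X @ concat ys) = u"
      define cs' where "cs' = map (\<lambda>(X, u). (X, Some u)) cs"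
      have cs': "\<exists>x u. X = True # x \<and> length x = k \<and> x \<notin> B \<and> v = Some u \<and> u \<in> short n"
        if "(X, v) \<in> set cs'" for X v
        using that cs(2) by (auto simp: cs'_def X0_def)
      show ?thesis
      proof (rule disjI2, rule test_from_cover)
        show "length cs' \<le> Suc n" using cs(1) by (simp add: cs'_def)
        show "\<exists>e x. X = e # x \<and> length x = k \<and> \<not> (e \<and> x \<in> B)" if "(X, v) \<in> set cs'" for X v
          using cs'[OF that] by blast
        show "v \<in> insert None (Some ` short n)" if "(X, v) \<in> set cs'" for X v
          using cs'[OF that] by blast
        show False if "(X, None) \<in> set cs'" for X
          using cs'[OF that] by blast
      next
        fix y assume "length y = n" "y \<notin> K"
        then have "y \<in> S0" by (simp add: S0_def)
        then obtain X u ys where c: "(X, u) \<in> set cs" "ys \<in> tuples (n + 2) S0" "y \<in> set ys" "G (X @ concat ys) = u"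
          using cover by blast
        have "(X, Some u) \<in> set cs'" using c(1) by (force simp: cs'_def)
        moreover have "u \<in> short n" using cs(2) c(1) by blast
        then have "trunc n (G (X @ concat ys)) = Some u" using c(4) by (simp add: trunc_def short_def)
        ultimately show "\<exists>(X, v)\<in>set cs'. \<exists>ys\<in>tuples (n + 2) {y. length y = n \<and> y \<notin> K}.
            y \<in> set ys \<and> trunc n (G (X @ concat ys)) = v"
          using c(2,3) unfolding S0_def by blast
      qed
    qed
  next
    case False
    \<comment> \<open>With the switch off the formula speaks of \<open>ys\<close> alone, so any
      \<open>x\<close> will do, even if all strings of length \<open>k\<close> are in
      \<open>B\<close>.\<close>
    define X where "X = False # replicate k False"
    let ?V = "insert None (Some ` short n)"
    let ?cov = "\<lambda>v y. \<exists>ys\<in>tuples (n + 2) S0. y \<in> set ys \<and> trunc n (G (X @ concat ys)) = v"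
    have "\<exists>v\<in>?V. card S \<le> 2 * card {y \<in> S. ?cov v y}" if S: "S \<subseteq> S0" for S
    proof -
      have fin: "finite S" using S S0(1) by (rule finite_subset)
      obtain v where v: "v \<in> ?V"
        "card S \<le> 2 * card {y \<in> S. \<exists>ys\<in>tuples (n + 2) S. y \<in> set ys \<and> trunc n (G (X @ concat ys)) = v}"
        using popular_trunc[OF fin, of n "\<lambda>ys. G (X @ concat ys)"] by (rule bexE)
      have "card {y \<in> S. \<exists>ys\<in>tuples (n + 2) S. y \<in> set ys \<and> trunc n (G (X @ concat ys)) = v}
          \<le> card {y \<in> S. ?cov v y}"
        using fin tuples_mono[OF S, of "n + 2"] by (intro card_mono) auto
      then have "card S \<le> 2 * card {y \<in> S. ?cov v y}" using v(2) by linarith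
      then show ?thesis using v(1) by (rule bexI)
    qed
    from halving_cover[OF S0, of ?V ?cov, OF this] obtain vs where
      vs: "length vs \<le> Suc n" "set vs \<subseteq> ?V" "\<forall>y\<in>S0. \<exists>v\<in>set vs. ?cov v y" by blast
    define cs where "cs = map (Pair X) vs"
    show ?thesis
    proof (rule disjI2, rule test_from_cover)
      show "length cs \<le> Suc n" using vs(1) by (simp add: cs_def)
      show "\<exists>e x. Y = e # x \<and> length x = k \<and> \<not> (e \<and> x \<in> B)" if "(Y, v) \<in> set cs" for Y v
        using that by (intro exI[of _ False] exI[of _ "replicate k False"]) (auto simp: cs_def X_def)
      show "v \<in> ?V" if "(Y, v) \<in> set cs" for Y v
        using that vs(2) by (auto simp: cs_def)
      show False if "w \<in> A" "n < length w" "length w \<le> Suc N" for w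
        using False that by blast
    next
      fix y assume "length y = n" "y \<notin> K"
      then have "y \<in> S0" by (simp add: S0_def)
      then obtain v ys where c: "v \<in> set vs" "ys \<in> tuples (n + 2) S0" "y \<in> set ys"
        "trunc n (G (X @ concat ys)) = v" using vs(3) by blast
      have "(X, v) \<in> set cs" using c(1) by (simp add: cs_def)
      then show "\<exists>(X, v)\<in>set cs. \<exists>ys\<in>tuples (n + 2) {y. length y = n \<and> y \<notin> K}.
          y \<in> set ys \<and> trunc n (G (X @ concat ys)) = v"
        using c(2-4) unfolding S0_def by blast
    qed
  qed
qed

end

section \<open>The main theorem\<close>

lemma out_cost_mono: "T \<le> T' \<Longrightarrow> out_cost M N T \<le> out_cost M N T'"
  unfolding out_cost_def by (intro add_mono run_cost_mono order_refl)

definition lengthening :: "lang \<Rightarrow> lang \<Rightarrow> nat \<Rightarrow> nat \<Rightarrow> circuit \<Rightarrow> bool" where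
  "lengthening A B n k C \<longleftrightarrow> (\<forall>x. length x = k \<longrightarrow>
     n < length (decode_pairs (circ_eval C x)) \<and> (decode_pairs (circ_eval C x) \<in> A \<longleftrightarrow> x \<in> B))"

definition refuting :: "lang \<Rightarrow> nat \<Rightarrow> circuit \<Rightarrow> bool" where
  "refuting K n C \<longleftrightarrow> (\<forall>y. length y = n \<longrightarrow>
     (y \<notin> K \<longleftrightarrow> (\<exists>w. length w = (n + 2) * n \<and> circ_accepts C (y @ w))))"

text \<open>The bounds mention neither \<open>k\<close> nor \<open>hs\<close>: they are the costs of
  the locale with \<open>k\<close> replaced by \<open>n\<close> and \<open>gcost\<close> by its
  bound \<open>c n\<close>.\<close>

lemma lengthening_or_refuting:
  assumes A: "NP_complete A" and B: "in_NP B" and K: "in_NP K"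
  obtains R S where "poly_bounded R" "poly_bounded S"
    "\<And>n k. k \<le> n \<Longrightarrow> (\<exists>C. csize C \<le> R n \<and> lengthening A B n k C) \<or> (\<exists>C. csize C \<le> S n \<and> refuting K n C)"
proof -
  obtain g where g: "FP g" "\<And>x. x \<in> CNF \<longleftrightarrow> g x \<in> A"
    using A CNF_in_NP unfolding NP_complete_def by blast
  obtain M and T :: "nat poly" where M: "wf_tm M"
    "\<And>x. tm_output (run M (poly T (length x)) (enc x)) = g x"
    using g(1) unfolding FP_def by blast
  obtain I where I: "poly_bounded I" "\<And>n k. k \<le> n \<Longrightarrow> \<exists>hs. or_instance B K n k hs \<and> length hs \<le> I n"
    using or_instances[OF B K] by blast
  define N where "N n = I n + poly T (I n) + n" for n
  define c where "c n = out_cost M (N n) (poly T (I n))" for n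
  define R where "R n = n + (Suc n * c n + (Suc n * (Suc (Suc n) * lcost 2) + (Suc (Suc n) * lcost 2 +
     (Suc n * Suc (N n) * lcost 2 + 2 * lcost 1)))) + (Suc n * (2 * Suc (N n)) + 2 * Suc (N n))" for n
  define S where "S n = (n + (n + 2) * n) + ((n + 2) * (Suc n * lcost 3) + (Suc (n + 2) * lcost 2 + lcost 1) +
     (Suc n * (c n + (n + 3) * lcost 3) + (Suc (Suc n) * lcost 2 + lcost 1)) + lcost 2) + 1" for n
  have "poly_bounded R" "poly_bounded S"
    unfolding R_def S_def c_def N_def by (intro poly_bounded_intros poly_bounded_out_cost I(1))+
  moreover have "(\<exists>C. csize C \<le> R n \<and> lengthening A B n k C) \<or> (\<exists>C. csize C \<le> S n \<and> refuting K n C)"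
    if kn: "k \<le> n" for n k
  proof -
    obtain hs where hs: "or_instance B K n k hs" "length hs \<le> I n" using I(2)[OF kn] by blast
    have T: "poly T (length hs) \<le> poly T (I n)" using hs(2) by (rule poly_nat_mono)
    interpret or_reduction A B K n k "N n" hs g M T
    proof
      show "length hs + poly T (length hs) \<le> N n" using hs(2) T by (simp add: N_def)
      show "n \<le> N n" by (simp add: N_def)
    qed (use hs M g(2) kn in simp_all)
    have gc: "gcost \<le> c n" unfolding gcost_def c_def using T by (rule out_cost_mono)
    have red_le: "red_cost \<le> R n" unfolding red_cost_def R_def
      by (intro add_mono mult_le_mono order_refl gc kn)
    have test_le: "test_cost \<le> S n" unfolding test_cost_def S_def
      by (intro add_mono mult_le_mono order_refl gc)
    from reduction_or_test[folded lengthening_def refuting_def] show ?thesis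
    proof (elim disjE exE conjE)
      fix C assume "csize C \<le> red_cost" "lengthening A B n k C"
      then show ?thesis using order_trans[OF _ red_le] by blast
    next
      fix C assume "csize C \<le> test_cost" "refuting K n C"
      then show ?thesis using order_trans[OF _ test_le] by blast
    qed
  qed
  ultimately show ?thesis by (rule that)
qed

theorem theorem3p4:
  assumes "\<exists>L. in_coNP L \<and> \<not> io_NPpoly L"
  shows "\<forall>A. NP_complete A \<longrightarrow>
           (\<forall>B. in_NP B \<longrightarrow>
              (\<exists>f. Ppoly_computable f \<and> (\<forall>x. x \<in> B \<longleftrightarrow> f x \<in> A) \<and>
                   (\<forall>x. length (f x) > length x)))"
proof (intro allI impI)
  fix A B assume A: "NP_complete A" and B: "in_NP B"
  obtain L where L: "in_NP (- L)" "\<not> io_NPpoly L" using assms unfolding in_coNP_def by blast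
  show "\<exists>f. Ppoly_computable f \<and> (\<forall>x. x \<in> B \<longleftrightarrow> f x \<in> A) \<and> (\<forall>x. length (f x) > length x)"
  proof (rule lengthening_or_refuting[OF A B L(1)])
    fix R S assume R: "poly_bounded R" and S: "poly_bounded S"
      and RS: "\<And>n k. k \<le> n \<Longrightarrow> (\<exists>C. csize C \<le> R n \<and> lengthening A B n k C) \<or>
        (\<exists>C. csize C \<le> S n \<and> refuting (- L) n C)"
    define bad where "bad = {n. \<exists>k\<le>n. \<nexists>C. csize C \<le> R n \<and> lengthening A B n k C}"
    \<comment> \<open>Outside \<open>bad\<close> any small circuit will do, since \<open>LD\<close>
      has to agree with \<open>L\<close> only at the lengths in \<open>bad\<close>.\<close>
    define D where "D n = (if n \<in> bad then SOME C. csize C \<le> S n \<and> refuting (- L) n C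
      else \<lparr>gates = [], outs = []\<rparr>)" for n
    have D: "csize (D n) \<le> S n \<and> refuting (- L) n (D n)" if "n \<in> bad" for n
    proof -
      have "\<exists>C. csize C \<le> S n \<and> refuting (- L) n C" using that RS unfolding bad_def by blast
      from someI_ex[OF this] show ?thesis using that by (simp add: D_def)
    qed
    have size: "csize (D n) \<le> S n" for n
      by (cases "n \<in> bad") (use D in \<open>simp_all add: D_def csize_def\<close>)
    define LD where "LD = {y. \<exists>w. length w = (length y + 2) * length y \<and> circ_accepts (D (length y)) (y @ w)}"
    have "in_NPpoly LD"
      unfolding in_NPpoly_def
    proof (intro exI conjI allI)
      obtain P :: "nat poly" where P: "\<And>n. S n \<le> poly P n" using S unfolding poly_bounded_def by blast
      have "csize (D n) \<le> poly P n" for n by (rule order_trans[OF size P])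
      then show "poly_size D" unfolding poly_size_def by blast
      show "y \<in> LD \<longleftrightarrow> (\<exists>w. length w = poly [:0, 2, 1:] (length y) \<and> circ_accepts (D (length y)) (y @ w))" for y
      proof -
        have "poly [:0, 2, 1:] (length y) = (length y + 2) * length y" by (simp add: algebra_simps)
        then show ?thesis by (simp only: LD_def mem_Collect_eq)
      qed
    qed
    then have "\<not> io_eq L LD" using L(2) unfolding io_NPpoly_def by blast
    then have "finite {n. \<forall>x. length x = n \<longrightarrow> (x \<in> L \<longleftrightarrow> x \<in> LD)}" unfolding io_eq_def by blast
    \<comment> \<open>If \<open>bad\<close> were infinite, \<open>LD\<close> would witness
      \<open>io_NPpoly L\<close>.\<close>
    moreover have "bad \<subseteq> {n. \<forall>x. length x = n \<longrightarrow> (x \<in> L \<longleftrightarrow> x \<in> LD)}"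
    proof
      fix n assume "n \<in> bad"
      then have "refuting (- L) n (D n)" using D by blast
      then show "n \<in> {n. \<forall>x. length x = n \<longrightarrow> (x \<in> L \<longleftrightarrow> x \<in> LD)}"
        unfolding refuting_def LD_def by simp
    qed
    ultimately have "finite bad" by (rule finite_subset[rotated])
    then have "\<exists>m. \<forall>n\<in>bad. n < m" by (simp only: finite_nat_set_iff_bounded)
    then obtain n0 where n0: "\<forall>n\<in>bad. n < n0" by (rule exE)
    \<comment> \<open>Inputs of length \<open>k\<close> are treated at the parameter
      \<open>k + n0\<close>, beyond all exceptions; the outputs then even exceed
      \<open>k + n0\<close>.\<close>
    have "\<exists>C. csize C \<le> R (k + n0) \<and> lengthening A B (k + n0) k C" for k
    proof -
      have "k + n0 \<notin> bad" using bspec[OF n0, of "k + n0"] by linarith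
      then have "\<forall>k'\<le>k + n0. \<exists>C. csize C \<le> R (k + n0) \<and> lengthening A B (k + n0) k' C"
        unfolding bad_def by simp
      from this[rule_format, OF le_add1] show ?thesis .
    qed
    then have "\<forall>k. \<exists>C. csize C \<le> R (k + n0) \<and> lengthening A B (k + n0) k C" by (rule allI)
    then obtain C where "\<forall>k. csize (C k) \<le> R (k + n0) \<and> lengthening A B (k + n0) k (C k)"
      by (rule choice[THEN exE])
    then have C: "\<And>k. csize (C k) \<le> R (k + n0)" "\<And>k. lengthening A B (k + n0) k (C k)" by simp_all
    define f where "f x = decode_pairs (circ_eval (C (length x)) x)" for x
    show ?thesis
    proof (intro exI conjI allI)
      obtain P :: "nat poly" where P: "\<And>n. R n \<le> poly P n" using R unfolding poly_bounded_def by blast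
      have "poly_bounded (\<lambda>k. poly P (k + n0))" by (intro poly_bounded_intros)
      then obtain Q :: "nat poly" where Q: "\<And>k. poly P (k + n0) \<le> poly Q k" unfolding poly_bounded_def by blast
      have "csize (C k) \<le> poly Q k" for k by (rule order_trans[OF order_trans[OF C(1) P] Q])
      then have "poly_size C" unfolding poly_size_def by blast
      then show "Ppoly_computable f" unfolding Ppoly_computable_def f_def by blast
      fix x
      have fx: "length x + n0 < length (f x) \<and> (f x \<in> A \<longleftrightarrow> x \<in> B)"
        unfolding f_def by (rule C(2)[unfolded lengthening_def, rule_format, OF refl])
      then show "x \<in> B \<longleftrightarrow> f x \<in> A" by simp
      from fx have "length x + n0 < length (f x)" by simp
      then show "length x < length (f x)" by simp
    qed
  qed
qed

end
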